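(* Let $n\ge 1$, let $r\in\{\infty,\omega\}$, let $U_i$ $(i=1,2)$ be a neighborhood of $p_i\in\mathbb{R}^n$, and let $f_i:U_i\to\mathbb{R}^{n+1}$ $(i=1,2)$ be two $C^r$-frontal maps with unit normal vector fields $\nu_i$ along $f_i$ satisfying (a1) $f_1(U_1)$ is a subset of $f_2(U_2)$ and $P:=f_1(p_1)=f_2(p_2)$; (a2) $f_2$ is $U_2$-proper at $p_2$ and $f_2^{-1}(P)=\{p_2\}$; (a3) the regular set of $f_i$ $(i=1,2)$ is open and dense in $U_i$; (a4) each Legendrian lift $L_{f_i}$ $(i=1,2)$ is injective on a certain neighborhood of $p_i$ (if $f_i$ is a wave front, this condition is satisfied). Then there exists a homeomorphism $\psi:V_1\to V_2$ between certain connected neighborhoods $V_i$ $(i=1,2)$ of $p_i$ such that (1) $\overline{V_i}\subset U_i$ for $i=1,2$; (2) $f_1=f_2\circ\psi$ and $\nu_1=\pm\,\nu_2\circ\psi$ hold on $V_1$ (for one choice of the sign). Moreover, if $f_1$ and $f_2$ are wave fronts, then $\psi$ can be taken as a $C^r$-diffeomorphism.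
   Context: $C^\infty$ means smooth and $C^\omega$ means real analytic; neighborhoods on which $C^r$-maps are defined are open. A $C^r$-map $f:U\to\mathbb{R}^{n+1}$ on an open set $U\subset\mathbb{R}^n$ is a frontal (frontal map) if it admits a unit normal $C^r$-vector field $\nu:U\to S^n$ along $f$, i.e. $\nu(q)$ is a unit vector orthogonal to the image of $df_q$ for every $q\in U$ ($S^n$ is the unit sphere of $\mathbb{R}^{n+1}$). The Legendrian lift of $f$ is $L_f:=(f,\nu):U\to\mathbb{R}^{n+1}\times S^n$. If $L_f$ is an immersion, $f$ is called a wave front. The regular set of $f$ is the set of points at which $f$ is an immersion. For a continuous map $f:U\to\mathbb{R}^{n+1}$ and an open neighborhood $V$ of $p\in U$, $f$ is called $V$-proper at $p$ if for every $\epsilon>0$ there exists $\rho\in(0,\epsilon)$ such that $(f|_V)^{-1}(\overline{B(f(p),\rho)})$ is a compact subset of $V$, where $B(f(p),\rho)$ is the open ball of radius $\rho$ centered at $f(p)$ and $\overline{B(f(p),\rho)}$ its closure. *)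

theory Defs
  imports "HOL-Analysis.Analysis"
begin

primrec times_cont_diff_on ::
  "nat \<Rightarrow> ('a::euclidean_space \<Rightarrow> 'b::real_normed_vector) \<Rightarrow> 'a set \<Rightarrow> bool"
where
  "times_cont_diff_on 0 f U \<longleftrightarrow> continuous_on U f"
| "times_cont_diff_on (Suc k) f U \<longleftrightarrow>
     (\<forall>x\<in>U. f differentiable (at x)) \<and>
     (\<forall>v. times_cont_diff_on k (\<lambda>x. frechet_derivative f (at x) v) U)"

definition smooth_map_on ::
  "('a::euclidean_space \<Rightarrow> 'b::real_normed_vector) \<Rightarrow> 'a set \<Rightarrow> bool"
where
  "smooth_map_on f U \<longleftrightarrow> (\<forall>k. times_cont_diff_on k f U)"

(* Near each point, f is the sum of a power series in several variables; the
   coefficients are indexed by multi-indices \<alpha> :: 'n \<Rightarrow> nat, and has_sum is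
   unconditional (hence absolute, in finite dimension) convergence. *)
definition real_analytic_map_on ::
  "(real ^ 'n \<Rightarrow> 'b::real_normed_vector) \<Rightarrow> (real ^ 'n) set \<Rightarrow> bool"
where
  "real_analytic_map_on f U \<longleftrightarrow>
     (\<forall>p\<in>U. \<exists>\<delta>>0. \<exists>a :: ('n \<Rightarrow> nat) \<Rightarrow> 'b. ball p \<delta> \<subseteq> U \<and>
        (\<forall>x\<in>ball p \<delta>.
           ((\<lambda>\<alpha>. (\<Prod>i\<in>UNIV. (x $ i - p $ i) ^ \<alpha> i) *\<^sub>R a \<alpha>) has_sum f x) UNIV))"

datatype regularity = C_infinity | C_omega

primrec Cr_map_on ::
  "regularity \<Rightarrow> (real ^ 'n \<Rightarrow> 'b::real_normed_vector) \<Rightarrow> (real ^ 'n) set \<Rightarrow> bool"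
where
  "Cr_map_on C_infinity f U \<longleftrightarrow> smooth_map_on f U"
| "Cr_map_on C_omega f U \<longleftrightarrow> real_analytic_map_on f U"

definition Cr_diffeomorphism ::
  "regularity \<Rightarrow> (real ^ 'n) set \<Rightarrow> (real ^ 'n) set \<Rightarrow>
   (real ^ 'n \<Rightarrow> real ^ 'n) \<Rightarrow> (real ^ 'n \<Rightarrow> real ^ 'n) \<Rightarrow> bool"
where
  "Cr_diffeomorphism r V W \<psi> \<phi> \<longleftrightarrow>
     open V \<and> open W \<and> homeomorphism V W \<psi> \<phi> \<and> Cr_map_on r \<psi> V \<and> Cr_map_on r \<phi> W"

definition immersion_at :: "('a::real_normed_vector \<Rightarrow> 'b::real_normed_vector) \<Rightarrow> 'a \<Rightarrow> bool" where
  "immersion_at f q \<longleftrightarrow> f differentiable (at q) \<and> inj (frechet_derivative f (at q))"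

definition regular_set ::
  "('a::real_normed_vector \<Rightarrow> 'b::real_normed_vector) \<Rightarrow> 'a set \<Rightarrow> 'a set"
where
  "regular_set f U = {q \<in> U. immersion_at f q}"

(* A C^r map into the unit sphere (an embedded submanifold) is a C^r map into
   the ambient space all of whose values are unit vectors. *)
definition unit_normal_field ::
  "regularity \<Rightarrow> (real ^ 'n) set \<Rightarrow> (real ^ 'n \<Rightarrow> real ^ 'm) \<Rightarrow> (real ^ 'n \<Rightarrow> real ^ 'm) \<Rightarrow> bool"
where
  "unit_normal_field r U f \<nu> \<longleftrightarrow>
     Cr_map_on r \<nu> U \<and> \<nu> ` U \<subseteq> sphere 0 1 \<and>
     (\<forall>q\<in>U. \<forall>v. \<nu> q \<bullet> frechet_derivative f (at q) v = 0)"

definition frontal_map ::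
  "regularity \<Rightarrow> (real ^ 'n) set \<Rightarrow> (real ^ 'n \<Rightarrow> real ^ 'm) \<Rightarrow> bool"
where
  "frontal_map r U f \<longleftrightarrow>
     open U \<and> CARD('m) = CARD('n) + 1 \<and> Cr_map_on r f U \<and> (\<exists>\<nu>. unit_normal_field r U f \<nu>)"

definition legendrian_lift :: "('a \<Rightarrow> 'b) \<Rightarrow> ('a \<Rightarrow> 'b) \<Rightarrow> 'a \<Rightarrow> 'b \<times> 'b" where
  "legendrian_lift f \<nu> q = (f q, \<nu> q)"

(* Being an immersion into R^(n+1) x S^n is the same as being one into the
   ambient space R^(n+1) x R^(n+1). *)
definition wave_front ::
  "regularity \<Rightarrow> (real ^ 'n) set \<Rightarrow> (real ^ 'n \<Rightarrow> real ^ 'm) \<Rightarrow> (real ^ 'n \<Rightarrow> real ^ 'm) \<Rightarrow> bool"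
where
  "wave_front r U f \<nu> \<longleftrightarrow>
     frontal_map r U f \<and> unit_normal_field r U f \<nu> \<and>
     (\<forall>q\<in>U. immersion_at (legendrian_lift f \<nu>) q)"

definition locally_injective_at :: "('a::topological_space \<Rightarrow> 'b) \<Rightarrow> 'a set \<Rightarrow> 'a \<Rightarrow> bool" where
  "locally_injective_at L U p \<longleftrightarrow> (\<exists>W. open W \<and> p \<in> W \<and> W \<subseteq> U \<and> inj_on L W)"

definition proper_at ::
  "('a::topological_space \<Rightarrow> 'b::metric_space) \<Rightarrow> 'a set \<Rightarrow> 'a \<Rightarrow> bool"
where
  "proper_at f V p \<longleftrightarrow>
     (\<forall>\<epsilon>>0. \<exists>\<rho>. 0 < \<rho> \<and> \<rho> < \<epsilon> \<and> compact {x \<in> V. f x \<in> closure (ball (f p) \<rho>)})"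

end

theory Submission
  imports Defs
begin

text \<open>The idea is to recover the parameter from the Legendrian lift. A frontal germ may be far from
  injective, but its lift \<open>(f, \<nu>)\<close> is injective near the base point. So if every pair
  \<open>(f\<^sub>1 q, \<nu>\<^sub>1 q)\<close> with \<open>q\<close> near \<open>p\<^sub>1\<close> equals \<open>(f\<^sub>2 x, \<plusminus> \<nu>\<^sub>2 x)\<close> for some \<open>x\<close>, then \<open>q \<mapsto> x\<close> is the
  wanted \<open>\<psi>\<close>.

  Existence of \<open>x\<close> is the geometric core (\<open>common_tangent_space\<close>, \<open>normals_match_up_to_sign\<close>). The inclusion
  of images gives an \<open>x\<close> with \<open>f\<^sub>2 x = f\<^sub>1 q\<close>, but its tangent space could be a different one. Near a
  regular point of \<open>f\<^sub>1\<close> project \<open>\<real>\<^sup>n\<^sup>+\<^sup>1\<close> linearly to \<open>\<real>\<^sup>n\<close> so that the projection of \<open>f\<^sub>1\<close> becomes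
  a local homeomorphism, and cut the domain of \<open>f\<^sub>2\<close> into countably many compact pieces: on each of
  them the projection of \<open>f\<^sub>2\<close> has either a null image (its critical values, by Sard) or is injective and
  immersive. By Baire one piece covers an open part of the image of \<open>f\<^sub>1\<close>; it is not a critical one, since
  open sets are not null. On such a piece \<open>f\<^sub>1 = f\<^sub>2 \<circ> \<psi>\<close> with \<open>\<psi>\<close> differentiable, so the tangent spaces
  agree there, and the unit normals agree up to sign. The points \<open>q\<close> reached in this way are dense,
  and properness of \<open>f\<^sub>2\<close> extends the conclusion to all \<open>q\<close> by compactness.

  Properness together with \<open>f\<^sub>2\<^sup>-\<^sup>1(P) = {p\<^sub>2}\<close> confines all the points \<open>x\<close> to a compact set on which the lift of
  \<open>f\<^sub>2\<close> is injective, hence a homeomorphism onto its image. Therefore \<open>\<psi>\<close> is continuous; it is injective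
  because the lift of \<open>f\<^sub>1\<close> is, and invariance of domain makes it a homeomorphism between open sets
  (\<open>frontal_reparametrization\<close>). Signs are constant because normals vary continuously.

  For wave fronts the lifts are immersions with \<open>L\<^sub>1 = L\<^sub>2 \<circ> \<psi>\<close>, and a continuous map that is a lift
  of a \<open>C\<^sup>r\<close> map through a \<open>C\<^sup>r\<close> immersion is itself \<open>C\<^sup>r\<close> (\<open>Cr_lift\<close>). In the smooth case Cramer's rule
  expresses the derivative of \<open>\<psi>\<close> through \<open>\<psi>\<close> and smooth functions, and one bootstraps. In the
  analytic case the equation is solved by a contraction among convergent power series, and the solution
  must be \<open>\<psi>\<close>; the estimates use weighted \<open>\<ell>\<^sup>1\<close> norms of the coefficients, for which products and
  compositions cost nothing.\<close>

section \<open>Maps of class C-k\<close>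

lemma times_cont_diff_on_differentiable:
  "times_cont_diff_on (Suc k) f U \<Longrightarrow> x \<in> U \<Longrightarrow> (f has_derivative frechet_derivative f (at x)) (at x)"
  by (simp add: frechet_derivative_works)

lemma times_cont_diff_on_directional:
  "times_cont_diff_on (Suc k) f U \<Longrightarrow> times_cont_diff_on k (\<lambda>x. frechet_derivative f (at x) v) U"
  by simp

lemma times_cont_diff_on_cong:
  assumes U: "open U"
  shows "(\<And>x. x \<in> U \<Longrightarrow> f x = g x) \<Longrightarrow> times_cont_diff_on k f U \<Longrightarrow> times_cont_diff_on k g U"
proof (induction k arbitrary: f g)
  case 0
  then show ?case using continuous_on_cong[of U U f g] by simp
next
  case (Suc k)
  have der: "(g has_derivative frechet_derivative f (at x)) (at x)" if x: "x \<in> U" for x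
    using has_derivative_transform_within_open[OF times_cont_diff_on_differentiable[OF Suc.prems(2) x] U x]
      Suc.prems(1) by blast
  have eq: "frechet_derivative f (at x) = frechet_derivative g (at x)" if "x \<in> U" for x
    using frechet_derivative_at[OF der[OF that]] .
  have "times_cont_diff_on k (\<lambda>x. frechet_derivative g (at x) v) U" for v
    by (rule Suc.IH[OF _ times_cont_diff_on_directional[OF Suc.prems(2)]]) (simp only: eq)
  then show ?case using der unfolding times_cont_diff_on.simps differentiable_def by blast
qed

text \<open>Derivatives are named here by any formula that holds on the open set, so that the rules
  below need not mention \<open>frechet_derivative\<close> of a composite expression.\<close>

lemma times_cont_diff_on_SucI:
  assumes "open U" and der: "\<And>x. x \<in> U \<Longrightarrow> (f has_derivative D x) (at x)"
    and D: "\<And>v. times_cont_diff_on k (\<lambda>x. D x v) U"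
  shows "times_cont_diff_on (Suc k) f U"
proof -
  have "D x = frechet_derivative f (at x)" if "x \<in> U" for x
    using frechet_derivative_at[OF der[OF that]] .
  then have "times_cont_diff_on k (\<lambda>x. frechet_derivative f (at x) v) U" for v
    by (intro times_cont_diff_on_cong[OF \<open>open U\<close> _ D[of v]]) simp
  then show ?thesis using der unfolding times_cont_diff_on.simps differentiable_def by blast
qed

lemma times_cont_diff_on_Suc_imp: "times_cont_diff_on (Suc k) f U \<Longrightarrow> times_cont_diff_on k f U"
proof (induction k arbitrary: f)
  case 0
  then have "continuous_on U f"
    by (intro continuous_at_imp_continuous_on ballI differentiable_imp_continuous_within) simp
  then show ?case by simp
next
  case (Suc k)
  have "times_cont_diff_on k (\<lambda>x. frechet_derivative f (at x) v) U" for v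
    by (rule Suc.IH) (use Suc.prems in simp)
  then show ?case using Suc.prems by auto
qed

lemma times_cont_diff_on_continuous: "times_cont_diff_on k f U \<Longrightarrow> continuous_on U f"
proof (induction k)
  case (Suc k)
  then show ?case using times_cont_diff_on_Suc_imp by blast
qed simp

lemma times_cont_diff_on_subset: "times_cont_diff_on k f U \<Longrightarrow> V \<subseteq> U \<Longrightarrow> times_cont_diff_on k f V"
  by (induction k arbitrary: f) (auto intro: continuous_on_subset)

text \<open>This lets regularity of \<open>\<psi>\<close> be checked with a left inverse of a derivative chosen separately near each
  point.\<close>

lemma times_cont_diff_on_local:
  assumes "\<And>x. x \<in> U \<Longrightarrow> \<exists>N. open N \<and> x \<in> N \<and> times_cont_diff_on k f N"
  shows "times_cont_diff_on k f U"
  using assms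
proof (induction k arbitrary: f)
  case 0
  show ?case
    unfolding times_cont_diff_on.simps
  proof (rule continuous_at_imp_continuous_on, rule ballI)
    fix x assume "x \<in> U"
    then obtain N where "open N" "x \<in> N" "continuous_on N f" using 0 by force
    then show "continuous (at x) f" by (simp add: continuous_on_eq_continuous_at)
  qed
next
  case (Suc k)
  have "f differentiable (at x)" if "x \<in> U" for x using Suc.prems[OF that] by auto
  moreover have "times_cont_diff_on k (\<lambda>x. frechet_derivative f (at x) v) U" for v
    by (rule Suc.IH) (use Suc.prems in \<open>fastforce\<close>)
  ultimately show ?case by simp
qed

lemma times_cont_diff_on_const: "times_cont_diff_on k (\<lambda>_. c) U"
  by (induction k arbitrary: c) auto

lemma times_cont_diff_on_bounded_linear:
  assumes "open U" and h: "bounded_linear h"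
  shows "times_cont_diff_on k f U \<Longrightarrow> times_cont_diff_on k (\<lambda>x. h (f x)) U"
proof (induction k arbitrary: f)
  case 0
  then show ?case using continuous_on_compose2[OF linear_continuous_on[OF h, of UNIV]] by simp
next
  case (Suc k)
  show ?case
    by (rule times_cont_diff_on_SucI[OF \<open>open U\<close> bounded_linear.has_derivative[OF h times_cont_diff_on_differentiable[OF Suc.prems]]
          Suc.IH[OF times_cont_diff_on_directional[OF Suc.prems]]])
qed

lemma times_cont_diff_on_add:
  assumes "open U"
  shows "times_cont_diff_on k f U \<Longrightarrow> times_cont_diff_on k g U \<Longrightarrow> times_cont_diff_on k (\<lambda>x. f x + g x) U"
proof (induction k arbitrary: f g)
  case 0
  then show ?case by (simp add: continuous_on_add)
next
  case (Suc k)
  show ?case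
    by (rule times_cont_diff_on_SucI[OF \<open>open U\<close> has_derivative_add[OF times_cont_diff_on_differentiable[OF Suc.prems(1)]
          times_cont_diff_on_differentiable[OF Suc.prems(2)]]
          Suc.IH[OF times_cont_diff_on_directional[OF Suc.prems(1)] times_cont_diff_on_directional[OF Suc.prems(2)]]])
qed

lemma times_cont_diff_on_sum:
  assumes "open U" "finite A" "\<And>i. i \<in> A \<Longrightarrow> times_cont_diff_on k (f i) U"
  shows "times_cont_diff_on k (\<lambda>x. \<Sum>i\<in>A. f i x) U"
  using assms(2,3) by (induction A) (auto intro: times_cont_diff_on_const times_cont_diff_on_add assms(1))

lemma times_cont_diff_on_bilinear:
  assumes "open U" and mul: "bounded_bilinear mul"
  shows "times_cont_diff_on k f U \<Longrightarrow> times_cont_diff_on k g U \<Longrightarrow>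
    times_cont_diff_on k (\<lambda>x. mul (f x) (g x)) U"
proof (induction k arbitrary: f g)
  case 0
  then show ?case by (simp add: bounded_bilinear.continuous_on[OF mul])
next
  case (Suc k)
  show ?case
    by (rule times_cont_diff_on_SucI[OF \<open>open U\<close> bounded_bilinear.FDERIV[OF mul times_cont_diff_on_differentiable[OF Suc.prems(1)]
          times_cont_diff_on_differentiable[OF Suc.prems(2)]]], assumption, assumption,
        rule times_cont_diff_on_add[OF \<open>open U\<close>
          Suc.IH[OF times_cont_diff_on_Suc_imp[OF Suc.prems(1)] times_cont_diff_on_directional[OF Suc.prems(2)]]
          Suc.IH[OF times_cont_diff_on_directional[OF Suc.prems(1)] times_cont_diff_on_Suc_imp[OF Suc.prems(2)]]])
qed

lemmas times_cont_diff_on_scaleR = times_cont_diff_on_bilinear[OF _ bounded_bilinear_scaleR]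

lemmas times_cont_diff_on_mult = times_cont_diff_on_bilinear[OF _ bounded_bilinear_mult]

lemma times_cont_diff_on_prod:
  fixes f :: "'i \<Rightarrow> 'a::euclidean_space \<Rightarrow> real"
  assumes "open U" "finite A" "\<And>i. i \<in> A \<Longrightarrow> times_cont_diff_on k (f i) U"
  shows "times_cont_diff_on k (\<lambda>x. \<Prod>i\<in>A. f i x) U"
  using assms(2,3) by (induction A) (auto intro: times_cont_diff_on_const times_cont_diff_on_mult assms(1))

lemma times_cont_diff_on_inverse:
  fixes f :: "'a::euclidean_space \<Rightarrow> real"
  assumes U: "open U" and nz: "\<And>x. x \<in> U \<Longrightarrow> f x \<noteq> 0"
  shows "times_cont_diff_on k f U \<Longrightarrow> times_cont_diff_on k (\<lambda>x. inverse (f x)) U"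
proof (induction k)
  case 0
  then show ?case using nz by (simp add: continuous_on_inverse)
next
  case (Suc k)
  have IH: "times_cont_diff_on k (\<lambda>x. inverse (f x)) U"
    by (rule Suc.IH[OF times_cont_diff_on_Suc_imp[OF Suc.prems]])
  show ?case
  proof (rule times_cont_diff_on_SucI[OF U])
    show "((\<lambda>x. inverse (f x)) has_derivative
        (\<lambda>v. - (inverse (f x) * frechet_derivative f (at x) v * inverse (f x)))) (at x)" if "x \<in> U" for x
      using Deriv.has_derivative_inverse[OF nz[OF that] times_cont_diff_on_differentiable[OF Suc.prems that]] .
    show "times_cont_diff_on k
        (\<lambda>x. - (inverse (f x) * frechet_derivative f (at x) v * inverse (f x))) U" for v
      by (intro times_cont_diff_on_bounded_linear[OF U bounded_linear_minus[OF bounded_linear_ident]]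
          times_cont_diff_on_mult[OF U] IH times_cont_diff_on_directional[OF Suc.prems])
  qed
qed

lemma times_cont_diff_on_components:
  fixes f :: "'a::euclidean_space \<Rightarrow> 'b::euclidean_space"
  assumes "open U" "\<And>b. b \<in> Basis \<Longrightarrow> times_cont_diff_on k (\<lambda>x. f x \<bullet> b) U"
  shows "times_cont_diff_on k f U"
proof -
  have "times_cont_diff_on k (\<lambda>x. \<Sum>b\<in>Basis. (f x \<bullet> b) *\<^sub>R b) U"
    by (intro times_cont_diff_on_sum times_cont_diff_on_scaleR times_cont_diff_on_const assms finite_Basis)
  then show ?thesis by (simp add: euclidean_representation)
qed

text \<open>Expanding the inner derivative in a basis turns the chain rule into a sum of products
  of a directional derivative of \<open>g\<close> after \<open>f\<close> (induction hypothesis) and a component of the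
  derivative of \<open>f\<close>.\<close>

lemma times_cont_diff_on_compose:
  fixes f :: "'a::euclidean_space \<Rightarrow> 'b::euclidean_space" and g :: "'b \<Rightarrow> 'c::real_normed_vector"
  assumes U: "open U" and fU: "f ` U \<subseteq> W"
  shows "times_cont_diff_on k g W \<Longrightarrow> times_cont_diff_on k f U \<Longrightarrow> times_cont_diff_on k (\<lambda>x. g (f x)) U"
proof (induction k arbitrary: g)
  case 0
  then show ?case using continuous_on_compose2[of W g U f] fU by simp
next
  case (Suc k)
  let ?g' = "\<lambda>y. frechet_derivative g (at y)" and ?f' = "\<lambda>x. frechet_derivative f (at x)"
  have g': "(g has_derivative ?g' (f x)) (at (f x))" if "x \<in> U" for x
    using times_cont_diff_on_differentiable[OF Suc.prems(1)] that fU by blast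
  show ?case
  proof (rule times_cont_diff_on_SucI[OF U])
    fix x assume x: "x \<in> U"
    have "((\<lambda>x. g (f x)) has_derivative (\<lambda>v. ?g' (f x) (?f' x v))) (at x)"
      by (rule has_derivative_compose[OF times_cont_diff_on_differentiable[OF Suc.prems(2) x] g'[OF x]])
    moreover have "?g' (f x) (?f' x v) = (\<Sum>b\<in>Basis. (?f' x v \<bullet> b) *\<^sub>R ?g' (f x) b)" for v
    proof -
      have lin: "linear (?g' (f x))" using g'[OF x] has_derivative_linear by blast
      have "?g' (f x) (?f' x v) = ?g' (f x) (\<Sum>b\<in>Basis. (?f' x v \<bullet> b) *\<^sub>R b)"
        by (simp add: euclidean_representation)
      also have "\<dots> = (\<Sum>b\<in>Basis. (?f' x v \<bullet> b) *\<^sub>R ?g' (f x) b)"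
        by (simp add: linear_sum[OF lin] linear_cmul[OF lin])
      finally show ?thesis .
    qed
    ultimately show "((\<lambda>x. g (f x)) has_derivative (\<lambda>v. \<Sum>b\<in>Basis. (?f' x v \<bullet> b) *\<^sub>R ?g' (f x) b)) (at x)"
      by simp
  next
    fix v
    show "times_cont_diff_on k (\<lambda>x. \<Sum>b\<in>Basis. (?f' x v \<bullet> b) *\<^sub>R ?g' (f x) b) U"
      by (intro times_cont_diff_on_sum[OF U finite_Basis] times_cont_diff_on_scaleR[OF U]
          times_cont_diff_on_bounded_linear[OF U bounded_linear_inner_left] times_cont_diff_on_directional[OF Suc.prems(2)]
          Suc.IH[OF times_cont_diff_on_directional[OF Suc.prems(1)] times_cont_diff_on_Suc_imp[OF Suc.prems(2)]])
  qed
qed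

lemma times_cont_diff_on_det:
  fixes A :: "'a::euclidean_space \<Rightarrow> real ^ 'n ^ 'n"
  assumes U: "open U" and "\<And>i j. times_cont_diff_on k (\<lambda>x. A x $ i $ j) U"
  shows "times_cont_diff_on k (\<lambda>x. det (A x)) U"
  unfolding det_def
  by (intro times_cont_diff_on_sum[OF U] times_cont_diff_on_mult[OF U] times_cont_diff_on_prod[OF U] times_cont_diff_on_const assms finite_permutations) simp_all

section \<open>Smooth lifts through immersions\<close>

lemma eventually_derivative_bound:
  assumes "(f has_derivative f') (at q)" and e: "0 < e"
  shows "\<forall>\<^sub>F z in nhds q. norm (f z - f q - f' (z - q)) \<le> e * norm (z - q)"
  using assms unfolding has_derivative_at_alt eventually_nhds_metric dist_norm by blast

text \<open>Composing with a left inverse \<open>\<Lambda>\<close> of \<open>A\<close> one may think of \<open>g\<close> as having derivative the identity.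
  Then \<open>\<psi> z - \<psi> q\<close> differs from \<open>\<Lambda> (f z) - \<Lambda> (f q)\<close> by little compared with itself, hence is
  \<open>O(norm (z - q))\<close>, and the difference is negligible. Continuity of \<open>\<psi>\<close> at the one point \<open>q\<close> suffices.\<close>

theorem has_derivative_lift:
  fixes \<psi> :: "'a::real_normed_vector \<Rightarrow> 'b::real_normed_vector" and g :: "'b \<Rightarrow> 'c::real_normed_vector"
  assumes g: "(g has_derivative A) (at (\<psi> q))" and \<Lambda>: "bounded_linear \<Lambda>" and inv: "\<And>v. \<Lambda> (A v) = v"
    and f: "(f has_derivative B) (at q)" and cont: "isCont \<psi> q"
    and eq: "\<forall>\<^sub>F z in nhds q. g (\<psi> z) = f z"
  shows "(\<psi> has_derivative (\<lambda>v. \<Lambda> (B v))) (at q)"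
proof -
  let ?G = "\<lambda>x. \<Lambda> (g x)" and ?F = "\<lambda>z. \<Lambda> (f z)" and ?B = "\<lambda>v. \<Lambda> (B v)"
  have G: "(?G has_derivative (\<lambda>v. v)) (at (\<psi> q))"
    using bounded_linear.has_derivative[OF \<Lambda> g] by (simp add: inv)
  have F: "(?F has_derivative ?B) (at q)"
    using bounded_linear.has_derivative[OF \<Lambda> f] .
  have B: "bounded_linear ?B" using F has_derivative_bounded_linear by blast
  have eqq: "g (\<psi> q) = f q" using eventually_nhds_x_imp_x[OF eq] .
  have lim: "filterlim \<psi> (nhds (\<psi> q)) (nhds q)"
    using cont isCont_def tendsto_at_iff_tendsto_nhds by blast
  have G_est: "\<forall>\<^sub>F z in nhds q. norm (?F z - ?F q - (\<psi> z - \<psi> q)) \<le> e * norm (\<psi> z - \<psi> q)" if "0 < e" for e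
    using eventually_compose_filterlim[OF eventually_derivative_bound[OF G that] lim] eq
    by eventually_elim (simp add: eqq)
  obtain K where K: "0 < K" "\<And>v. norm (?B v) \<le> norm v * K"
    using bounded_linear.pos_bounded[OF B] by blast
  have lip: "\<forall>\<^sub>F z in nhds q. norm (\<psi> z - \<psi> q) \<le> 2 * (K + 1) * norm (z - q)"
    using G_est[OF half_gt_zero[OF zero_less_one]] eventually_derivative_bound[OF F zero_less_one]
  proof eventually_elim
    case (elim z)
    have "norm (\<psi> z - \<psi> q) \<le> norm (?F z - ?F q) + norm (?F z - ?F q - (\<psi> z - \<psi> q))"
      using norm_triangle_ineq4[of "?F z - ?F q" "?F z - ?F q - (\<psi> z - \<psi> q)"] by simp
    then have "norm (\<psi> z - \<psi> q) \<le> 2 * norm (?F z - ?F q)" using elim(1) by simp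
    also have "norm (?F z - ?F q) \<le> norm (?F z - ?F q - ?B (z - q)) + norm (?B (z - q))"
      using norm_triangle_ineq[of "?F z - ?F q - ?B (z - q)" "?B (z - q)"] by simp
    also have "\<dots> \<le> (K + 1) * norm (z - q)"
      using elim(2) K(2)[of "z - q"] by (simp add: algebra_simps)
    finally show ?case by (simp only: mult.assoc)
  qed
  show ?thesis
    unfolding has_derivative_at_alt
  proof (intro conjI B allI impI)
    fix e :: real assume e: "0 < e"
    \<comment> \<open>so that \<open>e1\<close> times the Lipschitz constant \<open>2 * (K + 1)\<close> of \<open>\<psi>\<close> at \<open>q\<close> is \<open>e / 2\<close>\<close>
    define e1 where "e1 = e / (4 * (K + 1))"
    have e1: "0 < e1" "e1 * (2 * (K + 1)) = e / 2" using e K(1) by (simp_all add: e1_def field_simps)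
    have "\<forall>\<^sub>F z in nhds q. norm (\<psi> z - \<psi> q - ?B (z - q)) \<le> e * norm (z - q)"
      using G_est[OF e1(1)] eventually_derivative_bound[OF F half_gt_zero[OF e]] lip
    proof eventually_elim
      case (elim z)
      have split: "\<psi> z - \<psi> q - ?B (z - q) =
          (?F z - ?F q - ?B (z - q)) - (?F z - ?F q - (\<psi> z - \<psi> q))"
        by (simp add: algebra_simps)
      have "norm (\<psi> z - \<psi> q - ?B (z - q)) \<le>
          norm (?F z - ?F q - ?B (z - q)) + norm (?F z - ?F q - (\<psi> z - \<psi> q))"
        unfolding split by (rule norm_triangle_ineq4)
      also have "\<dots> \<le> e / 2 * norm (z - q) + e1 * norm (\<psi> z - \<psi> q)"
        using elim by simp
      also have "e1 * norm (\<psi> z - \<psi> q) \<le> e1 * (2 * (K + 1) * norm (z - q))"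
        using elim e1 by (intro mult_left_mono) auto
      also have "\<dots> = e / 2 * norm (z - q)" using e1(2) by (metis mult.assoc)
      finally show ?case by simp
    qed
    then show "\<exists>d>0. \<forall>y. norm (y - q) < d \<longrightarrow> norm (\<psi> y - \<psi> q - ?B (y - q)) \<le> e * norm (y - q)"
      unfolding eventually_nhds_metric dist_norm by blast
  qed
qed

lemma derivative_left_inverse:
  fixes L :: "'a::euclidean_space \<Rightarrow> 'b::euclidean_space"
  assumes "immersion_at L x"
  obtains \<Lambda> where "bounded_linear \<Lambda>" "\<And>v. \<Lambda> (frechet_derivative L (at x) v) = v"
proof -
  have "linear (frechet_derivative L (at x))"
    using assms unfolding immersion_at_def frechet_derivative_works by (blast dest: has_derivative_linear)
  then obtain \<Lambda> where "linear \<Lambda>" "\<Lambda> \<circ> frechet_derivative L (at x) = id"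
    using assms linear_injective_left_inverse unfolding immersion_at_def by blast
  then show thesis using that linear_conv_bounded_linear by (metis comp_apply id_apply)
qed

text \<open>The kernel of the derivative of \<open>f\<close> is contained in that of \<open>\<Lambda> \<circ> f\<close>.\<close>

lemma immersion_at_of_linear_image:
  assumes "bounded_linear \<Lambda>" "f differentiable (at x)" "immersion_at (\<lambda>z. \<Lambda> (f z)) x"
  shows "immersion_at f x"
proof -
  have "(f has_derivative frechet_derivative f (at x)) (at x)"
    using assms(2) by (simp add: frechet_derivative_works)
  from frechet_derivative_at[OF bounded_linear.has_derivative[OF assms(1) this]]
  have "(\<lambda>v. \<Lambda> (frechet_derivative f (at x) v)) = frechet_derivative (\<lambda>z. \<Lambda> (f z)) (at x)" .
  then have "inj (\<lambda>v. \<Lambda> (frechet_derivative f (at x) v))"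
    using assms(3) by (simp add: immersion_at_def)
  then have "inj (frechet_derivative f (at x))"
    unfolding inj_def by metis
  then show ?thesis using assms(2) by (simp add: immersion_at_def)
qed

text \<open>Bootstrapping. Differentiating \<open>L2 \<circ> \<psi> = L1\<close> and applying a fixed left inverse \<open>\<Lambda>\<close> of the derivative of
  \<open>L2\<close> at one point gives a square linear system \<open>A (\<psi> q) (D q v) = b q\<close>, solvable nearby by Cramer's rule.
  Its coefficients are as smooth as \<open>\<psi>\<close>, so \<open>\<psi>\<close> has one derivative more than was known.\<close>

theorem smooth_lift:
  fixes L1 L2 :: "real ^ 'n \<Rightarrow> 'c::euclidean_space" and \<psi> :: "real ^ 'n \<Rightarrow> real ^ 'n"
  assumes V: "open V" and L1: "smooth_map_on L1 V" and L2: "smooth_map_on L2 W"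
    and cont: "continuous_on V \<psi>" and sub: "\<psi> ` V \<subseteq> W" and eq: "\<And>x. x \<in> V \<Longrightarrow> L2 (\<psi> x) = L1 x"
    and imm: "\<And>x. x \<in> W \<Longrightarrow> immersion_at L2 x" and W: "open W"
  shows "smooth_map_on \<psi> V"
proof -
  let ?D1 = "\<lambda>x. frechet_derivative L1 (at x)" and ?D2 = "\<lambda>x. frechet_derivative L2 (at x)"
  have L1k: "times_cont_diff_on k L1 V" and L2k: "times_cont_diff_on k L2 W" for k
    using L1 L2 by (auto simp: smooth_map_on_def)
  have der2: "(L2 has_derivative ?D2 (\<psi> q)) (at (\<psi> q))" if "q \<in> V" for q
    using times_cont_diff_on_differentiable[OF L2k] sub that by blast
  have der: "\<exists>D. (\<psi> has_derivative D) (at q)" if q: "q \<in> V" for q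
  proof -
    obtain \<Lambda> where \<Lambda>: "bounded_linear \<Lambda>" "\<And>v. \<Lambda> (?D2 (\<psi> q) v) = v"
      using derivative_left_inverse imm sub q by blast
    have "isCont \<psi> q" using cont V q continuous_on_eq_continuous_at by blast
    moreover have "\<forall>\<^sub>F z in nhds q. L2 (\<psi> z) = L1 z"
      unfolding eventually_nhds using V q eq by blast
    ultimately show ?thesis
      using has_derivative_lift[where \<psi> = \<psi> and q = q, OF der2[OF q] \<Lambda> times_cont_diff_on_differentiable[OF L1k q]]
      by blast
  qed
  define D where "D q = frechet_derivative \<psi> (at q)" for q
  have D: "(\<psi> has_derivative D q) (at q)" if "q \<in> V" for q
    using der[OF that] frechet_derivative_at unfolding D_def by metis
  have chain: "?D2 (\<psi> q) (D q v) = ?D1 q v" if q: "q \<in> V" for q v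
  proof -
    have "((\<lambda>x. L2 (\<psi> x)) has_derivative (\<lambda>v. ?D2 (\<psi> q) (D q v))) (at q)"
      by (rule has_derivative_compose[OF D[OF q] der2[OF q]])
    then have "(L1 has_derivative (\<lambda>v. ?D2 (\<psi> q) (D q v))) (at q)"
      by (rule has_derivative_transform_within_open[OF _ V q eq])
    from has_derivative_unique[OF this times_cont_diff_on_differentiable[OF L1k q]] show ?thesis by (rule fun_cong)
  qed
  have "times_cont_diff_on k \<psi> V" for k
  proof (induction k)
    case 0
    then show ?case using cont by simp
  next
    case (Suc k)
    show ?case
    proof (rule times_cont_diff_on_SucI[OF V D])
      fix v
      show "times_cont_diff_on k (\<lambda>q. D q v) V"
      proof (rule times_cont_diff_on_local)
        fix q0 assume q0: "q0 \<in> V"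
        obtain \<Lambda> where \<Lambda>: "bounded_linear \<Lambda>" "\<And>v. \<Lambda> (?D2 (\<psi> q0) v) = v"
          using derivative_left_inverse imm sub q0 by blast
        define A :: "real ^ 'n \<Rightarrow> real ^ 'n ^ 'n" where
          "A x = matrix (\<lambda>v. \<Lambda> (?D2 x v))" for x
        define b where "b q = \<Lambda> (?D1 q v)" for q
        have Ab: "A (\<psi> q) *v D q v = b q" if q: "q \<in> V" for q
        proof -
          have "linear (\<lambda>v. \<Lambda> (?D2 (\<psi> q) v))"
            using has_derivative_linear[OF bounded_linear.has_derivative[OF \<Lambda>(1) der2[OF q]]] .
          then show ?thesis unfolding A_def b_def by (simp add: matrix_works chain[OF q])
        qed
        have A_ij: "times_cont_diff_on l (\<lambda>x. A x $ i $ j) W" for i j l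
        proof -
          have "bounded_linear (\<lambda>w. \<Lambda> w $ i)"
            by (rule bounded_linear_compose[OF bounded_linear_vec_nth \<Lambda>(1)])
          from times_cont_diff_on_bounded_linear[OF W this times_cont_diff_on_directional[OF L2k]]
          show ?thesis by (simp add: A_def matrix_def)
        qed
        have A\<psi>: "times_cont_diff_on k (\<lambda>q. A (\<psi> q) $ i $ j) V" for i j
          by (rule times_cont_diff_on_compose[OF V sub A_ij Suc.IH])
        \<comment> \<open>the neighbourhood of \<open>q0\<close> on which the linear system is uniquely solvable; at \<open>q0\<close> its matrix is the identity\<close>
        define N where "N = {q \<in> V. det (A (\<psi> q)) \<noteq> 0}"
        have detk: "times_cont_diff_on k (\<lambda>q. det (A (\<psi> q))) V"
          by (rule times_cont_diff_on_det[OF V A\<psi>])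
        have "open (V \<inter> (\<lambda>q. det (A (\<psi> q))) -` (- {0}))"
          by (rule continuous_open_preimage[OF times_cont_diff_on_continuous[OF detk] V]) auto
        then have N: "open N" by (simp add: N_def vimage_def Int_def)
        have NV: "N \<subseteq> V" by (auto simp: N_def)
        have "A (\<psi> q0) = mat 1" unfolding A_def \<Lambda>(2) using matrix_id_mat_1 by (simp add: id_def)
        then have q0N: "q0 \<in> N" using q0 by (simp add: N_def)
        let ?M = "\<lambda>q l. \<chi> i j. if j = l then b q $ i else A (\<psi> q) $ i $ j"
        have bk: "times_cont_diff_on k (\<lambda>q. b q $ i) V" for i
        proof -
          have "bounded_linear (\<lambda>w. \<Lambda> w $ i)"
            by (rule bounded_linear_compose[OF bounded_linear_vec_nth \<Lambda>(1)])
          from times_cont_diff_on_bounded_linear[OF V this times_cont_diff_on_directional[OF L1k]] show ?thesis by (simp add: b_def)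
        qed
        have Mk: "times_cont_diff_on k (\<lambda>q. ?M q l $ i $ j) N" for l i j
          using times_cont_diff_on_subset[OF bk NV] times_cont_diff_on_subset[OF A\<psi> NV] by (cases "j = l") auto
        have quot: "times_cont_diff_on k (\<lambda>q. det (?M q l) * inverse (det (A (\<psi> q)))) N" for l
          by (intro times_cont_diff_on_mult[OF N] times_cont_diff_on_det[OF N Mk] times_cont_diff_on_inverse[OF N] times_cont_diff_on_subset[OF detk NV])
            (simp add: N_def)
        have "times_cont_diff_on k (\<lambda>q. D q v) N"
        proof (rule times_cont_diff_on_components[OF N])
          fix e :: "real ^ 'n" assume "e \<in> Basis"
          then obtain l where e: "e = axis l 1" by (auto simp: Basis_vec_def)
          show "times_cont_diff_on k (\<lambda>q. D q v \<bullet> e) N"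
          proof (rule times_cont_diff_on_cong[OF N _ quot[of l]])
            fix q assume "q \<in> N"
            then have "det (A (\<psi> q)) \<noteq> 0" "q \<in> V" by (auto simp: N_def)
            from cramer[OF this(1), THEN iffD1, OF Ab[OF this(2)]]
            have "D q v = (\<chi> l. det (?M q l) / det (A (\<psi> q)))" .
            then show "det (?M q l) * inverse (det (A (\<psi> q))) = D q v \<bullet> e"
              by (simp add: e inner_axis divide_inverse)
          qed
        qed
        then show "\<exists>N. open N \<and> q0 \<in> N \<and> times_cont_diff_on k (\<lambda>q. D q v) N"
          using N q0N by blast
      qed
    qed
  qed
  then show ?thesis by (simp add: smooth_map_on_def)
qed

section \<open>Power series on cubes with weighted absolute convergence\<close>

definition monomial :: "('n::finite \<Rightarrow> nat) \<Rightarrow> real ^ 'n \<Rightarrow> real" where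
  "monomial m y = (\<Prod>i\<in>UNIV. (y $ i) ^ m i)"

definition total_degree :: "('n::finite \<Rightarrow> nat) \<Rightarrow> nat" where
  "total_degree m = (\<Sum>i\<in>UNIV. m i)"

text \<open>The index type \<open>'k\<close> is arbitrary and \<open>m\<close> may repeat multi-indices. Sums, products
  and substitutions of series can then be indexed by sums, products and sequences of the index sets, and terms
  with equal multi-indices are collected only once, at the very end (\<open>cube_series_regroup\<close>).\<close>

definition cube_expansion ::
    "nat \<Rightarrow> real \<Rightarrow> ('k \<Rightarrow> real) \<Rightarrow> ('k \<Rightarrow> 'n \<Rightarrow> nat) \<Rightarrow> real \<Rightarrow> (real ^ 'n \<Rightarrow> real) \<Rightarrow> bool" where
  "cube_expansion d r c m S f \<longleftrightarrow>
     (\<forall>k. c k = 0 \<or> d \<le> total_degree (m k)) \<and>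
     ((\<lambda>k. \<bar>c k\<bar> * r ^ total_degree (m k)) has_sum S) UNIV \<and>
     (\<forall>y. (\<forall>i. \<bar>y $ i\<bar> \<le> r) \<longrightarrow> ((\<lambda>k. c k * monomial (m k) y) has_sum f y) UNIV)"

text \<open>The norm bound \<open>M\<close> is the weighted \<open>\<ell>\<^sup>1\<close> norm of some expansion of \<open>f\<close>. With repeated
  multi-indices the expansion is not unique, but only upper bounds for its norm matter.
  The degree \<open>d\<close> is a lower bound for the order of vanishing at 0.\<close>

definition cube_series :: "nat \<Rightarrow> real \<Rightarrow> real \<Rightarrow> (real ^ 'n \<Rightarrow> real) \<Rightarrow> bool" where
  "cube_series d r M f \<longleftrightarrow> (\<exists>(c :: nat \<Rightarrow> real) m S. cube_expansion d r c m S f \<and> S \<le> M)"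

lemma cube_expansionD:
  assumes "cube_expansion d r c m S f"
  shows "c k = 0 \<or> d \<le> total_degree (m k)"
    and "((\<lambda>k. \<bar>c k\<bar> * r ^ total_degree (m k)) has_sum S) UNIV"
    and "(\<And>i. \<bar>y $ i\<bar> \<le> r) \<Longrightarrow> ((\<lambda>k. c k * monomial (m k) y) has_sum f y) UNIV"
  using assms by (auto simp: cube_expansion_def)

lemma abs_monomial_le:
  assumes "\<And>i. \<bar>y $ i\<bar> \<le> r"
  shows "\<bar>monomial m y\<bar> \<le> r ^ total_degree m"
  unfolding monomial_def total_degree_def power_sum abs_prod power_abs
  by (intro prod_mono) (auto intro: power_mono assms)

lemma monomial_add: "monomial (\<lambda>i. m i + m' i) y = monomial m y * monomial m' y"
  by (simp add: monomial_def power_add prod.distrib)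

lemma total_degree_add: "total_degree (\<lambda>i. m i + m' i) = total_degree m + total_degree m'"
  by (simp add: total_degree_def sum.distrib)

text \<open>Any countable index type can be embedded in the natural numbers, with zero coefficients
  outside the image.\<close>

lemma cube_seriesI:
  fixes c :: "'k::countable \<Rightarrow> real" and m :: "'k \<Rightarrow> 'n::finite \<Rightarrow> nat"
  assumes deg: "\<And>k. c k = 0 \<or> d \<le> total_degree (m k)"
    and S: "((\<lambda>k. \<bar>c k\<bar> * r ^ total_degree (m k)) has_sum S) UNIV" and "S \<le> M"
    and f: "\<And>y. (\<And>i. \<bar>y $ i\<bar> \<le> r) \<Longrightarrow> ((\<lambda>k. c k * monomial (m k) y) has_sum f y) UNIV"
  shows "cube_series d r M f"
proof -
  define c' where "c' = (\<lambda>j. if j \<in> range (to_nat :: 'k \<Rightarrow> nat) then c (from_nat j) else 0)"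
  define m' where "m' = (\<lambda>j::nat. m (from_nat j))"
  have transfer: "((\<lambda>j. g (c' j) (m' j)) has_sum s) UNIV"
    if "\<And>k. g 0 k = 0" "((\<lambda>k. g (c k) (m k)) has_sum s) UNIV" for g :: "real \<Rightarrow> ('n \<Rightarrow> nat) \<Rightarrow> real" and s
  proof -
    have "((\<lambda>j. g (c' j) (m' j)) has_sum s) (range (to_nat :: 'k \<Rightarrow> nat))"
      by (subst has_sum_reindex) (use that(2) in \<open>auto simp: c'_def m'_def o_def\<close>)
    then show ?thesis
      by (rule has_sum_cong_neutral[THEN iffD1, rotated -1]) (auto simp: c'_def that(1))
  qed
  have 1: "((\<lambda>j. \<bar>c' j\<bar> * r ^ total_degree (m' j)) has_sum S) UNIV"
    using transfer[of "\<lambda>c m. \<bar>c\<bar> * r ^ total_degree m" S] S by simp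
  have 2: "((\<lambda>j. c' j * monomial (m' j) y) has_sum f y) UNIV" if "\<And>i. \<bar>y $ i\<bar> \<le> r" for y
    using transfer[of "\<lambda>c m. c * monomial m y" "f y"] f[OF that] by simp
  have 3: "c' j = 0 \<or> d \<le> total_degree (m' j)" for j
    using deg[of "from_nat j"] by (auto simp: c'_def m'_def)
  show ?thesis unfolding cube_series_def cube_expansion_def
    using 1 2 3 \<open>S \<le> M\<close> by (intro exI[of _ c'] exI[of _ m'] exI[of _ S]) auto
qed

lemma cube_seriesE:
  assumes "cube_series d r M f"
  obtains c :: "nat \<Rightarrow> real" and m S where "cube_expansion d r c m S f" "S \<le> M"
  using assms unfolding cube_series_def by blast

lemma cube_series_nonneg:
  assumes "cube_series d r M f" "0 \<le> r"
  shows "0 \<le> M"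
proof -
  obtain c :: "nat \<Rightarrow> real" and m S where f: "cube_expansion d r c m S f" "S \<le> M"
    using cube_seriesE[OF assms(1)] by blast
  have "0 \<le> S" by (rule has_sum_nonneg[OF cube_expansionD(2)[OF f(1)]]) (use assms(2) in auto)
  then show ?thesis using f(2) by simp
qed

lemma cube_series_weaken_bound: "cube_series d r M f \<Longrightarrow> M \<le> M' \<Longrightarrow> cube_series d r M' f"
  unfolding cube_series_def by (elim exE conjE) (intro exI conjI, assumption, simp)

lemma cube_series_bound:
  assumes "cube_series d r M f" "0 \<le> r" "\<And>i. \<bar>y $ i\<bar> \<le> r"
  shows "\<bar>f y\<bar> \<le> M"
proof -
  obtain c :: "nat \<Rightarrow> real" and m S where f: "cube_expansion d r c m S f" "S \<le> M"
    using cube_seriesE[OF assms(1)] by blast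
  note * = cube_expansionD(2)[OF f(1)] f(2) cube_expansionD(3)[OF f(1) assms(3)]
  have **: "\<bar>c k * monomial (m k) y\<bar> \<le> \<bar>c k\<bar> * r ^ total_degree (m k)" for k
    unfolding abs_mult by (intro mult_left_mono abs_monomial_le assms) auto
  then have "(\<lambda>k. \<bar>c k * monomial (m k) y\<bar>) summable_on UNIV"
    by (intro summable_on_comparison_test[OF has_sum_imp_summable[OF *(1)]]) auto
  then have "((\<lambda>k. \<bar>c k * monomial (m k) y\<bar>) has_sum (\<Sum>\<^sub>\<infinity>k. \<bar>c k * monomial (m k) y\<bar>)) UNIV"
    by (rule has_sum_infsum)
  with ** have "\<bar>f y\<bar> \<le> (\<Sum>\<^sub>\<infinity>k. \<bar>c k * monomial (m k) y\<bar>)"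
    using norm_has_sum_bound[OF _ *(3)] by simp
  also have "\<dots> \<le> S"
    using has_sum_mono[OF has_sum_infsum *(1)] ** \<open>_ summable_on UNIV\<close> by blast
  finally show ?thesis using *(2) by simp
qed

text \<open>A series of expansions whose norms are summable is again an expansion: the double family of terms is
  absolutely summable, hence may be summed in either order.\<close>

lemma cube_series_suminf:
  fixes f :: "'k::countable \<Rightarrow> real ^ 'n \<Rightarrow> real"
  assumes r: "0 \<le> r" and f: "\<And>k. cube_series d r (M k) (f k)" and M: "(M has_sum S) UNIV"
    and g: "\<And>y. (\<And>i. \<bar>y $ i\<bar> \<le> r) \<Longrightarrow> ((\<lambda>k. f k y) has_sum g y) UNIV"
  shows "cube_series d r S g"
proof -
  have "\<forall>k. \<exists>c m S. cube_expansion d r (c :: nat \<Rightarrow> real) m S (f k) \<and> S \<le> M k"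
    using f unfolding cube_series_def by blast
  then obtain c m T where rep: "\<And>k. cube_expansion d r (c k :: nat \<Rightarrow> real) (m k) (T k) (f k)"
    and TM: "\<And>k. T k \<le> M k"
    by metis
  note deg = cube_expansionD(1)[OF rep] and T = cube_expansionD(2)[OF rep] TM and h = cube_expansionD(3)[OF rep]
  define C where "C = (\<lambda>(k,j). \<bar>c k j\<bar> * r ^ total_degree (m k j))"
  have T0: "0 \<le> T k" for k using T(1)[of k] by (rule has_sum_nonneg) (use r in auto)
  have Tsum: "T summable_on UNIV"
    by (rule summable_on_comparison_test[OF has_sum_imp_summable[OF M]]) (use T0 T(2) in auto)
  have "(\<lambda>p. norm (C p)) summable_on (UNIV \<times> UNIV)"
    unfolding Infinite_Sum.abs_summable_on_Sigma_iff
  proof (intro conjI ballI)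
    fix k show "(\<lambda>j. norm (C (k, j))) summable_on UNIV"
      using has_sum_imp_summable[OF T(1)[of k]] r by (simp add: C_def abs_mult)
  next
    have "(\<Sum>\<^sub>\<infinity>j. norm (C (k, j))) = T k" for k
      using T(1)[of k] r by (simp add: C_def abs_mult infsumI)
    then show "(\<lambda>k. norm (\<Sum>\<^sub>\<infinity>j. norm (C (k, j)))) summable_on UNIV"
      using Tsum T0 by simp
  qed
  then have Cabs: "(\<lambda>p. norm (C p)) summable_on UNIV" by simp
  then have Csum: "C summable_on UNIV" by (rule abs_summable_summable)
  have "(T has_sum (\<Sum>\<^sub>\<infinity>p. C p)) UNIV"
    by (rule has_sum_SigmaD[where f = C and B = "\<lambda>_. UNIV"])
      (use has_sum_infsum[OF Csum] T(1) in \<open>auto simp: C_def\<close>)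
  then have le: "(\<Sum>\<^sub>\<infinity>p. C p) \<le> S"
    using has_sum_mono[OF _ M] T(2) by blast
  show ?thesis
  proof (rule cube_seriesI[where c = "\<lambda>p. c (fst p) (snd p)" and m = "\<lambda>p. m (fst p) (snd p)", OF _ _ le])
    show "c (fst p) (snd p) = 0 \<or> d \<le> total_degree (m (fst p) (snd p))" for p using deg by auto
    show "((\<lambda>p. \<bar>c (fst p) (snd p)\<bar> * r ^ total_degree (m (fst p) (snd p))) has_sum (\<Sum>\<^sub>\<infinity>p. C p)) UNIV"
      using has_sum_infsum[OF Csum] by (simp add: C_def case_prod_unfold)
    fix y :: "real ^ 'n" assume y: "\<And>i. \<bar>y $ i\<bar> \<le> r"
    have "(\<lambda>p. norm (c (fst p) (snd p) * monomial (m (fst p) (snd p)) y)) summable_on UNIV"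
      by (rule Infinite_Sum.abs_summable_on_comparison_test[OF Cabs])
        (use r in \<open>auto simp: C_def abs_mult intro!: mult_left_mono abs_monomial_le y\<close>)
    then have "(\<lambda>p. c (fst p) (snd p) * monomial (m (fst p) (snd p)) y) summable_on UNIV \<times> UNIV"
      by (simp add: abs_summable_summable)
    then show "((\<lambda>p. c (fst p) (snd p) * monomial (m (fst p) (snd p)) y) has_sum g y) UNIV"
      unfolding UNIV_Times_UNIV[symmetric]
      by (rule has_sum_SigmaI[rotated 2, where g = "\<lambda>k. f k y"]) (use h g y in auto)
  qed
qed

lemma cube_series_const: "cube_series 0 r \<bar>a\<bar> (\<lambda>_. a)"
  by (rule cube_seriesI[where c = "\<lambda>_::unit. a" and m = "\<lambda>_ _. 0" and S = "\<bar>a\<bar>"])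
    (auto simp: total_degree_def monomial_def UNIV_unit intro!: has_sum_finiteI)

lemma cube_series_coord: "0 \<le> r \<Longrightarrow> cube_series 0 r r (\<lambda>y. y $ i)"
  by (rule cube_seriesI[where c = "\<lambda>_::unit. 1" and m = "\<lambda>_ j. if j = i then 1 else 0" and S = r])
    (auto simp: total_degree_def monomial_def UNIV_unit if_distrib[of "\<lambda>n. _ ^ n"] prod.If_cases cong: if_cong intro!: has_sum_finiteI)

lemma cube_series_add:
  assumes "0 \<le> r" "cube_series d r M f" "cube_series d r N g"
  shows "cube_series d r (M + N) (\<lambda>y. f y + g y)"
  by (rule cube_series_suminf[where f = "\<lambda>b. if b then f else g" and M = "\<lambda>b. if b then M else N"])
    (use assms in \<open>auto simp: UNIV_bool intro!: has_sum_finiteI\<close>)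

text \<open>The norm is submultiplicative: multiplying by one monomial shifts exponents, and the general case is
  a series of such products.\<close>

lemma cube_series_mult:
  assumes r: "0 \<le> r" and f: "cube_series d r M f" and g: "cube_series 0 r N g"
  shows "cube_series d r (M * N) (\<lambda>y. f y * g y)"
proof -
  obtain c :: "nat \<Rightarrow> real" and m S where f0: "cube_expansion d r c m S f" "S \<le> M"
    using cube_seriesE[OF f] by blast
  note f' = cube_expansionD(1)[OF f0(1)] cube_expansionD(2)[OF f0(1)] f0(2) cube_expansionD(3)[OF f0(1)]
  obtain e :: "nat \<Rightarrow> real" and l T where g0: "cube_expansion 0 r e l T g" "T \<le> N"
    using cube_seriesE[OF g] by blast
  note g' = cube_expansionD(2)[OF g0(1)] g0(2) cube_expansionD(3)[OF g0(1)]
  have "cube_series d r (S * T) (\<lambda>y. f y * g y)"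
  proof (rule cube_series_suminf[OF r, where f = "\<lambda>k y. c k * monomial (m k) y * g y"
        and M = "\<lambda>k. \<bar>c k\<bar> * r ^ total_degree (m k) * T"])
    show "((\<lambda>k. \<bar>c k\<bar> * r ^ total_degree (m k) * T) has_sum S * T) UNIV"
      by (rule has_sum_cmult_left[OF f'(2)])
    show "((\<lambda>k. c k * monomial (m k) y * g y) has_sum f y * g y) UNIV"
      if "\<And>i. \<bar>y $ i\<bar> \<le> r" for y by (rule has_sum_cmult_left[OF f'(4)[OF that]])
    fix k
    show "cube_series d r (\<bar>c k\<bar> * r ^ total_degree (m k) * T) (\<lambda>y. c k * monomial (m k) y * g y)"
    proof (rule cube_seriesI[where c = "\<lambda>j. c k * e j" and m = "\<lambda>j i. m k i + l j i", OF _ _ order_refl])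
      show "c k * e j = 0 \<or> d \<le> total_degree (\<lambda>i. m k i + l j i)" for j
        using f'(1)[of k] by (auto simp: total_degree_add)
      show "((\<lambda>j. \<bar>c k * e j\<bar> * r ^ total_degree (\<lambda>i. m k i + l j i)) has_sum
              \<bar>c k\<bar> * r ^ total_degree (m k) * T) UNIV"
        using has_sum_cmult_right[OF g'(1), of "\<bar>c k\<bar> * r ^ total_degree (m k)"]
        by (simp add: total_degree_add power_add abs_mult mult_ac)
      show "((\<lambda>j. c k * e j * monomial (\<lambda>i. m k i + l j i) y) has_sum c k * monomial (m k) y * g y) UNIV"
        if "\<And>i. \<bar>y $ i\<bar> \<le> r" for y
        using has_sum_cmult_right[OF g'(3)[OF that], of "c k * monomial (m k) y"]
        by (simp add: monomial_add mult_ac)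
    qed
  qed
  moreover have "S * T \<le> M * N"
    using f' g' r by (intro mult_mono) (auto intro: has_sum_nonneg order_trans[OF has_sum_nonneg])
  ultimately show ?thesis by (rule cube_series_weaken_bound)
qed

lemma cube_series_cmult: "0 \<le> r \<Longrightarrow> cube_series d r M f \<Longrightarrow> cube_series d r (\<bar>a\<bar> * M) (\<lambda>y. a * f y)"
  using cube_series_mult[of r d M f "\<bar>a\<bar>" "\<lambda>_. a"] cube_series_const[of r a] by (simp add: mult.commute)

lemma cube_series_diff:
  assumes "0 \<le> r" "cube_series d r M f" "cube_series d r N g"
  shows "cube_series d r (M + N) (\<lambda>y. f y - g y)"
  using cube_series_add[OF assms(1,2) cube_series_cmult[OF assms(1,3), of "-1"]] by simp

lemma cube_series_zero: "0 \<le> r \<Longrightarrow> cube_series d r 0 (\<lambda>_. 0)"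
  by (rule cube_seriesI[where c = "\<lambda>_::unit. 0" and m = "\<lambda>_ _. 0" and S = 0]) auto

text \<open>Terms of degree at least \<open>d\<close> shrink by at least the factor \<open>(r / t)\<^sup>d\<close>. This is where
  small norms come from: vanishing at the centre makes a norm small on small cubes.\<close>

lemma cube_series_shrink:
  assumes f: "cube_series d t M f" and r: "0 \<le> r" "r \<le> t" "0 < t"
  shows "cube_series d r ((r / t) ^ d * M) f"
proof -
  obtain c :: "nat \<Rightarrow> real" and m S where f0: "cube_expansion d t c m S f" "S \<le> M"
    using cube_seriesE[OF f] by blast
  note f' = cube_expansionD(1)[OF f0(1)] cube_expansionD(2)[OF f0(1)] f0(2) cube_expansionD(3)[OF f0(1)]
  have le: "\<bar>c k\<bar> * r ^ total_degree (m k) \<le> (r / t) ^ d * (\<bar>c k\<bar> * t ^ total_degree (m k))" for k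
  proof (cases "c k = 0")
    case False
    then have "d \<le> total_degree (m k)" using f'(1) by blast
    then have "(r / t) ^ total_degree (m k) \<le> (r / t) ^ d" using r by (intro power_decreasing) auto
    then have "(r / t) ^ total_degree (m k) * t ^ total_degree (m k) \<le> (r / t) ^ d * t ^ total_degree (m k)"
      using r by (intro mult_right_mono) auto
    then have "r ^ total_degree (m k) \<le> (r / t) ^ d * t ^ total_degree (m k)" using r by (simp add: power_divide)
    from mult_left_mono[OF this abs_ge_zero[of "c k"]] show ?thesis by (simp add: mult.left_commute)
  qed auto
  have sm: "((\<lambda>k. (r / t) ^ d * (\<bar>c k\<bar> * t ^ total_degree (m k))) has_sum (r / t) ^ d * S) UNIV"
    by (rule has_sum_cmult_right[OF f'(2)])
  have "(\<lambda>k. \<bar>c k\<bar> * r ^ total_degree (m k)) summable_on UNIV"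
    by (rule summable_on_comparison_test[OF has_sum_imp_summable[OF sm]]) (use le r in auto)
  then have h: "((\<lambda>k. \<bar>c k\<bar> * r ^ total_degree (m k)) has_sum (\<Sum>\<^sub>\<infinity>k. \<bar>c k\<bar> * r ^ total_degree (m k))) UNIV"
    by (rule has_sum_infsum)
  have "(\<Sum>\<^sub>\<infinity>k. \<bar>c k\<bar> * r ^ total_degree (m k)) \<le> (r / t) ^ d * S"
    by (rule has_sum_mono[OF h sm]) (use le in auto)
  also have "\<dots> \<le> (r / t) ^ d * M" using f'(3) r by (intro mult_left_mono) auto
  finally have le': "(\<Sum>\<^sub>\<infinity>k. \<bar>c k\<bar> * r ^ total_degree (m k)) \<le> (r / t) ^ d * M" .
  show ?thesis
  proof (rule cube_seriesI[OF f'(1) h le'])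
    fix y :: "real ^ 'a" assume "\<And>i. \<bar>y $ i\<bar> \<le> r"
    then have "\<And>i. \<bar>y $ i\<bar> \<le> t" using r(2) order_trans by blast
    then show "((\<lambda>k. c k * monomial (m k) y) has_sum f y) UNIV" by (rule f'(4))
  qed
qed

text \<open>Both \<open>u\<close> and \<open>v\<close> are bounded like a product of \<open>k\<close> factors of norm \<open>s\<close>, and their difference like
  that of two such products whose corresponding factors differ by \<open>s * e\<close>.
  The number \<open>e\<close> is thus a relative error, and relative errors add under multiplication.\<close>

definition close_pair :: "real \<Rightarrow> real \<Rightarrow> real \<Rightarrow> nat \<Rightarrow> (real ^ 'n \<Rightarrow> real) \<Rightarrow> (real ^ 'n \<Rightarrow> real) \<Rightarrow> bool" where
  "close_pair r s e k u v \<longleftrightarrow>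
     cube_series 0 r (s ^ k) u \<and> cube_series 0 r (s ^ k) v \<and> cube_series 0 r (real k * s ^ k * e) (\<lambda>y. u y - v y)"

lemma close_pair_mult:
  assumes r: "0 \<le> r" and 1: "close_pair r s e k u v" and 2: "close_pair r s e l u' v'"
  shows "close_pair r s e (k + l) (\<lambda>y. u y * u' y) (\<lambda>y. v y * v' y)"
proof -
  have "cube_series 0 r (real k * s ^ k * e * s ^ l + s ^ k * (real l * s ^ l * e))
         (\<lambda>y. (u y - v y) * u' y + v y * (u' y - v' y))"
    by (intro cube_series_add cube_series_mult) (use assms in \<open>auto simp: close_pair_def\<close>)
  then show ?thesis
    using cube_series_mult[OF r, of 0] 1 2 by (auto simp: close_pair_def power_add algebra_simps)
qed

lemma close_pair_power:
  assumes r: "0 \<le> r" and "close_pair r s e 1 u v"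
  shows "close_pair r s e k (\<lambda>y. u y ^ k) (\<lambda>y. v y ^ k)"
proof (induction k)
  case 0
  then show ?case using cube_series_const[of r 1] cube_series_zero[OF r] by (auto simp: close_pair_def)
next
  case (Suc k)
  then show ?case using close_pair_mult[OF r assms(2) Suc] by simp
qed

lemma close_pair_monomial:
  assumes r: "0 \<le> r" and "\<And>i. close_pair r s e 1 (\<lambda>y. u y $ i) (\<lambda>y. v y $ i)"
  shows "close_pair r s e (total_degree m) (\<lambda>y. monomial m (u y)) (\<lambda>y. monomial m (v y))"
proof -
  have "close_pair r s e (\<Sum>i\<in>A. m i) (\<lambda>y. \<Prod>i\<in>A. (u y $ i) ^ m i) (\<lambda>y. \<Prod>i\<in>A. (v y $ i) ^ m i)"
    if "finite A" for A
    using that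
  proof (induction A)
    case empty
    then show ?case using cube_series_const[of r 1] cube_series_zero[OF r] by (auto simp: close_pair_def)
  next
    case (insert i A)
    then show ?case using close_pair_mult[OF r close_pair_power[OF r assms(2)[of i], of "m i"] insert.IH] by simp
  qed
  then show ?thesis by (simp add: monomial_def total_degree_def)
qed

text \<open>Substitution does not increase norms: \<open>monomial m\<close> of functions of norm at most \<open>s\<close> has
  norm at most \<open>s ^ total_degree m\<close>, which is the weight of that monomial.\<close>

lemma cube_series_compose:
  fixes f :: "real ^ 'n \<Rightarrow> real" and u :: "real ^ 'k \<Rightarrow> real ^ 'n"
  assumes r: "0 \<le> r" and s: "0 \<le> s" and f: "cube_series 0 s M f" and u: "\<And>i. cube_series 0 r s (\<lambda>y. u y $ i)"
  shows "cube_series 0 r M (\<lambda>y. f (u y))"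
proof -
  obtain c :: "nat \<Rightarrow> real" and m S where f0: "cube_expansion 0 s c m S f" "S \<le> M"
    using cube_seriesE[OF f] by blast
  note f' = cube_expansionD(2)[OF f0(1)] f0(2) cube_expansionD(3)[OF f0(1)]
  have "close_pair r s 0 1 (\<lambda>y. u y $ i) (\<lambda>y. u y $ i)" for i
    using u[of i] cube_series_zero[OF r] s by (auto simp: close_pair_def intro: cube_series_weaken_bound)
  note close_pair_monomial[OF r this]
  then have mono: "cube_series 0 r (s ^ total_degree l) (\<lambda>y. monomial l (u y))" for l
    by (auto simp: close_pair_def)
  have "cube_series 0 r S (\<lambda>y. f (u y))"
  proof (rule cube_series_suminf[OF r _ f'(1)])
    show "cube_series 0 r (\<bar>c k\<bar> * s ^ total_degree (m k)) (\<lambda>y. c k * monomial (m k) (u y))" for k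
      by (rule cube_series_cmult[OF r mono])
    show "((\<lambda>k. c k * monomial (m k) (u y)) has_sum f (u y)) UNIV" if "\<And>i. \<bar>y $ i\<bar> \<le> r" for y
      by (rule f'(3)) (use cube_series_bound[OF u r that] in auto)
  qed
  then show ?thesis using f'(2) by (rule cube_series_weaken_bound)
qed

lemma plus_two_le_power2: "real (j + 2) \<le> 2 * 2 ^ j"
proof (induction j)
  case (Suc j)
  have "real (Suc j + 2) \<le> 2 * real (j + 2)" by simp
  then show ?case using Suc by simp
qed simp

text \<open>A series of order at least 2 is a contraction on small arguments: its Lipschitz constant at
  scale \<open>s\<close> is proportional to \<open>s\<close>. With constant functions \<open>u\<close>, \<open>v\<close> this is a pointwise Lipschitz estimate.\<close>

lemma cube_series_lipschitz:
  fixes f :: "real ^ 'n \<Rightarrow> real" and u v :: "real ^ 'k \<Rightarrow> real ^ 'n"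
  assumes r: "0 \<le> r" and s: "0 < s" "2 * s \<le> t" and f: "cube_series 2 t M f"
    and u: "\<And>i. cube_series 0 r s (\<lambda>y. u y $ i)" and v: "\<And>i. cube_series 0 r s (\<lambda>y. v y $ i)"
    and uv: "\<And>i. cube_series 0 r e (\<lambda>y. u y $ i - v y $ i)"
  shows "cube_series 0 r (2 * s * M / t\<^sup>2 * e) (\<lambda>y. f (u y) - f (v y))"
proof -
  obtain c :: "nat \<Rightarrow> real" and m S where f0: "cube_expansion 2 t c m S f" "S \<le> M"
    using cube_seriesE[OF f] by blast
  note f' = cube_expansionD(1)[OF f0(1)] cube_expansionD(2)[OF f0(1)] f0(2) cube_expansionD(3)[OF f0(1)]
  have e: "0 \<le> e" using cube_series_nonneg[OF uv r] .
  have "close_pair r s (e / s) 1 (\<lambda>y. u y $ i) (\<lambda>y. v y $ i)" for i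
    using u[of i] v[of i] uv[of i] s by (auto simp: close_pair_def)
  note close_pair_monomial[OF r this]
  then have mono: "cube_series 0 r (real (total_degree l) * s ^ total_degree l * (e / s)) (\<lambda>y. monomial l (u y) - monomial l (v y))" for l
    by (auto simp: close_pair_def)
  have est: "real l * s ^ l * (e / s) \<le> 2 * s / t\<^sup>2 * e * t ^ l" if "2 \<le> l" for l
  proof -
    obtain j where l: "l = j + 2" using \<open>2 \<le> l\<close> le_Suc_ex[of 2 l] by (metis add.commute)
    have "real l * s ^ l = real l * s ^ j * s\<^sup>2" by (simp add: l power_add power2_eq_square)
    also have "\<dots> \<le> (2 * 2 ^ j) * s ^ j * s\<^sup>2"
      using plus_two_le_power2[of j] s unfolding l by (intro mult_right_mono) auto
    also have "\<dots> = 2 * (2 * s) ^ j * s\<^sup>2" by (simp add: power_mult_distrib)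
    also have "\<dots> \<le> 2 * t ^ j * s\<^sup>2"
      by (rule mult_right_mono, rule mult_left_mono, rule power_mono) (use s in auto)
    finally have "real l * s ^ l * (e / s) \<le> 2 * t ^ j * s\<^sup>2 * (e / s)"
      by (rule mult_right_mono) (use e s in auto)
    moreover have "0 < t" using s by simp
    then have "2 * t ^ j * s\<^sup>2 * (e / s) = 2 * s / t\<^sup>2 * e * t ^ l"
      using s by (simp add: l power_add field_simps power2_eq_square)
    ultimately show ?thesis by simp
  qed
  have "cube_series 0 r (S * (2 * s / t\<^sup>2 * e)) (\<lambda>y. f (u y) - f (v y))"
  proof (rule cube_series_suminf[OF r, where f = "\<lambda>k y. c k * (monomial (m k) (u y) - monomial (m k) (v y))"
        and M = "\<lambda>k. \<bar>c k\<bar> * t ^ total_degree (m k) * (2 * s / t\<^sup>2 * e)"])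
    show "cube_series 0 r (\<bar>c k\<bar> * t ^ total_degree (m k) * (2 * s / t\<^sup>2 * e))
           (\<lambda>y. c k * (monomial (m k) (u y) - monomial (m k) (v y)))" for k
    proof (cases "c k = 0")
      case True then show ?thesis using cube_series_zero[OF r] by simp
    next
      case False
      then have "2 \<le> total_degree (m k)" using f'(1) by blast
      from cube_series_weaken_bound[OF mono est[OF this]] show ?thesis
        by (intro cube_series_weaken_bound[OF cube_series_cmult[OF r]]) (auto simp: mult_ac)
    qed
    show "((\<lambda>k. \<bar>c k\<bar> * t ^ total_degree (m k) * (2 * s / t\<^sup>2 * e)) has_sum S * (2 * s / t\<^sup>2 * e)) UNIV"
      by (rule has_sum_cmult_left[OF f'(2)])
    fix y :: "real ^ 'k" assume y: "\<And>i. \<bar>y $ i\<bar> \<le> r"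
    have "\<bar>u y $ i\<bar> \<le> t" and "\<bar>v y $ i\<bar> \<le> t" for i
      using cube_series_bound[OF u r y, of i] cube_series_bound[OF v r y, of i] s by auto
    from has_sum_add[OF f'(4)[OF this(1)] has_sum_uminusI[OF f'(4)[OF this(2)]]]
    show "((\<lambda>k. c k * (monomial (m k) (u y) - monomial (m k) (v y))) has_sum f (u y) - f (v y)) UNIV"
      by (simp add: algebra_simps)
  qed
  moreover have "S * (2 * s / t\<^sup>2 * e) \<le> 2 * s * M / t\<^sup>2 * e"
    using mult_right_mono[OF f'(3), of "2 * s / t\<^sup>2 * e"] s e by (simp add: mult_ac)
  ultimately show ?thesis by (rule cube_series_weaken_bound)
qed

section \<open>Taylor expansion and recentring\<close>

lemma total_degree_eq_0: "total_degree m = 0 \<longleftrightarrow> (\<forall>i. m i = 0)"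
  by (simp add: total_degree_def)

lemma monomial_total_degree_0: "total_degree m = 0 \<Longrightarrow> monomial m y = 1"
  by (simp add: total_degree_eq_0 monomial_def)

lemma monomial_at_0: "monomial m 0 = (if total_degree m = 0 then 1 else 0)"
  unfolding total_degree_eq_0 monomial_def by (auto simp: prod_zero_iff)

lemma monomial_total_degree_1:
  assumes "total_degree m = 1"
  shows "monomial m y = (\<Sum>i\<in>UNIV. of_bool (m = (\<lambda>j. of_bool (j = i))) * y $ i)"
proof -
  obtain i where i: "m i \<noteq> 0" using assms total_degree_eq_0[of m] by auto
  have "total_degree m = m i + (\<Sum>j\<in>UNIV-{i}. m j)"
    unfolding total_degree_def by (subst sum.remove[of _ i]) auto
  with i assms have mi: "m i = 1" and "(\<Sum>j\<in>UNIV-{i}. m j) = 0" by linarith+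
  then have "m j = 0" if "j \<noteq> i" for j using that by (subst (asm) sum_eq_0_iff) auto
  with mi have m: "m = (\<lambda>j. of_bool (j = i))" by (auto simp: fun_eq_iff)
  have eq: "(m = (\<lambda>j. of_bool (j = k))) \<longleftrightarrow> k = i" for k
    unfolding m fun_eq_iff by auto
  have "monomial m y = (\<Prod>j\<in>UNIV. if j = i then y $ j else 1)"
    unfolding monomial_def m by (intro prod.cong) auto
  then show ?thesis unfolding eq by (simp add: of_bool_def if_distrib[of "\<lambda>x. x * _"] cong: if_cong)
qed

text \<open>Removing the terms of low degree can only decrease the norm.\<close>

lemma cube_series_truncate:
  fixes c :: "nat \<Rightarrow> real"
  assumes f: "cube_expansion 0 r c m S f" "S \<le> M" and r: "0 \<le> r"
    and h: "\<And>y. (\<And>i. \<bar>y $ i\<bar> \<le> r) \<Longrightarrow>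
      ((\<lambda>k. if total_degree (m k) < d then c k * monomial (m k) y else 0) has_sum h y) UNIV"
  shows "cube_series d r M (\<lambda>y. f y - h y)"
proof -
  define c' where "c' k = (if total_degree (m k) < d then 0 else c k)" for k
  have le: "\<bar>c' k\<bar> * r ^ total_degree (m k) \<le> \<bar>c k\<bar> * r ^ total_degree (m k)" for k
    using r by (simp add: c'_def)
  have "(\<lambda>k. \<bar>c' k\<bar> * r ^ total_degree (m k)) summable_on UNIV"
    by (rule summable_on_comparison_test[OF has_sum_imp_summable[OF cube_expansionD(2)[OF f(1)]]])
      (use le r in auto)
  then have S': "((\<lambda>k. \<bar>c' k\<bar> * r ^ total_degree (m k)) has_sum (\<Sum>\<^sub>\<infinity>k. \<bar>c' k\<bar> * r ^ total_degree (m k))) UNIV"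
    by (rule has_sum_infsum)
  have "(\<Sum>\<^sub>\<infinity>k. \<bar>c' k\<bar> * r ^ total_degree (m k)) \<le> S"
    by (rule has_sum_mono[OF S' cube_expansionD(2)[OF f(1)]]) (use le in auto)
  then have S'': "(\<Sum>\<^sub>\<infinity>k. \<bar>c' k\<bar> * r ^ total_degree (m k)) \<le> M" using f(2) by simp
  show ?thesis
  proof (rule cube_seriesI[OF _ S' S''])
    show "c' k = 0 \<or> d \<le> total_degree (m k)" for k by (simp add: c'_def)
    fix y :: "real ^ 'a" assume y: "\<And>i. \<bar>y $ i\<bar> \<le> r"
    have "((\<lambda>k. c k * monomial (m k) y + - (if total_degree (m k) < d then c k * monomial (m k) y else 0))
            has_sum f y + - h y) UNIV"
      by (rule has_sum_add[OF cube_expansionD(3)[OF f(1) y] has_sum_uminusI[OF h[OF y]]])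
    also have "(\<lambda>k. c k * monomial (m k) y + - (if total_degree (m k) < d then c k * monomial (m k) y else 0)) =
        (\<lambda>k. c' k * monomial (m k) y)"
      by (auto simp: c'_def)
    finally show "((\<lambda>k. c' k * monomial (m k) y) has_sum f y - h y) UNIV" by simp
  qed
qed

lemma cube_series_minus_center:
  assumes f: "cube_series 0 r M f" and r: "0 \<le> r"
  shows "cube_series 1 r M (\<lambda>y. f y - f 0)"
proof -
  obtain c :: "nat \<Rightarrow> real" and m S where f': "cube_expansion 0 r c m S f" "S \<le> M"
    using cube_seriesE[OF f] by blast
  have 0: "((\<lambda>k. c k * monomial (m k) 0) has_sum f 0) UNIV"
    by (rule cube_expansionD(3)[OF f'(1)]) (use r in auto)
  have "((\<lambda>k. if total_degree (m k) < 1 then c k * monomial (m k) y else 0) has_sum f 0) UNIV" for y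
    by (rule has_sum_cong[THEN iffD1, OF _ 0]) (auto simp: monomial_at_0 monomial_total_degree_0)
  then show ?thesis by (rule cube_series_truncate[OF f' r])
qed

lemma has_sum_finite_sum:
  fixes f :: "'i \<Rightarrow> 'k \<Rightarrow> 'b::real_normed_vector"
  assumes "finite A" "\<And>i. i \<in> A \<Longrightarrow> ((\<lambda>k. f i k) has_sum g i) B"
  shows "((\<lambda>k. \<Sum>i\<in>A. f i k) has_sum (\<Sum>i\<in>A. g i)) B"
  using assms by (induction A) (auto intro: has_sum_add)

text \<open>The coefficient \<open>b i\<close> collects all terms with multi-index the \<open>i\<close>-th unit vector.\<close>

lemma cube_series_taylor:
  assumes f: "cube_series 0 r M f" and r: "0 < r"
  obtains b where "cube_series 2 r M (\<lambda>y. f y - (f 0 + (\<Sum>i\<in>UNIV. b i * y $ i)))"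
proof -
  obtain c :: "nat \<Rightarrow> real" and m S where f': "cube_expansion 0 r c m S f" "S \<le> M"
    using cube_seriesE[OF f] by blast
  define e :: "'a \<Rightarrow> 'a \<Rightarrow> nat" where "e i = (\<lambda>j. of_bool (j = i))" for i
  have deg_e: "total_degree (e i) = 1" for i unfolding e_def total_degree_def by simp
  have "(\<lambda>k. norm (of_bool (m k = e i) * c k)) summable_on UNIV" for i
  proof (rule summable_on_comparison_test)
    show "(\<lambda>k. (\<bar>c k\<bar> * r ^ total_degree (m k)) * (1 / r)) summable_on UNIV"
      by (rule has_sum_imp_summable[OF has_sum_cmult_left[OF cube_expansionD(2)[OF f'(1)]]])
    show "norm (of_bool (m k = e i) * c k) \<le> (\<bar>c k\<bar> * r ^ total_degree (m k)) * (1 / r)" for k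
    proof (cases "m k = e i")
      case True
      have "total_degree (m k) = 1" unfolding True by (rule deg_e)
      with True r show ?thesis by simp
    qed (use r in simp)
  qed simp
  then have B: "((\<lambda>k. of_bool (m k = e i) * c k) has_sum (\<Sum>\<^sub>\<infinity>k. of_bool (m k = e i) * c k)) UNIV" for i
    by (rule has_sum_infsum[OF abs_summable_summable])
  define b where "b i = (\<Sum>\<^sub>\<infinity>k. of_bool (m k = e i) * c k)" for i
  have 0: "((\<lambda>k. c k * monomial (m k) 0) has_sum f 0) UNIV"
    by (rule cube_expansionD(3)[OF f'(1)]) (use r in auto)
  have "((\<lambda>k. if total_degree (m k) < 2 then c k * monomial (m k) y else 0)
          has_sum f 0 + (\<Sum>i\<in>UNIV. b i * y $ i)) UNIV" for y
  proof (rule has_sum_cong[THEN iffD1, rotated])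
    show "((\<lambda>k. c k * monomial (m k) 0 + (\<Sum>i\<in>UNIV. of_bool (m k = e i) * c k * y $ i))
            has_sum f 0 + (\<Sum>i\<in>UNIV. b i * y $ i)) UNIV"
      by (intro has_sum_add[OF 0] has_sum_finite_sum has_sum_cmult_left)
        (auto simp: b_def intro: B)
    fix k
    consider "total_degree (m k) = 0" | "total_degree (m k) = 1" | "2 \<le> total_degree (m k)" by linarith
    then show "c k * monomial (m k) 0 + (\<Sum>i\<in>UNIV. of_bool (m k = e i) * c k * y $ i) =
        (if total_degree (m k) < 2 then c k * monomial (m k) y else 0)"
    proof cases
      case 1
      then have "m k \<noteq> e i" for i using deg_e[of i] by auto
      then show ?thesis using 1 by (simp add: monomial_total_degree_0)
    next
      case 2
      have "(\<Sum>i\<in>UNIV. of_bool (m k = e i) * c k * y $ i) = c k * monomial (m k) y"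
        unfolding monomial_total_degree_1[OF 2] sum_distrib_left e_def by (intro sum.cong refl) (simp add: mult_ac)
      then show ?thesis using 2 by (simp add: monomial_at_0)
    next
      case 3
      then have "m k \<noteq> e i" for i using deg_e[of i] by auto
      then show ?thesis using 3 by (simp add: monomial_at_0)
    qed
  qed
  then have "cube_series 2 r M (\<lambda>y. f y - (f 0 + (\<Sum>i\<in>UNIV. b i * y $ i)))"
    using r by (intro cube_series_truncate[OF f']) auto
  then show thesis by (rule that)
qed

lemma cube_series_quadratic_bound:
  assumes f: "cube_series 2 r M f" and "norm y \<le> r" "0 < r"
  shows "\<bar>f y\<bar> \<le> M / r\<^sup>2 * (norm y)\<^sup>2"
  using cube_series_bound[OF cube_series_shrink[OF f, of "norm y"], of y] assms component_le_norm_cart[of y]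
  by (simp add: power_divide mult.commute)

text \<open>A special case of substitution, by \<open>y \<mapsto> z + y\<close>.\<close>

lemma cube_series_recenter:
  assumes f: "cube_series 0 t M f" and z: "\<And>i. \<bar>z $ i\<bar> + r \<le> t" "0 \<le> r"
  shows "cube_series 0 r M (\<lambda>y. f (z + y))"
proof (rule cube_series_compose[OF z(2) _ f])
  show "cube_series 0 r t (\<lambda>y. (z + y) $ i)" for i
    using cube_series_weaken_bound[OF cube_series_add[OF z(2) cube_series_const cube_series_coord[OF z(2)]] z(1)] by simp
  show "0 \<le> t" using z(1)[of undefined] z(2) by (meson abs_ge_zero add_nonneg_nonneg order_trans)
qed

lemma cube_series_forget_degree: "cube_series d r M f \<Longrightarrow> cube_series 0 r M f"
  unfolding cube_series_def cube_expansion_def by auto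

section \<open>Germs of convergent power series\<close>

definition power_series_at :: "real ^ 'n \<Rightarrow> (real ^ 'n \<Rightarrow> real) \<Rightarrow> bool" where
  "power_series_at p f \<longleftrightarrow> (\<exists>r>0. \<exists>M. cube_series 0 r M (\<lambda>y. f (p + y)))"

lemma power_series_at_small:
  assumes "power_series_at p f"
  obtains r M where "0 < r" "\<And>s. 0 < s \<Longrightarrow> s \<le> r \<Longrightarrow> cube_series 0 s M (\<lambda>y. f (p + y))"
proof -
  obtain r M where r: "0 < r" "cube_series 0 r M (\<lambda>y. f (p + y))"
    using assms unfolding power_series_at_def by blast
  show thesis
  proof (rule that[OF r(1)])
    show "cube_series 0 s M (\<lambda>y. f (p + y))" if "0 < s" "s \<le> r" for s
      using cube_series_shrink[OF r(2), of s] that by simp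
  qed
qed

text \<open>Finitely many germs, such as the components of a map, share one cube and one bound.\<close>

lemma power_series_at_common:
  fixes f :: "'i \<Rightarrow> real ^ 'n \<Rightarrow> real"
  assumes A: "finite A" and "\<And>i. i \<in> A \<Longrightarrow> power_series_at p (f i)"
  shows "\<exists>r>0. \<exists>M. \<forall>i\<in>A. cube_series 0 r M (\<lambda>y. f i (p + y))"
proof -
  have "\<exists>r M. 0 < r \<and> (\<forall>i\<in>A. \<forall>s. 0 < s \<longrightarrow> s \<le> r \<longrightarrow> cube_series 0 s M (\<lambda>y. f i (p + y)))"
    using assms
  proof (induction A)
    case empty
    then show ?case by (auto intro: exI[of _ 1])
  next
    case (insert i A)
    then obtain r M where r: "0 < r" "\<forall>i\<in>A. \<forall>s. 0 < s \<longrightarrow> s \<le> r \<longrightarrow> cube_series 0 s M (\<lambda>y. f i (p + y))"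
      by auto
    obtain r' M' where r': "0 < r'" "\<And>s. 0 < s \<Longrightarrow> s \<le> r' \<Longrightarrow> cube_series 0 s M' (\<lambda>y. f i (p + y))"
      using power_series_at_small[of p "f i"] insert.prems by auto
    show ?case
      by (rule exI[of _ "min r r'"], rule exI[of _ "max M M'"])
        (use r r' in \<open>auto intro: cube_series_weaken_bound[OF _ max.cobounded1] cube_series_weaken_bound[OF _ max.cobounded2]\<close>)
  qed
  then show ?thesis by blast
qed

text \<open>A quadratic remainder bound that is uniform in the base point makes the directional derivative
  \<open>L z v\<close> a locally uniform limit of difference quotients, which are continuous in \<open>z\<close>.
  For power series this replaces termwise differentiation.\<close>

lemma continuous_on_derivative_if_quadratic_remainder:
  fixes f :: "'a::euclidean_space \<Rightarrow> real"
  assumes S: "open S" and "0 < \<rho>"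
    and L: "\<And>z. z \<in> S \<Longrightarrow> linear (L z)"
    and rem: "\<And>z y. z \<in> S \<Longrightarrow> norm y \<le> \<rho> \<Longrightarrow> \<bar>f (z + y) - f z - L z y\<bar> \<le> C * (norm y)\<^sup>2"
  shows "z \<in> S \<Longrightarrow> (f has_derivative L z) (at z)"
    and "continuous_on S (\<lambda>z. L z v)"
proof -
  show der: "(f has_derivative L z) (at z)" if z: "z \<in> S" for z
    unfolding has_derivative_at_alt
  proof (intro conjI allI impI)
    show "bounded_linear (L z)" using L[OF z] linear_conv_bounded_linear by blast
    fix e :: real assume e: "0 < e"
    show "\<exists>d>0. \<forall>y. norm (y - z) < d \<longrightarrow> norm (f y - f z - L z (y - z)) \<le> e * norm (y - z)"
    proof (intro exI[of _ "min \<rho> (e / (\<bar>C\<bar> + 1))"] conjI allI impI)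
      show "0 < min \<rho> (e / (\<bar>C\<bar> + 1))" using \<open>0 < \<rho>\<close> e by simp
      fix y assume y: "norm (y - z) < min \<rho> (e / (\<bar>C\<bar> + 1))"
      have "norm (f y - f z - L z (y - z)) \<le> C * (norm (y - z))\<^sup>2"
        using rem[OF z, of "y - z"] y by simp
      also have "\<dots> \<le> (\<bar>C\<bar> + 1) * norm (y - z) * norm (y - z)"
        unfolding power2_eq_square mult.assoc by (intro mult_right_mono) auto
      also have "(\<bar>C\<bar> + 1) * norm (y - z) \<le> e"
      proof -
        have "norm (y - z) * (\<bar>C\<bar> + 1) \<le> e"
          by (subst pos_le_divide_eq[symmetric]) (use y in auto)
        then show ?thesis by (simp add: mult.commute)
      qed
      finally show "norm (f y - f z - L z (y - z)) \<le> e * norm (y - z)"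
        by (simp add: mult_right_mono)
    qed
  qed
  have contf: "continuous (at z) f" if "z \<in> S" for z
    using der[OF that] has_derivative_continuous by blast
  show "continuous_on S (\<lambda>z. L z v)"
    unfolding continuous_on_eq_continuous_at[OF S]
  proof
    fix z assume z: "z \<in> S"
    define N where "N = norm v"
    show "continuous (at z) (\<lambda>z. L z v)"
      unfolding continuous_within tendsto_iff
    proof (intro allI impI)
      fix e :: real assume e: "0 < e"
      have 1: "((\<lambda>h. h * N) \<longlongrightarrow> 0) (at_right 0)" "((\<lambda>h. 2 * C * h * N\<^sup>2) \<longlongrightarrow> 0) (at_right 0)"
        "((\<lambda>h. z + h *\<^sub>R v) \<longlongrightarrow> z) (at_right 0)"
        by (auto intro!: tendsto_eq_intros)
      have "\<forall>\<^sub>F h in at_right 0. 0 < h \<and> h * N < \<rho> \<and> 2 * C * h * N\<^sup>2 < e / 2 \<and> z + h *\<^sub>R v \<in> S"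
        using order_tendstoD(2)[OF 1(1) \<open>0 < \<rho>\<close>] order_tendstoD(2)[OF 1(2), of "e / 2"] e
          topological_tendstoD[OF 1(3) S z] eventually_at_right_less[of "0::real"]
        by (auto elim!: eventually_elim2 intro!: eventually_conj)
      then obtain h where h: "0 < h" "h * N < \<rho>" "2 * C * h * N\<^sup>2 < e / 2" "z + h *\<^sub>R v \<in> S"
        by (auto dest: eventually_happens)
      define q where "q w = (f (w + h *\<^sub>R v) - f w) / h" for w
      have approx: "\<bar>L w v - q w\<bar> \<le> C * h * N\<^sup>2" if w: "w \<in> S" for w
      proof -
        have "\<bar>f (w + h *\<^sub>R v) - f w - L w (h *\<^sub>R v)\<bar> \<le> C * (norm (h *\<^sub>R v))\<^sup>2"
          by (rule rem[OF w]) (use h in \<open>auto simp: N_def\<close>)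
        also have "f (w + h *\<^sub>R v) - f w - L w (h *\<^sub>R v) = - (h * (L w v - q w))"
          using h(1) linear_cmul[OF L[OF w], of h v] by (simp add: q_def field_simps)
        also have "\<bar>- (h * (L w v - q w))\<bar> = h * \<bar>L w v - q w\<bar>"
          using h(1) by (simp add: abs_mult)
        also have "C * (norm (h *\<^sub>R v))\<^sup>2 = h * (C * h * N\<^sup>2)"
          using h(1) by (simp add: N_def power_mult_distrib power2_eq_square)
        finally show ?thesis using h(1) by simp
      qed
      have "isCont (\<lambda>w. f (w + h *\<^sub>R v)) z"
        by (rule isCont_o2[where f = "\<lambda>w. w + h *\<^sub>R v" and g = f]) (use contf[OF h(4)] in auto)
      then have "isCont q z" unfolding q_def
        using contf[OF z] h(1) by (intro continuous_intros) auto
      then have "\<forall>\<^sub>F w in at z. dist (q w) (q z) < e / 2"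
        unfolding continuous_within tendsto_iff using half_gt_zero[OF e] by blast
      moreover have "\<forall>\<^sub>F w in at z. w \<in> S"
        using S z by (rule eventually_at_in_open')
      ultimately show "\<forall>\<^sub>F w in at z. dist (L w v) (L z v) < e"
      proof eventually_elim
        case (elim w)
        have "2 * (C * h * N\<^sup>2) < e / 2" using h(3) by (simp add: mult.assoc)
        then show ?case
          using approx[OF z] approx[OF elim(2)] elim(1) unfolding dist_real_def by linarith
      qed
    qed
  qed
qed

text \<open>Recentring at every nearby point preserves the norm, so the second-order remainders are
  bounded uniformly.\<close>

lemma power_series_at_continuously_differentiable:
  fixes f :: "real ^ 'n \<Rightarrow> real"
  assumes "power_series_at p f"
  obtains e L where "0 < e" "\<And>z. z \<in> ball p e \<Longrightarrow> (f has_derivative L z) (at z)"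
    "\<And>v. continuous_on (ball p e) (\<lambda>z. L z v)"
proof -
  obtain t M where t: "0 < t" and f: "cube_series 0 t M (\<lambda>y. f (p + y))"
    using assms unfolding power_series_at_def by blast
  define r where "r = t / 2"
  have r: "0 < r" using t by (simp add: r_def)
  have "\<exists>b. cube_series 2 r M (\<lambda>y. f (z + y) - (f z + (\<Sum>i\<in>UNIV. b i * y $ i)))" if z: "z \<in> ball p r" for z
  proof -
    have "\<bar>(z - p) $ i\<bar> + r \<le> t" for i
      using component_le_norm_cart[of "z - p" i] z by (simp add: r_def dist_norm norm_minus_commute)
    from cube_series_recenter[OF f this] r have "cube_series 0 r M (\<lambda>y. f (z + y))"
      by (simp add: algebra_simps)
    from cube_series_taylor[OF this r] show ?thesis by auto
  qed
  then have "\<exists>b. \<forall>z\<in>ball p r. cube_series 2 r M (\<lambda>y. f (z + y) - (f z + (\<Sum>i\<in>UNIV. b z i * y $ i)))"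
    by (intro bchoice) blast
  then obtain b where b: "\<And>z. z \<in> ball p r \<Longrightarrow>
      cube_series 2 r M (\<lambda>y. f (z + y) - (f z + (\<Sum>i\<in>UNIV. b z i * y $ i)))"
    by blast
  define L where "L z y = (\<Sum>i\<in>UNIV. b z i * y $ i)" for z and y :: "real ^ 'n"
  have lin: "linear (L z)" for z
    by (rule linearI) (simp_all add: L_def algebra_simps sum.distrib sum_distrib_left)
  have rem: "\<bar>f (z + y) - f z - L z y\<bar> \<le> M / r\<^sup>2 * (norm y)\<^sup>2"
    if "z \<in> ball p r" "norm y \<le> r" for z y
    using cube_series_quadratic_bound[OF b[OF that(1)] that(2) r] by (simp add: L_def algebra_simps)
  show thesis
    by (rule that[OF r]; rule continuous_on_derivative_if_quadratic_remainder[OF open_ball r lin rem])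
qed

section \<open>The analytic inverse function theorem\<close>

text \<open>With the derivative of \<open>G\<close> at \<open>x\<^sub>0 = \<psi> q\<close> normalized to the identity, the equation \<open>G (\<psi> z) = F z\<close> for
  \<open>w = \<psi> (q + y) - x\<^sub>0\<close> reads \<open>w = H y - R w\<close>, where \<open>R\<close> has order 2 and \<open>H\<close> vanishes at 0.
  The iteration \<open>u\<^sub>k\<^sub>+\<^sub>1 = H - R \<circ> u\<^sub>k\<close> contracts by 1/2 in the weighted norm, so its increments
  add up to a convergent power series. The same contraction, applied pointwise, shows that the iterates
  converge to the given solution \<open>w\<close>, which is therefore the sum of that series.\<close>

theorem analytic_inverse:
  fixes G F \<psi> :: "real ^ 'n \<Rightarrow> real ^ 'n"
  assumes G: "\<And>i. power_series_at (\<psi> q) (\<lambda>x. G x $ i)" and G': "(G has_derivative id) (at (\<psi> q))"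
    and F: "\<And>i. power_series_at q (\<lambda>x. F x $ i)"
    and cont: "continuous (at q) \<psi>" and eq: "\<forall>\<^sub>F z in nhds q. G (\<psi> z) = F z"
  shows "power_series_at q (\<lambda>z. \<psi> z $ i)"
proof -
  define x0 where "x0 = \<psi> q"
  obtain t M where t: "0 < t" and GM: "\<And>i. cube_series 0 t M (\<lambda>y. G (x0 + y) $ i)"
    using power_series_at_common[OF finite[of UNIV], of "\<psi> q" "\<lambda>i x. G x $ i"] G unfolding x0_def by blast
  have M0: "0 \<le> M" using cube_series_nonneg[OF GM] t by auto
  define R where "R i y = G (x0 + y) $ i - (G x0 $ i + y $ i)" for i y
  \<comment> \<open>the linear Taylor coefficients of \<open>G\<close> are those of the identity, as they give its derivative\<close>
  have R: "cube_series 2 t M (R i)" for i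
  proof -
    obtain b where b: "cube_series 2 t M (\<lambda>y. G (x0 + y) $ i - (G x0 $ i + (\<Sum>j\<in>UNIV. b j * y $ j)))"
      using cube_series_taylor[OF GM t] by auto
    have lin: "linear (\<lambda>y. \<Sum>j\<in>UNIV. b j * y $ j)"
      by (rule linearI) (simp_all add: algebra_simps sum.distrib sum_distrib_left)
    have "\<exists>d>0. \<forall>y. norm (y - x0) < d \<longrightarrow>
        norm (G y $ i - G x0 $ i - (\<Sum>j\<in>UNIV. b j * (y - x0) $ j)) \<le> e * norm (y - x0)" if e: "0 < e" for e
    proof (intro exI[of _ "min t (e / (M / t\<^sup>2 + 1))"] conjI allI impI)
      have pos: "0 < M / t\<^sup>2 + 1" using M0 t by (simp add: add_nonneg_pos)
      show "0 < min t (e / (M / t\<^sup>2 + 1))" using t e pos by simp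
      fix y assume y: "norm (y - x0) < min t (e / (M / t\<^sup>2 + 1))"
      have "norm (G y $ i - G x0 $ i - (\<Sum>j\<in>UNIV. b j * (y - x0) $ j)) \<le> M / t\<^sup>2 * (norm (y - x0))\<^sup>2"
        using cube_series_quadratic_bound[OF b, of "y - x0"] y t by (simp add: algebra_simps)
      also have "\<dots> = (M / t\<^sup>2 * norm (y - x0)) * norm (y - x0)" by (simp add: power2_eq_square)
      also have "\<dots> \<le> e * norm (y - x0)"
      proof (rule mult_right_mono)
        have "(M / t\<^sup>2 + 1) * norm (y - x0) \<le> e" using y pos by (simp add: pos_less_divide_eq mult.commute)
        then show "M / t\<^sup>2 * norm (y - x0) \<le> e" by (simp add: distrib_right) (smt (verit) norm_ge_zero)
      qed simp
      finally show "norm (G y $ i - G x0 $ i - (\<Sum>j\<in>UNIV. b j * (y - x0) $ j)) \<le> e * norm (y - x0)" .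
    qed
    then have "((\<lambda>x. G x $ i) has_derivative (\<lambda>y. \<Sum>j\<in>UNIV. b j * y $ j)) (at x0)"
      unfolding has_derivative_at_alt using lin linear_conv_bounded_linear by blast
    moreover have "((\<lambda>x. G x $ i) has_derivative (\<lambda>y. y $ i)) (at x0)"
      using bounded_linear.has_derivative[OF bounded_linear_vec_nth G'] by (simp add: x0_def)
    ultimately have "(\<lambda>y. \<Sum>j\<in>UNIV. b j * y $ j) = (\<lambda>y. y $ i)" by (rule has_derivative_unique)
    then have "(\<Sum>j\<in>UNIV. b j * y $ j) = y $ i" for y by meson
    then show ?thesis using b unfolding R_def by simp
  qed
  have R0: "R i 0 = 0" for i by (simp add: R_def)
  obtain t' M' where t': "0 < t'" and "\<And>i. cube_series 0 t' M' (\<lambda>y. F (q + y) $ i)"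
    using power_series_at_common[OF finite[of UNIV], of q "\<lambda>i x. F x $ i"] F by blast
  then have FM: "cube_series 1 t' M' (\<lambda>y. F (q + y) $ i - F q $ i)" for i
    using cube_series_minus_center[of t' M' "\<lambda>y. F (q + y) $ i"] by simp
  have M'0: "0 \<le> M'" using cube_series_nonneg[OF FM] t' by auto
  \<comment> \<open>the scale at which \<open>R\<close> contracts by 1/2\<close>
  define s where "s = min (t / 2) (t\<^sup>2 / (4 * (M + 1)))"
  have s: "0 < s" "2 * s \<le> t" using t M0 by (auto simp: s_def)
  have "s \<le> t\<^sup>2 / (4 * (M + 1))" by (simp add: s_def)
  then have "s * (4 * (M + 1)) \<le> t\<^sup>2" using M0 by (simp add: pos_le_divide_eq)
  then have "4 * s * M \<le> t\<^sup>2" using s by (simp add: algebra_simps)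
  then have half: "2 * s * M / t\<^sup>2 \<le> 1 / 2" using t by (simp add: divide_simps)
  have "\<forall>\<^sub>F z in nhds q. (\<forall>i. \<bar>(\<psi> z - x0) $ i\<bar> < s) \<and> G (\<psi> z) = F z"
  proof (rule eventually_conj[OF _ eq])
    have "\<forall>\<^sub>F z in nhds q. dist (\<psi> z) x0 < s"
      using cont s(1) unfolding x0_def continuous_at_eps_delta
      by (auto simp: eventually_nhds_metric)
    then show "\<forall>\<^sub>F z in nhds q. \<forall>i. \<bar>(\<psi> z - x0) $ i\<bar> < s"
      by eventually_elim (metis dist_norm component_le_norm_cart le_less_trans)
  qed
  then obtain d where d: "0 < d" "\<And>z. dist z q < d \<Longrightarrow> (\<forall>i. \<bar>(\<psi> z - x0) $ i\<bar> < s) \<and> G (\<psi> z) = F z"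
    unfolding eventually_nhds_metric by blast
  \<comment> \<open>the cube of size \<open>r\<close> lies in the ball of radius \<open>d\<close>, and \<open>H\<close> has norm at most \<open>s / 2\<close> on it\<close>
  define r where "r = min (d / (2 * CARD('n))) (min t' (t' * s / (2 * (M' + 1))))"
  have "r \<le> d / (2 * CARD('n))" by (simp add: r_def)
  then have "r * CARD('n) \<le> d / 2" by (simp add: pos_le_divide_eq mult_ac)
  then have r: "0 < r" "r \<le> t'" "r * CARD('n) < d"
    using d(1) t' s(1) M'0 by (simp_all add: r_def)
  have "r \<le> t' * s / (2 * (M' + 1))" by (simp add: r_def)
  then have "r * (2 * (M' + 1)) \<le> t' * s" using M'0 by (simp add: pos_le_divide_eq)
  then have "2 * r * M' \<le> t' * s" using r by (simp add: algebra_simps)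
  then have rM': "r / t' * M' \<le> s / 2" using t' by (simp add: divide_simps mult_ac)
  define H where "H i y = F (q + y) $ i - F q $ i" for i y
  have H: "cube_series 0 r (s / 2) (H i)" for i
    using cube_series_weaken_bound[OF cube_series_forget_degree[OF cube_series_shrink[OF FM _ r(2) t']]] rM' r(1)
    unfolding H_def by simp
  define u where "u = rec_nat (\<lambda>_. 0 :: real ^ 'n) (\<lambda>k v y. \<chi> i. H i y - R i (v y))"
  have u0: "u 0 = (\<lambda>_. 0)" and uS: "u (Suc k) y $ i = H i y - R i (u k y)" for k y i
    by (simp_all add: u_def)
  have contract: "cube_series 0 \<rho> (e / 2) (\<lambda>y. R i (v y) - R i (w y))"
    if \<rho>: "0 \<le> \<rho>" and "\<And>i. cube_series 0 \<rho> s (\<lambda>y. v y $ i)" "\<And>i. cube_series 0 \<rho> s (\<lambda>y. w y $ i)"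
      and vw: "\<And>i. cube_series 0 \<rho> e (\<lambda>y. v y $ i - w y $ i)" for \<rho> e i and v w :: "real ^ 'n \<Rightarrow> real ^ 'n"
    using cube_series_weaken_bound[OF cube_series_lipschitz[OF \<rho> s R that(2,3) vw] mult_right_mono[OF half cube_series_nonneg[OF vw \<rho>]]]
    by simp
  have us: "cube_series 0 r s (\<lambda>y. u k y $ i)" for k i
  proof (induction k arbitrary: i)
    case 0
    then show ?case using cube_series_weaken_bound[OF cube_series_zero, of r s 0] r s by (simp add: u0)
  next
    case (Suc k)
    have z: "cube_series 0 r s (\<lambda>y. (0 :: real ^ 'n) $ i)" for i
      using cube_series_weaken_bound[OF cube_series_zero, of r s 0] r s by simp
    have "cube_series 0 r (s / 2 + s / 2) (\<lambda>y. H i y - (R i (u k y) - R i 0))"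
      by (intro cube_series_diff H contract z Suc) (use r Suc in auto)
    then show ?case by (simp add: uS R0)
  qed
  have uu: "cube_series 0 r (s * (1/2) ^ k) (\<lambda>y. u (Suc k) y $ i - u k y $ i)" for k i
  proof (induction k arbitrary: i)
    case 0
    then show ?case using cube_series_weaken_bound[OF H, of s] s by (simp add: u0 uS R0)
  next
    case (Suc k)
    have "cube_series 0 r (\<bar>-1\<bar> * (s * (1/2) ^ k / 2)) (\<lambda>y. -1 * (R i (u (Suc k) y) - R i (u k y)))"
      by (intro cube_series_cmult contract us Suc) (use r in auto)
    then show ?case by (simp add: uS[of "Suc k"] uS[of k])
  qed
  define w where "w y = \<psi> (q + y) - x0" for y
  have lim: "(\<lambda>k. u k y $ i) \<longlonglongrightarrow> w y $ i" if y: "\<And>i. \<bar>y $ i\<bar> \<le> r" for y i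
  proof -
    have "norm y \<le> (\<Sum>i\<in>UNIV. \<bar>y $ i\<bar>)" by (rule norm_le_l1_cart)
    also have "\<dots> \<le> (\<Sum>i\<in>(UNIV :: 'n set). r)" by (intro sum_mono y)
    finally have "dist (q + y) q < d" using r(3) by (simp add: dist_norm mult.commute)
    from d(2)[OF this] have ws: "\<And>i. \<bar>w y $ i\<bar> < s" and Gw: "G (x0 + w y) = F (q + y)"
      by (auto simp: w_def)
    have "G x0 = F q" using eventually_nhds_x_imp_x[OF eq] by (simp add: x0_def)
    then have wH: "w y $ i = H i y - R i (w y)" for i
      by (simp add: H_def R_def Gw)
    have "\<bar>u k y $ i - w y $ i\<bar> \<le> 2 * s * (1/2) ^ k" for k i
    proof (induction k arbitrary: i)
      case 0
      then show ?case using ws[of i] s by (simp add: u0)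
    next
      case (Suc k)
      \<comment> \<open>the contraction for two constant functions, on the cube of size 0\<close>
      have "cube_series 0 0 (2 * s * (1/2) ^ k / 2) (\<lambda>_ :: real ^ 'n. R i (u k y) - R i (w y))"
      proof (rule contract)
        show "cube_series 0 0 s (\<lambda>_ :: real ^ 'n. u k y $ i)" for i
          by (rule cube_series_weaken_bound[OF cube_series_const cube_series_bound[OF us _ y]]) (use r in auto)
        show "cube_series 0 0 s (\<lambda>_ :: real ^ 'n. w y $ i)" for i
          by (rule cube_series_weaken_bound[OF cube_series_const less_imp_le[OF ws]])
        show "cube_series 0 0 (2 * s * (1/2) ^ k) (\<lambda>_ :: real ^ 'n. u k y $ i - w y $ i)" for i
          by (rule cube_series_weaken_bound[OF cube_series_const Suc])
      qed simp
      from cube_series_bound[OF this, of 0] have "\<bar>R i (u k y) - R i (w y)\<bar> \<le> 2 * s * (1/2) ^ k / 2" by simp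
      then show ?case unfolding uS wH[of i] by (simp add: abs_minus_commute)
    qed
    then have le: "\<forall>\<^sub>F k in sequentially. norm (u k y $ i - w y $ i) \<le> 2 * s * (1/2) ^ k"
      by (intro always_eventually allI) simp
    have "(\<lambda>k. (1/2 :: real) ^ k) \<longlonglongrightarrow> 0" by (rule LIMSEQ_realpow_zero) auto
    from tendsto_mult_right_zero[OF this, of "2 * s"]
    have "(\<lambda>k. u k y $ i - w y $ i) \<longlonglongrightarrow> 0"
      by (rule Lim_null_comparison[OF le])
    then show ?thesis by (simp add: LIM_zero_iff)
  qed
  have geom: "((\<lambda>k. s * (1/2) ^ k) has_sum 2 * s) UNIV"
    using norm_summable_imp_has_sum[of "\<lambda>k. s * (1/2) ^ k" "2 * s"]
      sums_mult[OF geometric_sums[of "1/2 :: real"], of s] s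
    by (simp add: abs_mult summable_mult summable_geometric mult.commute)
  have "cube_series 0 r (2 * s) (\<lambda>y. w y $ i)"
  proof (rule cube_series_suminf[OF _ uu geom])
    show "0 \<le> r" using r by simp
    fix y :: "real ^ 'n" assume y: "\<And>i. \<bar>y $ i\<bar> \<le> r"
    have "summable (\<lambda>k. norm (u (Suc k) y $ i - u k y $ i))"
      by (rule summable_comparison_test'[of "\<lambda>k. s * (1/2) ^ k" 0])
        (use cube_series_bound[OF uu _ y] r in \<open>auto intro!: summable_mult summable_geometric\<close>)
    from norm_summable_imp_has_sum[OF this telescope_sums[OF lim[OF y, of i]]]
    show "((\<lambda>k. u (Suc k) y $ i - u k y $ i) has_sum w y $ i) UNIV" by (simp add: u0)
  qed
  from cube_series_add[OF _ cube_series_const[of r "x0 $ i"] this] r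
  have "cube_series 0 r (\<bar>x0 $ i\<bar> + 2 * s) (\<lambda>y. \<psi> (q + y) $ i)" by (simp add: w_def)
  then show ?thesis unfolding power_series_at_def using r by blast
qed

section \<open>Real analytic maps\<close>

lemma norm_le_of_cube:
  fixes y :: "real ^ 'n" and t :: real
  assumes "\<And>i. \<bar>y $ i\<bar> \<le> t"
  shows "norm y \<le> CARD('n) * t"
  using norm_le_l1_cart[of y] sum_bounded_above[of UNIV "\<lambda>i. \<bar>y $ i\<bar>" t] assms by auto

text \<open>Summability at one point with all coordinates equal to \<open>t\<close> is absolute and
  is exactly finiteness of the weighted norm on the cube of size \<open>t\<close>.\<close>

lemma real_analytic_imp_power_series_at:
  fixes f :: "real ^ 'n \<Rightarrow> 'b::real_inner"
  assumes f: "real_analytic_map_on f U" and p: "p \<in> U"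
  shows "power_series_at p (\<lambda>x. f x \<bullet> w)"
proof -
  obtain \<delta> and a :: "('n \<Rightarrow> nat) \<Rightarrow> 'b" where \<delta>: "0 < \<delta>"
    and a: "\<And>x. x \<in> ball p \<delta> \<Longrightarrow> ((\<lambda>\<alpha>. (\<Prod>i\<in>UNIV. (x $ i - p $ i) ^ \<alpha> i) *\<^sub>R a \<alpha>) has_sum f x) UNIV"
    using f p unfolding real_analytic_map_on_def by meson
  define t where "t = \<delta> / (2 * CARD('n))"
  have t: "0 < t" "CARD('n) * t < \<delta>" using \<delta> by (auto simp: t_def)
  have ser: "((\<lambda>\<alpha>. (a \<alpha> \<bullet> w) * monomial \<alpha> y) has_sum f (p + y) \<bullet> w) UNIV"
    if "\<And>i. \<bar>y $ i\<bar> \<le> t" for y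
  proof -
    have "p + y \<in> ball p \<delta>" using norm_le_of_cube[of y, OF that] t by (simp add: dist_norm)
    from has_sum_bounded_linear[OF bounded_linear_inner_left a[OF this], of w]
    show ?thesis by (simp add: monomial_def mult.commute)
  qed
  \<comment> \<open>monomials at the corner of the cube are the weights\<close>
  have mt: "monomial \<alpha> (\<chi> i. t) = t ^ total_degree \<alpha>" for \<alpha> :: "'n \<Rightarrow> nat"
    by (simp add: monomial_def total_degree_def power_sum)
  have "(\<lambda>\<alpha>. (a \<alpha> \<bullet> w) * t ^ total_degree \<alpha>) summable_on UNIV"
    using has_sum_imp_summable[OF ser[of "\<chi> i. t"]] t by (simp add: mt)
  then have "(\<lambda>\<alpha>. norm ((a \<alpha> \<bullet> w) * t ^ total_degree \<alpha>)) summable_on UNIV"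
    by (subst (asm) summable_on_iff_abs_summable_on_real)
  then have "(\<lambda>\<alpha>. \<bar>a \<alpha> \<bullet> w\<bar> * t ^ total_degree \<alpha>) summable_on UNIV"
    using t by (simp add: abs_mult)
  then have "cube_series 0 t (\<Sum>\<^sub>\<infinity>\<alpha>. \<bar>a \<alpha> \<bullet> w\<bar> * t ^ total_degree \<alpha>) (\<lambda>y. f (p + y) \<bullet> w)"
    by (intro cube_seriesI[OF _ has_sum_infsum order_refl ser]) auto
  then show ?thesis using t unfolding power_series_at_def by blast
qed

text \<open>Terms with the same multi-index are collected into one coefficient.\<close>

lemma cube_series_regroup:
  fixes f :: "real ^ 'n \<Rightarrow> real"
  assumes "cube_series 0 r M f" and r: "0 < r"
  shows "\<exists>a. \<forall>y. (\<forall>i. \<bar>y $ i\<bar> \<le> r) \<longrightarrow> ((\<lambda>\<alpha>. monomial \<alpha> y * a \<alpha>) has_sum f y) UNIV"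
proof -
  obtain c :: "nat \<Rightarrow> real" and m S where f: "cube_expansion 0 r c m S f"
    using cube_seriesE[OF assms(1)] by blast
  define K where "K \<alpha> = {k. m k = \<alpha>}" for \<alpha>
  define a where "a \<alpha> = (\<Sum>\<^sub>\<infinity>k\<in>K \<alpha>. c k)" for \<alpha>
  have a: "(c has_sum a \<alpha>) (K \<alpha>)" for \<alpha>
  proof -
    have "(\<lambda>k. \<bar>c k\<bar> * r ^ total_degree (m k) * (1 / r ^ total_degree \<alpha>)) summable_on K \<alpha>"
      by (rule summable_on_subset_banach[OF has_sum_imp_summable[OF
            has_sum_cmult_left[OF cube_expansionD(2)[OF f]]]]) simp
    then have "(\<lambda>k. norm (c k)) summable_on K \<alpha>"
      by (rule summable_on_cong[THEN iffD1, rotated]) (use r in \<open>simp add: K_def\<close>)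
    then have "c summable_on K \<alpha>" by (rule abs_summable_summable)
    then show ?thesis unfolding a_def by (rule has_sum_infsum)
  qed
  have bij: "bij_betw snd (Sigma UNIV K) (UNIV :: nat set)"
    by (auto simp: bij_betw_def inj_on_def K_def image_iff)
  have "((\<lambda>\<alpha>. monomial \<alpha> y * a \<alpha>) has_sum f y) UNIV" if y: "\<And>i. \<bar>y $ i\<bar> \<le> r" for y
  proof (rule has_sum_SigmaD[where f = "\<lambda>p. c (snd p) * monomial (m (snd p)) y"])
    show "((\<lambda>p. c (snd p) * monomial (m (snd p)) y) has_sum f y) (Sigma UNIV K)"
      by (subst has_sum_reindex_bij_betw[OF bij, of "\<lambda>k. c k * monomial (m k) y"])
        (rule cube_expansionD(3)[OF f y])
    show "((\<lambda>k. c (snd (\<alpha>, k)) * monomial (m (snd (\<alpha>, k))) y) has_sum monomial \<alpha> y * a \<alpha>) (K \<alpha>)" for \<alpha>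
      by (rule has_sum_cong[THEN iffD1, OF _ has_sum_cmult_right[OF a]]) (simp add: K_def)
  qed
  then show ?thesis by blast
qed

lemma real_analytic_if_power_series_at:
  fixes f :: "real ^ 'n \<Rightarrow> real ^ 'm"
  assumes V: "open V" and f: "\<And>p i. p \<in> V \<Longrightarrow> power_series_at p (\<lambda>x. f x $ i)"
  shows "real_analytic_map_on f V"
  unfolding real_analytic_map_on_def
proof
  fix p assume p: "p \<in> V"
  obtain r M where r: "0 < r" and M: "\<And>i. cube_series 0 r M (\<lambda>y. f (p + y) $ i)"
    using power_series_at_common[OF finite[of UNIV], of p "\<lambda>i x. f x $ i"] f[OF p] by blast
  obtain d where d: "0 < d" "ball p d \<subseteq> V" using V p open_contains_ball by blast
  have "\<forall>i. \<exists>a. \<forall>y. (\<forall>j. \<bar>y $ j\<bar> \<le> r) \<longrightarrow> ((\<lambda>\<alpha>. monomial \<alpha> y * a \<alpha>) has_sum f (p + y) $ i) UNIV"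
    using cube_series_regroup[OF M r] by blast
  then obtain a where a: "\<And>i y. (\<And>j. \<bar>y $ j\<bar> \<le> r) \<Longrightarrow>
      ((\<lambda>\<alpha>. monomial \<alpha> y * a i \<alpha>) has_sum f (p + y) $ i) UNIV"
    by metis
  show "\<exists>\<delta>>0. \<exists>a. ball p \<delta> \<subseteq> V \<and>
      (\<forall>x\<in>ball p \<delta>. ((\<lambda>\<alpha>. (\<Prod>i\<in>UNIV. (x $ i - p $ i) ^ \<alpha> i) *\<^sub>R a \<alpha>) has_sum f x) UNIV)"
  proof (intro exI[of _ "min r d"] exI[of _ "\<lambda>\<alpha>. \<Sum>i\<in>UNIV. a i \<alpha> *\<^sub>R axis i 1"] conjI ballI)
    fix x assume x: "x \<in> ball p (min r d)"
    have "\<bar>(x - p) $ j\<bar> \<le> r" for j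
      using component_le_norm_cart[of "x - p" j] x by (simp add: dist_norm norm_minus_commute)
    from a[of "x - p", OF this]
    have "((\<lambda>\<alpha>. monomial \<alpha> (x - p) * a i \<alpha>) has_sum f x $ i) UNIV" for i by simp
    then have "((\<lambda>\<alpha>. (monomial \<alpha> (x - p) * a i \<alpha>) *\<^sub>R axis i (1::real)) has_sum (f x $ i) *\<^sub>R axis i 1) UNIV" for i
      by (rule has_sum_bounded_linear[OF bounded_linear_scaleR_left])
    then have "((\<lambda>\<alpha>. \<Sum>i\<in>UNIV. (monomial \<alpha> (x - p) * a i \<alpha>) *\<^sub>R axis i (1::real)) has_sum
        (\<Sum>i\<in>UNIV. (f x $ i) *\<^sub>R axis i 1)) UNIV"
      by (intro has_sum_finite_sum) auto
    also have "(\<Sum>i\<in>UNIV. (f x $ i) *\<^sub>R axis i 1) = f x"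
      using basis_expansion[of "f x"] by (simp add: scalar_mult_eq_scaleR)
    finally show "((\<lambda>\<alpha>. (\<Prod>i\<in>UNIV. (x $ i - p $ i) ^ \<alpha> i) *\<^sub>R (\<Sum>i\<in>UNIV. a i \<alpha> *\<^sub>R axis i (1::real))) has_sum f x) UNIV"
      by (simp add: scaleR_sum_right monomial_def)
  qed (use r d in auto)
qed

lemma real_analytic_bounded_linear:
  fixes f :: "real ^ 'n \<Rightarrow> 'b::real_normed_vector"
  assumes h: "bounded_linear h" and f: "real_analytic_map_on f U"
  shows "real_analytic_map_on (\<lambda>x. h (f x)) U"
  unfolding real_analytic_map_on_def
proof
  fix p assume "p \<in> U"
  then obtain \<delta> and a :: "('n \<Rightarrow> nat) \<Rightarrow> 'b" where \<delta>: "0 < \<delta>" "ball p \<delta> \<subseteq> U"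
    and a: "\<And>x. x \<in> ball p \<delta> \<Longrightarrow> ((\<lambda>\<alpha>. (\<Prod>i\<in>UNIV. (x $ i - p $ i) ^ \<alpha> i) *\<^sub>R a \<alpha>) has_sum f x) UNIV"
    using f unfolding real_analytic_map_on_def by meson
  have "((\<lambda>\<alpha>. (\<Prod>i\<in>UNIV. (x $ i - p $ i) ^ \<alpha> i) *\<^sub>R h (a \<alpha>)) has_sum h (f x)) UNIV"
    if "x \<in> ball p \<delta>" for x
    using has_sum_bounded_linear[OF h a[OF that]]
    by (simp add: linear_simps(5)[OF h])
  then show "\<exists>\<delta>>0. \<exists>a. ball p \<delta> \<subseteq> U \<and>
      (\<forall>x\<in>ball p \<delta>. ((\<lambda>\<alpha>. (\<Prod>i\<in>UNIV. (x $ i - p $ i) ^ \<alpha> i) *\<^sub>R a \<alpha>) has_sum h (f x)) UNIV)"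
    using \<delta> by (intro exI[of _ \<delta>] conjI exI[of _ "\<lambda>\<alpha>. h (a \<alpha>)"]) auto
qed

lemma real_analytic_add:
  fixes f g :: "real ^ 'n \<Rightarrow> 'b::real_normed_vector"
  assumes f: "real_analytic_map_on f U" and g: "real_analytic_map_on g U"
  shows "real_analytic_map_on (\<lambda>x. f x + g x) U"
  unfolding real_analytic_map_on_def
proof
  fix p assume p: "p \<in> U"
  obtain \<delta> and a :: "('n \<Rightarrow> nat) \<Rightarrow> 'b" where \<delta>: "0 < \<delta>" "ball p \<delta> \<subseteq> U"
    and a: "\<And>x. x \<in> ball p \<delta> \<Longrightarrow> ((\<lambda>\<alpha>. (\<Prod>i\<in>UNIV. (x $ i - p $ i) ^ \<alpha> i) *\<^sub>R a \<alpha>) has_sum f x) UNIV"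
    using f p unfolding real_analytic_map_on_def by meson
  obtain \<epsilon> and b :: "('n \<Rightarrow> nat) \<Rightarrow> 'b" where \<epsilon>: "0 < \<epsilon>" "ball p \<epsilon> \<subseteq> U"
    and b: "\<And>x. x \<in> ball p \<epsilon> \<Longrightarrow> ((\<lambda>\<alpha>. (\<Prod>i\<in>UNIV. (x $ i - p $ i) ^ \<alpha> i) *\<^sub>R b \<alpha>) has_sum g x) UNIV"
    using g p unfolding real_analytic_map_on_def by meson
  have "((\<lambda>\<alpha>. (\<Prod>i\<in>UNIV. (x $ i - p $ i) ^ \<alpha> i) *\<^sub>R (a \<alpha> + b \<alpha>)) has_sum f x + g x) UNIV"
    if "x \<in> ball p (min \<delta> \<epsilon>)" for x
    unfolding scaleR_add_right by (rule has_sum_add[OF a b]) (use that in auto)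
  then show "\<exists>\<delta>>0. \<exists>a. ball p \<delta> \<subseteq> U \<and>
      (\<forall>x\<in>ball p \<delta>. ((\<lambda>\<alpha>. (\<Prod>i\<in>UNIV. (x $ i - p $ i) ^ \<alpha> i) *\<^sub>R a \<alpha>) has_sum f x + g x) UNIV)"
    using \<delta> \<epsilon> by (intro exI[of _ "min \<delta> \<epsilon>"] conjI exI[of _ "\<lambda>\<alpha>. a \<alpha> + b \<alpha>"]) auto
qed

section \<open>Maps of class C-r and their lifts through immersions\<close>

lemma power_series_at_imp_times_cont_diff_1:
  assumes "power_series_at p f"
  shows "\<exists>N. open N \<and> p \<in> N \<and> times_cont_diff_on (Suc 0) f N"
proof -
  obtain e L where e: "0 < e" and L: "\<And>z. z \<in> ball p e \<Longrightarrow> (f has_derivative L z) (at z)"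
    "\<And>v. continuous_on (ball p e) (\<lambda>z. L z v)"
    using power_series_at_continuously_differentiable[OF assms] by metis
  have "times_cont_diff_on (Suc 0) f (ball p e)"
    by (rule times_cont_diff_on_SucI[OF open_ball L(1)]) (use L(2) in auto)
  then show ?thesis using e by (intro exI[of _ "ball p e"]) auto
qed

text \<open>Everything before the regularity of \<open>\<psi>\<close> uses only one continuous derivative, so the smooth and the
  analytic case can be treated together.\<close>

lemma Cr_map_on_imp_C1:
  fixes f :: "real ^ 'n \<Rightarrow> 'b::euclidean_space"
  assumes f: "Cr_map_on r f U" and U: "open U"
  shows "times_cont_diff_on (Suc 0) f U"
proof (cases r)
  case C_infinity
  then have "smooth_map_on f U" using f by simp
  then show ?thesis unfolding smooth_map_on_def by blast
next
  case C_omega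
  then have an: "real_analytic_map_on f U" using f by simp
  show ?thesis
    by (rule times_cont_diff_on_components[OF U], rule times_cont_diff_on_local)
      (rule power_series_at_imp_times_cont_diff_1[OF real_analytic_imp_power_series_at[OF an]])
qed

text \<open>This covers the Legendrian lift and its variant with the opposite normal.\<close>

lemma Cr_map_on_Pair_scaleR:
  fixes f g :: "real ^ 'n \<Rightarrow> 'b::euclidean_space"
  assumes f: "Cr_map_on r f U" and g: "Cr_map_on r g U" and U: "open U"
  shows "Cr_map_on r (\<lambda>x. (f x, c *\<^sub>R g x)) U"
proof -
  have 1: "bounded_linear (\<lambda>y::'b. (y, 0::'b))"
    by (intro bounded_linear_Pair bounded_linear_ident bounded_linear_zero)
  have 2: "bounded_linear (\<lambda>y::'b. (0::'b, c *\<^sub>R y))"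
    by (intro bounded_linear_Pair bounded_linear_scaleR_right bounded_linear_zero)
  have "Cr_map_on r (\<lambda>x. (f x, 0) + (0, c *\<^sub>R g x)) U"
  proof (cases r)
    case C_infinity
    then show ?thesis using f g
      by (auto simp: smooth_map_on_def intro!: times_cont_diff_on_add[OF U] times_cont_diff_on_bounded_linear[OF U 1] times_cont_diff_on_bounded_linear[OF U 2]
          simp del: add_Pair)
  next
    case C_omega
    then show ?thesis using f g
      by (auto intro!: real_analytic_add real_analytic_bounded_linear[OF 1] real_analytic_bounded_linear[OF 2]
          simp del: add_Pair)
  qed
  then show ?thesis by simp
qed

lemma Cr_map_on_subset:
  assumes f: "Cr_map_on r f U" and V: "open V" "V \<subseteq> U"
  shows "Cr_map_on r f V"
proof (cases r)
  case C_infinity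
  then show ?thesis using f times_cont_diff_on_subset[OF _ V(2)] by (auto simp: smooth_map_on_def)
next
  case C_omega
  then have an: "real_analytic_map_on f U" using f by simp
  have "real_analytic_map_on f V"
    unfolding real_analytic_map_on_def
  proof
    fix p assume p: "p \<in> V"
    then obtain \<delta> a where \<delta>: "0 < \<delta>" and a: "\<And>x. x \<in> ball p \<delta> \<Longrightarrow>
        ((\<lambda>\<alpha>. (\<Prod>i\<in>UNIV. (x $ i - p $ i) ^ \<alpha> i) *\<^sub>R a \<alpha>) has_sum f x) UNIV"
      using an V(2) unfolding real_analytic_map_on_def by (meson subsetD)
    obtain d where d: "0 < d" "ball p d \<subseteq> V" using V(1) p open_contains_ball by blast
    show "\<exists>\<delta>>0. \<exists>a. ball p \<delta> \<subseteq> V \<and>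
        (\<forall>x\<in>ball p \<delta>. ((\<lambda>\<alpha>. (\<Prod>i\<in>UNIV. (x $ i - p $ i) ^ \<alpha> i) *\<^sub>R a \<alpha>) has_sum f x) UNIV)"
      using \<delta> a d by (intro exI[of _ "min \<delta> d"] conjI exI[of _ a]) auto
  qed
  then show ?thesis using C_omega by simp
qed

text \<open>In the analytic case the components of \<open>\<Lambda> \<circ> L2\<close> and \<open>\<Lambda> \<circ> L1\<close> are inner products
  with fixed vectors, hence power series, and \<open>\<Lambda> \<circ> L2\<close> has derivative the identity
  at \<open>\<psi> q\<close>.\<close>

theorem Cr_lift:
  fixes L1 L2 :: "real ^ 'n \<Rightarrow> 'c::euclidean_space" and \<psi> :: "real ^ 'n \<Rightarrow> real ^ 'n"
  assumes V: "open V" and W: "open W" and L1: "Cr_map_on r L1 V" and L2: "Cr_map_on r L2 W"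
    and imm: "\<And>x. x \<in> W \<Longrightarrow> immersion_at L2 x"
    and cont: "continuous_on V \<psi>" and sub: "\<psi> ` V \<subseteq> W" and eq: "\<And>x. x \<in> V \<Longrightarrow> L2 (\<psi> x) = L1 x"
  shows "Cr_map_on r \<psi> V"
proof (cases r)
  case C_infinity
  then show ?thesis using smooth_lift[OF V _ _ cont sub eq imm W] L1 L2 by simp
next
  case C_omega
  then have an: "real_analytic_map_on L1 V" "real_analytic_map_on L2 W" using L1 L2 by auto
  have "power_series_at q (\<lambda>x. \<psi> x $ i)" if q: "q \<in> V" for q i
  proof -
    have \<psi>q: "\<psi> q \<in> W" using sub q by blast
    obtain \<Lambda> where \<Lambda>: "bounded_linear \<Lambda>" "\<And>v. \<Lambda> (frechet_derivative L2 (at (\<psi> q)) v) = v"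
      using derivative_left_inverse[OF imm[OF \<psi>q]] by blast
    have comp: "\<Lambda> w $ i = w \<bullet> adjoint \<Lambda> (axis i 1)" for w i
      using adjoint_works[of \<Lambda> w "axis i 1"] \<Lambda>(1) by (simp add: linear_conv_bounded_linear inner_axis)
    show ?thesis
    proof (rule analytic_inverse[where G = "\<lambda>x. \<Lambda> (L2 x)" and F = "\<lambda>x. \<Lambda> (L1 x)"])
      show "power_series_at (\<psi> q) (\<lambda>x. \<Lambda> (L2 x) $ i)" for i
        unfolding comp by (rule real_analytic_imp_power_series_at[OF an(2) \<psi>q])
      show "power_series_at q (\<lambda>x. \<Lambda> (L1 x) $ i)" for i
        unfolding comp by (rule real_analytic_imp_power_series_at[OF an(1) q])
      have "(L2 has_derivative frechet_derivative L2 (at (\<psi> q))) (at (\<psi> q))"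
        using imm[OF \<psi>q] by (simp add: immersion_at_def frechet_derivative_works)
      from bounded_linear.has_derivative[OF \<Lambda>(1) this]
      show "((\<lambda>x. \<Lambda> (L2 x)) has_derivative id) (at (\<psi> q))" by (simp add: \<Lambda>(2) id_def)
      show "isCont \<psi> q" using cont V q continuous_on_eq_continuous_at by blast
      show "\<forall>\<^sub>F z in nhds q. \<Lambda> (L2 (\<psi> z)) = \<Lambda> (L1 z)"
        unfolding eventually_nhds using V q eq by metis
    qed
  qed
  then have "real_analytic_map_on \<psi> V" by (rule real_analytic_if_power_series_at[OF V])
  then show ?thesis using C_omega by simp
qed

section \<open>Local injectivity of immersions\<close>

text \<open>In finite dimension continuity of the derivative along each basis vector controls its operator norm.\<close>

lemma C1_onorm_continuous:
  fixes f :: "'a::euclidean_space \<Rightarrow> 'b::real_normed_vector"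
  assumes f: "times_cont_diff_on (Suc 0) f U" and U: "open U" "p \<in> U" and e: "0 < e"
  shows "\<forall>\<^sub>F x in nhds p. onorm (\<lambda>v. frechet_derivative f (at x) v - frechet_derivative f (at p) v) < e"
proof -
  let ?D = "\<lambda>x. frechet_derivative f (at x)"
  let ?c = "e / (2 * DIM('a))"
  have c: "0 < ?c" using e by simp
  have "\<forall>\<^sub>F x in nhds p. norm (?D x b - ?D p b) < ?c" for b
  proof -
    have "continuous_on U (\<lambda>x. ?D x b)" using f by simp
    then have "isCont (\<lambda>x. ?D x b) p" using U continuous_on_eq_continuous_at by blast
    then have "filterlim (\<lambda>x. ?D x b) (nhds (?D p b)) (nhds p)"
      using isCont_def tendsto_at_iff_tendsto_nhds by blast
    from tendstoD[OF this c] show ?thesis by (simp add: dist_norm)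
  qed
  then have "\<forall>\<^sub>F x in nhds p. \<forall>b\<in>Basis. norm (?D x b - ?D p b) < ?c"
    by (simp add: eventually_ball_finite_distrib)
  moreover have "\<forall>\<^sub>F x in nhds p. x \<in> U" using U eventually_nhds by blast
  ultimately show ?thesis
  proof eventually_elim
    case (elim x)
    have lin: "linear (\<lambda>v. ?D x v - ?D p v)"
      using has_derivative_linear[OF times_cont_diff_on_differentiable[OF f elim(2)]]
        has_derivative_linear[OF times_cont_diff_on_differentiable[OF f U(2)]] by (rule linear_compose_sub)
    have "onorm (\<lambda>v. ?D x v - ?D p v) \<le> e / 2"
    proof (rule onorm_le)
      fix v
      have "?D x v - ?D p v = (\<lambda>v. ?D x v - ?D p v) (\<Sum>b\<in>Basis. (v \<bullet> b) *\<^sub>R b)"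
        by (simp add: euclidean_representation)
      also have "\<dots> = (\<Sum>b\<in>Basis. (v \<bullet> b) *\<^sub>R (?D x b - ?D p b))"
        using linear_sum[OF lin, of "\<lambda>b. (v \<bullet> b) *\<^sub>R b" Basis] linear_cmul[OF lin] by simp
      also have "norm \<dots> \<le> (\<Sum>b\<in>(Basis :: 'a set). norm v * ?c)"
      proof (rule sum_norm_le)
        fix b :: 'a assume b: "b \<in> Basis"
        show "norm ((v \<bullet> b) *\<^sub>R (?D x b - ?D p b)) \<le> norm v * ?c"
          unfolding norm_scaleR real_norm_def
          using Basis_le_norm[OF b, of v] elim(1) b by (intro mult_mono) auto
      qed
      also have "\<dots> = e / 2 * norm v" by simp
      finally show "norm (?D x v - ?D p v) \<le> e / 2 * norm v" .
    qed
    then show ?case using e by simp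
  qed
qed

lemma C1_immersion_locally_injective:
  fixes f :: "'a::euclidean_space \<Rightarrow> 'b::euclidean_space"
  assumes f: "times_cont_diff_on (Suc 0) f U" and U: "open U" "p \<in> U" and imm: "immersion_at f p"
  obtains r where "0 < r" "ball p r \<subseteq> U" "inj_on f (ball p r)"
proof -
  obtain \<Lambda> where \<Lambda>: "bounded_linear \<Lambda>" "\<And>v. \<Lambda> (frechet_derivative f (at p) v) = v"
    using derivative_left_inverse[OF imm] by blast
  have id: "\<Lambda> \<circ> frechet_derivative f (at p) = id" using \<Lambda>(2) by auto
  show thesis
  proof (rule has_derivative_locally_injective[where g' = \<Lambda> and f' = "\<lambda>x. frechet_derivative f (at x)",
        OF U(2,1) \<Lambda>(1) id times_cont_diff_on_differentiable[OF f]])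
    fix e :: real assume "0 < e"
    from C1_onorm_continuous[OF f U this]
    show "\<exists>d>0. \<forall>x. dist p x < d \<longrightarrow>
        onorm (\<lambda>v. frechet_derivative f (at x) v - frechet_derivative f (at p) v) < e"
      unfolding eventually_nhds_metric by (simp add: dist_commute)
  qed (use that in auto)
qed

section \<open>Critical values\<close>

text \<open>A copy of the index type that carries a well-order: the measure-theoretic theorem of Sard concerns
  coordinate spaces with ordered indices, while the index types of the maps at hand are merely finite.\<close>

typedef ('n::finite) ranked = "{..<CARD('n)}"
  by (rule exI[of _ 0]) simp

instantiation ranked :: (finite) "{finite, wellorder}"
begin

definition less_eq_ranked :: "'a ranked \<Rightarrow> 'a ranked \<Rightarrow> bool" where
  "less_eq_ranked i j \<longleftrightarrow> Rep_ranked i \<le> Rep_ranked j"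

definition less_ranked :: "'a ranked \<Rightarrow> 'a ranked \<Rightarrow> bool" where
  "less_ranked i j \<longleftrightarrow> Rep_ranked i < Rep_ranked j"

instance
proof
  show "finite (UNIV :: 'a ranked set)"
    using type_definition.univ[OF type_definition_ranked] by (metis finite_imageI finite_lessThan)
  show "P a" if "\<And>i. (\<And>j. j < i \<Longrightarrow> P j) \<Longrightarrow> P i" for P and a :: "'a ranked"
    by (induction a rule: measure_induct_rule[of Rep_ranked]) (auto intro: that simp: less_ranked_def)
qed (auto simp: less_eq_ranked_def less_ranked_def Rep_ranked_inject)

end

lemma card_ranked: "CARD('n ranked) = CARD('n::finite)"
  using type_definition.card[OF type_definition_ranked] by simp

text \<open>Renaming the coordinates by a bijection between \<open>'n ranked\<close> and \<open>'n\<close> changes neither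
  the rank of a derivative nor negligibility.\<close>

lemma sard:
  fixes f :: "real ^ 'n \<Rightarrow> real ^ 'n"
  assumes der: "\<And>x. x \<in> S \<Longrightarrow> (f has_derivative f' x) (at x)" and crit: "\<And>x. x \<in> S \<Longrightarrow> \<not> inj (f' x)"
  shows "negligible (f ` S)"
proof -
  obtain \<pi> :: "'n ranked \<Rightarrow> 'n" where \<pi>: "bij \<pi>"
    using finite_same_card_bij[of "UNIV :: 'n ranked set" "UNIV :: 'n set"] card_ranked by auto
  define T :: "real ^ 'n \<Rightarrow> real ^ 'n ranked" where "T x = (\<chi> j. x $ \<pi> j)" for x
  define T' :: "real ^ 'n ranked \<Rightarrow> real ^ 'n" where "T' y = (\<chi> i. y $ inv \<pi> i)" for y
  have T'T: "T' (T x) = x" for x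
    using \<pi> by (simp add: T_def T'_def vec_eq_iff bij_is_surj surj_f_inv_f)
  have T: "linear T" and T': "linear T'"
    by (auto intro!: linearI simp: T_def T'_def vec_eq_iff)
  then have bl: "bounded_linear T" "bounded_linear T'" by (auto simp: linear_conv_bounded_linear)
  have "negligible ((\<lambda>y. T (f (T' y))) ` (T ` S))"
  proof (rule baby_Sard[where f' = "\<lambda>y v. T (f' (T' y) (T' v))"])
    fix y assume "y \<in> T ` S"
    then have T'y: "T' y \<in> S" using T'T by auto
    have d: "((\<lambda>y. T (f (T' y))) has_derivative (\<lambda>v. T (f' (T' y) (T' v)))) (at y)"
      by (rule bounded_linear.has_derivative[OF bl(1)], rule has_derivative_compose[OF
            bounded_linear_imp_has_derivative[OF bl(2)] der[OF T'y]])
    then show "((\<lambda>y. T (f (T' y))) has_derivative (\<lambda>v. T (f' (T' y) (T' v)))) (at y within T ` S)"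
      by (rule has_derivative_at_withinI)
    have "\<not> inj (\<lambda>v. T (f' (T' y) (T' v)))"
    proof
      assume inj: "inj (\<lambda>v. T (f' (T' y) (T' v)))"
      have "inj (f' (T' y))"
      proof (rule injI)
        fix v w assume "f' (T' y) v = f' (T' y) w"
        then have "T (f' (T' y) (T' (T v))) = T (f' (T' y) (T' (T w)))" by (simp add: T'T)
        then have "T v = T w" using inj by (rule injD[where f = "\<lambda>v. T (f' (T' y) (T' v))", rotated])
        then show "v = w" by (metis T'T)
      qed
      with crit[OF T'y] show False by blast
    qed
    moreover have "(*v) (matrix (\<lambda>v. T (f' (T' y) (T' v)))) = (\<lambda>v. T (f' (T' y) (T' v)))"
      using has_derivative_linear[OF d] by (simp add: fun_eq_iff matrix_works)
    ultimately show "rank (matrix (\<lambda>v. T (f' (T' y) (T' v)))) < CARD('n ranked)"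
      unfolding less_rank_noninjective by simp
  qed simp
  then have neg: "negligible (T ` f ` S)" by (simp add: image_image T'T)
  have "negligible (T' ` T ` f ` S)"
    by (rule negligible_differentiable_image_negligible[OF _ neg])
      (auto simp: card_ranked intro: linear_imp_differentiable_on T')
  then show ?thesis by (simp add: image_image T'T)
qed

text \<open>Exhaust \<open>U\<close> by compact sets and take their intersections with the critical set; cover the open set of
  regular points by countably many closed balls on which \<open>g\<close> is injective.\<close>

lemma compact_cover_critical_or_injective:
  fixes g :: "real ^ 'n \<Rightarrow> real ^ 'n"
  assumes U: "open U" and g: "times_cont_diff_on (Suc 0) g U"
  obtains \<K> where "countable \<K>" "\<Union>\<K> = U" "\<And>K. K \<in> \<K> \<Longrightarrow> compact K"
    "\<And>K. K \<in> \<K> \<Longrightarrow> negligible (g ` K) \<or> (inj_on g K \<and> (\<forall>x\<in>K. immersion_at g x))"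
proof -
  let ?D = "\<lambda>x. frechet_derivative g (at x)"
  have gd: "(g has_derivative ?D x) (at x)" if "x \<in> U" for x
    using times_cont_diff_on_differentiable[OF g that] .
  have imm_iff: "immersion_at g x \<longleftrightarrow> det (matrix (?D x)) \<noteq> 0" if "x \<in> U" for x
    using gd[OF that] det_nz_iff_inj[OF has_derivative_linear[OF gd[OF that]]]
    by (auto simp: immersion_at_def differentiable_def)
  have "times_cont_diff_on 0 (\<lambda>x. matrix (?D x) $ i $ j) U" for i j
    using times_cont_diff_on_bounded_linear[OF U bounded_linear_vec_nth times_cont_diff_on_directional[OF g, of "axis j 1"], of i]
    by (simp add: matrix_def)
  from times_cont_diff_on_det[OF U this] have det: "continuous_on U (\<lambda>x. det (matrix (?D x)))" by simp
  define R where "R = {x \<in> U. immersion_at g x}"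
  have "open (U \<inter> (\<lambda>x. det (matrix (?D x))) -` (- {0}))"
    by (rule continuous_open_preimage[OF det U]) auto
  also have "U \<inter> (\<lambda>x. det (matrix (?D x))) -` (- {0}) = R"
    by (auto simp: R_def imm_iff)
  finally have R: "open R" .
  obtain C :: "nat \<Rightarrow> (real ^ 'n) set" where C: "\<And>n. compact (C n)" "\<And>n. C n \<subseteq> U" "\<Union>(range C) = U"
    using open_Union_compact_subsets[OF U] by metis
  have "\<exists>\<rho>>0. cball x \<rho> \<subseteq> R \<and> inj_on g (cball x \<rho>)" if x: "x \<in> R" for x
  proof -
    obtain r where r: "0 < r" "ball x r \<subseteq> U" "inj_on g (ball x r)"
      using C1_immersion_locally_injective[OF g U] x unfolding R_def by blast
    obtain d where d: "0 < d" "cball x d \<subseteq> R" using R x open_contains_cball by blast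
    \<comment> \<open>a closed ball inside the open ball of injectivity, to have compact pieces\<close>
    have "cball x (min d (r / 2)) \<subseteq> ball x r" using r by auto
    then show ?thesis using r d by (intro exI[of _ "min d (r / 2)"]) (auto intro: inj_on_subset)
  qed
  then obtain \<rho> where \<rho>: "\<And>x. x \<in> R \<Longrightarrow> 0 < \<rho> x \<and> cball x (\<rho> x) \<subseteq> R \<and> inj_on g (cball x (\<rho> x))"
    by metis
  obtain \<F> where \<F>: "\<F> \<subseteq> (\<lambda>x. ball x (\<rho> x)) ` R" "countable \<F>" "\<Union>\<F> = \<Union>((\<lambda>x. ball x (\<rho> x)) ` R)"
    using Lindelof[of "(\<lambda>x. ball x (\<rho> x)) ` R"] by auto
  obtain X where X: "countable X" "X \<subseteq> R" "\<F> = (\<lambda>x. ball x (\<rho> x)) ` X"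
    using \<F>(1,2) countable_subset_image by meson
  define \<K> where "\<K> = range (\<lambda>n. C n - R) \<union> (\<lambda>x. cball x (\<rho> x)) ` X"
  show thesis
  proof
    show "countable \<K>" using X(1) by (simp add: \<K>_def)
    have "R \<subseteq> \<Union>\<F>" unfolding \<F>(3) using \<rho> by auto
    also have "\<dots> \<subseteq> \<Union>((\<lambda>x. cball x (\<rho> x)) ` X)" unfolding X(3) by auto
    finally have "R \<subseteq> \<Union>((\<lambda>x. cball x (\<rho> x)) ` X)" .
    moreover have "\<Union>((\<lambda>x. cball x (\<rho> x)) ` X) \<subseteq> R" using \<rho> X(2) by blast
    ultimately have "\<Union>((\<lambda>x. cball x (\<rho> x)) ` X) = R" by (rule antisym[rotated])
    moreover have "\<Union>(range (\<lambda>n. C n - R)) = U - R" unfolding C(3)[symmetric] by auto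
    moreover have "R \<subseteq> U" by (auto simp: R_def)
    ultimately show "\<Union>\<K> = U" unfolding \<K>_def Union_Un_distrib by auto
    fix K assume K: "K \<in> \<K>"
    then consider n where "K = C n - R" | x where "x \<in> X" "K = cball x (\<rho> x)"
      unfolding \<K>_def by blast
    note cases = this
    show "compact K" using cases by cases (use C(1) R compact_diff in auto)
    show "negligible (g ` K) \<or> (inj_on g K \<and> (\<forall>x\<in>K. immersion_at g x))"
      using cases
    proof cases
      case 1
      have "negligible (g ` K)"
      proof (rule sard)
        fix x assume "x \<in> K"
        then have "x \<in> U" "x \<notin> R" using 1 C(2) by auto
        then show "(g has_derivative ?D x) (at x)" "\<not> inj (?D x)"
          using gd by (auto simp: R_def immersion_at_def differentiable_def)
      qed
      then show ?thesis ..
    next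
      case 2
      then show ?thesis using \<rho>[of x] X(2) by (auto simp: R_def)
    qed
  qed
qed

section \<open>Coincidence of tangent spaces and normals\<close>

text \<open>Baire's theorem on a closed ball. The open set \<open>T\<close> is found inside the open ball, because every
  point of the closed ball is a limit of points of the open one.\<close>

lemma countable_closed_cover_interior:
  fixes q :: "'a::euclidean_space"
  assumes "countable \<A>" "\<And>A. A \<in> \<A> \<Longrightarrow> closed A" "cball q r \<subseteq> \<Union>\<A>" and r: "0 < r"
  obtains A T where "A \<in> \<A>" "open T" "T \<noteq> {}" "T \<subseteq> A" "T \<subseteq> ball q r"
proof -
  let ?B = "cball q r"
  have "\<exists>A\<in>\<A>. \<not> ?B \<subseteq> closure (?B - A)"
  proof (rule ccontr)
    assume "\<not> ?thesis"
    then have "?B \<subseteq> closure (?B - A)" if "A \<in> \<A>" for A using that by blast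
    moreover have "openin (top_of_set ?B) (?B - A)" if "A \<in> \<A>" for A
      using assms(2)[OF that] by (metis Diff_eq open_Compl openin_open_Int)
    ultimately have "?B \<subseteq> closure (\<Inter>((\<lambda>A. ?B - A) ` \<A>))"
      using assms(1) by (intro Baire) auto
    moreover have "\<Inter>((\<lambda>A. ?B - A) ` \<A>) = {}"
    proof (rule ccontr)
      assume "\<Inter>((\<lambda>A. ?B - A) ` \<A>) \<noteq> {}"
      then obtain z where z: "\<And>A. A \<in> \<A> \<Longrightarrow> z \<in> ?B - A" by blast
      have "q \<in> ?B" using r by simp
      then have "q \<in> \<Union>\<A>" using assms(3) by blast
      then have "z \<in> ?B" using z by blast
      then show False using assms(3) z by blast
    qed
    ultimately show False using r by auto
  qed
  then obtain A z where A: "A \<in> \<A>" and z: "z \<in> ?B" "z \<notin> closure (?B - A)" by blast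
  define T where "T = ball q r - closure (?B - A)"
  have "z \<in> closure (ball q r)" using z r by simp
  moreover have "open (- closure (?B - A))" by auto
  ultimately have "(- closure (?B - A)) \<inter> ball q r \<noteq> {}"
    using z(2) open_Int_closure_eq_empty[of "- closure (?B - A)" "ball q r"] by blast
  then have "T \<noteq> {}" by (auto simp: T_def)
  moreover have "open T" unfolding T_def by (intro open_Diff) auto
  moreover have "T \<subseteq> A" using closure_subset[of "?B - A"] ball_subset_cball[of q r] unfolding T_def by blast
  ultimately show thesis using that A by (auto simp: T_def)
qed

text \<open>The images of two maps into a higher-dimensional space can touch without sharing a tangent space, but
  not along an open part of the image of an immersion. Projecting by a left inverse \<open>\<Lambda>\<close> of the derivative
  of \<open>f\<^sub>1\<close> at one point makes Sard's theorem in equal dimensions applicable.\<close>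

theorem common_tangent_space:
  fixes f\<^sub>1 f\<^sub>2 :: "real ^ 'n \<Rightarrow> real ^ 'm"
  assumes B: "open B" "B \<noteq> {}" and f1: "times_cont_diff_on (Suc 0) f\<^sub>1 B"
    and imm: "\<And>q. q \<in> B \<Longrightarrow> immersion_at f\<^sub>1 q"
    and U: "open U" and f2: "times_cont_diff_on (Suc 0) f\<^sub>2 U" and sub: "f\<^sub>1 ` B \<subseteq> f\<^sub>2 ` U"
  shows "\<exists>q\<in>B. \<exists>x\<in>U. f\<^sub>2 x = f\<^sub>1 q \<and>
    range (frechet_derivative f\<^sub>1 (at q)) \<subseteq> range (frechet_derivative f\<^sub>2 (at x))"
proof -
  obtain q0 where q0: "q0 \<in> B" using B by blast
  obtain \<Lambda> where \<Lambda>: "bounded_linear \<Lambda>" "\<And>v. \<Lambda> (frechet_derivative f\<^sub>1 (at q0) v) = v"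
    using derivative_left_inverse[OF imm[OF q0]] by blast
  define g1 where "g1 x = \<Lambda> (f\<^sub>1 x)" for x
  define g2 where "g2 x = \<Lambda> (f\<^sub>2 x)" for x
  have g1C: "times_cont_diff_on (Suc 0) g1 B" and g2C: "times_cont_diff_on (Suc 0) g2 U"
    unfolding g1_def g2_def using times_cont_diff_on_bounded_linear \<Lambda>(1) B(1) U f1 f2 by blast+
  have "(g1 has_derivative (\<lambda>v. v)) (at q0)"
    using bounded_linear.has_derivative[OF \<Lambda>(1) times_cont_diff_on_differentiable[OF f1 q0]]
    by (simp add: g1_def[abs_def] \<Lambda>(2))
  note g1' = this frechet_derivative_at[OF this, symmetric]
  have "immersion_at g1 q0"
    unfolding immersion_at_def g1'(2) using g1'(1) by (auto simp: differentiable_def inj_def)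
  then obtain \<rho> where \<rho>: "0 < \<rho>" "ball q0 \<rho> \<subseteq> B" "inj_on g1 (ball q0 \<rho>)"
    using C1_immersion_locally_injective[OF g1C B(1) q0] by blast
  define r where "r = \<rho> / 2"
  have r: "0 < r" "cball q0 r \<subseteq> ball q0 \<rho>" using \<rho>(1) by (auto simp: r_def)
  obtain \<K> where \<K>: "countable \<K>" "\<Union>\<K> = U" "\<And>K. K \<in> \<K> \<Longrightarrow> compact K"
    "\<And>K. K \<in> \<K> \<Longrightarrow> negligible (g2 ` K) \<or> (inj_on g2 K \<and> (\<forall>x\<in>K. immersion_at g2 x))"
    using compact_cover_critical_or_injective[OF U g2C] by metis
  have cont1: "continuous_on B f\<^sub>1" and cont2: "continuous_on U f\<^sub>2"
    using f1 f2 times_cont_diff_on_continuous by blast+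
  \<comment> \<open>the points near \<open>q0\<close> whose image is hit from the piece \<open>K\<close>\<close>
  define A where "A K = cball q0 r \<inter> f\<^sub>1 -` (f\<^sub>2 ` K)" for K
  have clA: "closed (A K)" if "K \<in> \<K>" for K
    unfolding A_def
  proof (rule continuous_closed_preimage)
    show "continuous_on (cball q0 r) f\<^sub>1" using cont1 r(2) \<rho>(2) by (meson continuous_on_subset)
    have "K \<subseteq> U" using \<K>(2) that by blast
    then show "closed (f\<^sub>2 ` K)"
      by (intro compact_imp_closed compact_continuous_image continuous_on_subset[OF cont2] \<K>(3) that)
  qed simp
  have cover: "cball q0 r \<subseteq> \<Union>(A ` \<K>)"
  proof
    fix z assume z: "z \<in> cball q0 r"
    then have "f\<^sub>1 z \<in> f\<^sub>2 ` U" using r(2) \<rho>(2) sub by blast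
    then show "z \<in> \<Union>(A ` \<K>)" using z \<K>(2) by (auto simp: A_def)
  qed
  obtain A' T where AT: "A' \<in> A ` \<K>" "open T" "T \<noteq> {}" "T \<subseteq> A'" "T \<subseteq> ball q0 r"
  proof (rule countable_closed_cover_interior[OF _ _ cover r(1)])
    show "countable (A ` \<K>)" using \<K>(1) by simp
    show "closed A'" if "A' \<in> A ` \<K>" for A' using that clA by blast
  qed (use that in blast)
  then obtain K where K: "K \<in> \<K>" "T \<subseteq> A K" by blast
  have TB: "T \<subseteq> ball q0 \<rho>" "T \<subseteq> B" using AT(5) r(2) \<rho>(2) ball_subset_cball by blast+
  have f12: "\<exists>x\<in>K. f\<^sub>2 x = f\<^sub>1 z" if "z \<in> T" for z using that K(2) by (force simp: A_def)
  have contg1: "continuous_on T g1" using times_cont_diff_on_continuous[OF g1C] TB(2) continuous_on_subset by blast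
  have "open (g1 ` T)"
    by (rule invariance_of_domain[OF contg1 AT(2)]) (use \<rho>(3) TB(1) inj_on_subset in blast)
  \<comment> \<open>so \<open>K\<close> is not one of the critical pieces\<close>
  then have "\<not> negligible (g1 ` T)" using open_not_negligible AT(3) by blast
  moreover have "g1 ` T \<subseteq> g2 ` K" using f12 by (force simp: g1_def g2_def)
  ultimately have "\<not> negligible (g2 ` K)" using negligible_subset by blast
  then have injK: "inj_on g2 K" and immK: "\<And>x. x \<in> K \<Longrightarrow> immersion_at g2 x" using \<K>(4)[OF K(1)] by blast+
  have KU: "K \<subseteq> U" using \<K>(2) K(1) by blast
  obtain h where h: "homeomorphism K (g2 ` K) g2 h"
    using homeomorphism_compact[OF \<K>(3)[OF K(1)] continuous_on_subset[OF times_cont_diff_on_continuous[OF g2C] KU] refl injK]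
    by blast
  define \<psi> where "\<psi> z = h (g1 z)" for z
  have \<psi>: "\<psi> z \<in> K \<and> f\<^sub>2 (\<psi> z) = f\<^sub>1 z" if z: "z \<in> T" for z
  proof -
    obtain x where x: "x \<in> K" "f\<^sub>2 x = f\<^sub>1 z" using f12[OF z] by blast
    then have "g1 z = g2 x" by (simp add: g1_def g2_def)
    then have "\<psi> z = x" using h x(1) by (simp add: \<psi>_def homeomorphism_def)
    then show ?thesis using x by simp
  qed
  obtain q where q: "q \<in> T" using AT(3) by blast
  have "continuous_on T \<psi>"
    unfolding \<psi>_def
    by (rule continuous_on_compose2[OF homeomorphism_cont2[OF h] contg1 \<open>g1 ` T \<subseteq> g2 ` K\<close>])
  then have cont: "isCont \<psi> q" using AT(2) q continuous_on_eq_continuous_at by blast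
  have \<psi>U: "\<psi> q \<in> U" using \<psi>[OF q] KU by blast
  have d2: "(f\<^sub>2 has_derivative frechet_derivative f\<^sub>2 (at (\<psi> q))) (at (\<psi> q))"
    by (rule times_cont_diff_on_differentiable[OF f2 \<psi>U])
  have "immersion_at f\<^sub>2 (\<psi> q)"
    using immersion_at_of_linear_image[OF \<Lambda>(1), of f\<^sub>2 "\<psi> q"] d2 immK \<psi>[OF q]
    by (auto simp: differentiable_def g2_def[abs_def])
  then obtain \<Lambda>' where \<Lambda>': "bounded_linear \<Lambda>'" "\<And>v. \<Lambda>' (frechet_derivative f\<^sub>2 (at (\<psi> q)) v) = v"
    using derivative_left_inverse by blast
  have qB: "q \<in> B" using q TB by blast
  have "\<forall>\<^sub>F z in nhds q. f\<^sub>2 (\<psi> z) = f\<^sub>1 z"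
    unfolding eventually_nhds using AT(2) q \<psi> by blast
  then have d\<psi>: "(\<psi> has_derivative (\<lambda>v. \<Lambda>' (frechet_derivative f\<^sub>1 (at q) v))) (at q)"
    using has_derivative_lift[where \<psi> = \<psi> and q = q, OF d2 \<Lambda>' times_cont_diff_on_differentiable[OF f1 qB] cont] by blast
  have "((\<lambda>z. f\<^sub>2 (\<psi> z)) has_derivative
      (\<lambda>v. frechet_derivative f\<^sub>2 (at (\<psi> q)) (\<Lambda>' (frechet_derivative f\<^sub>1 (at q) v)))) (at q)"
    by (rule has_derivative_compose[OF d\<psi> d2])
  then have "(f\<^sub>1 has_derivative
      (\<lambda>v. frechet_derivative f\<^sub>2 (at (\<psi> q)) (\<Lambda>' (frechet_derivative f\<^sub>1 (at q) v)))) (at q)"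
    by (rule has_derivative_transform_within_open[OF _ AT(2) q]) (use \<psi> in blast)
  from frechet_derivative_at[OF this]
  have "range (frechet_derivative f\<^sub>1 (at q)) \<subseteq> range (frechet_derivative f\<^sub>2 (at (\<psi> q)))"
    by (metis image_subsetI rangeI)
  then show ?thesis using qB \<psi>U \<psi>[OF q] by blast
qed

text \<open>The orthogonal complement of a hyperplane is a line.\<close>

lemma unit_normals_agree_up_to_sign:
  fixes A :: "real ^ 'n \<Rightarrow> real ^ 'm"
  assumes dim: "CARD('m) = CARD('n) + 1" and A: "linear A" "inj A"
    and u: "norm u = 1" "\<And>v. u \<bullet> A v = 0" and w: "norm w = 1" "\<And>v. w \<bullet> A v = 0"
  shows "u = w \<or> u = - w"
proof -
  let ?N = "{y \<in> UNIV. \<forall>x\<in>range A. orthogonal x y}"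
  have "dim (range A) = CARD('n)"
    using dim_image_eq[OF A(1), of UNIV] A(2) by simp
  moreover have "dim ?N + dim (range A) = dim (UNIV :: (real ^ 'm) set)"
    by (rule dim_subspace_orthogonal_to_vectors) (auto intro: linear_subspace_image A)
  ultimately have "dim ?N = 1" using dim by simp
  have wN: "w \<in> ?N" "u \<in> ?N" using u(2) w(2) by (auto simp: orthogonal_def inner_commute)
  have "w \<noteq> 0" using w(1) by auto
  then have "?N \<subseteq> span {w}"
    using \<open>dim ?N = 1\<close> wN by (intro card_ge_dim_independent) auto
  then obtain c where c: "u = c *\<^sub>R w" using wN(2) by (auto simp: span_singleton)
  then have "\<bar>c\<bar> = 1" using u(1) w(1) by simp
  then have "c = 1 \<or> c = -1" by linarith
  then show ?thesis using c by auto
qed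

section \<open>Reparametrization of frontals and wave fronts\<close>

text \<open>The preimages of small closed balls around \<open>f p\<close> form a decreasing family of compact sets with intersection
  the fibre \<open>{p}\<close>, so they eventually lie in any neighbourhood of \<open>p\<close>.\<close>

lemma proper_at_small_preimage:
  fixes f :: "'a::t2_space \<Rightarrow> 'b::{real_normed_vector, heine_borel}"
  assumes proper: "proper_at f U p" and fib: "{x \<in> U. f x = f p} = {p}"
    and cont: "continuous_on U f" and W: "open W" "p \<in> W"
  obtains \<rho> where "0 < \<rho>" "compact {x \<in> U. f x \<in> cball (f p) \<rho>}" "{x \<in> U. f x \<in> cball (f p) \<rho>} \<subseteq> W"
proof -
  let ?K = "\<lambda>\<rho>. {x \<in> U. f x \<in> cball (f p) \<rho>}"
  obtain \<rho>0 where \<rho>0: "0 < \<rho>0" "compact (?K \<rho>0)"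
    using proper zero_less_one unfolding proper_at_def by (metis closure_ball)
  have contK: "continuous_on (?K \<rho>0) f" using cont by (rule continuous_on_subset) auto
  have comp: "compact (?K \<rho>)" if "\<rho> \<le> \<rho>0" for \<rho>
  proof -
    have "closed (?K \<rho>0 \<inter> f -` cball (f p) \<rho>)"
      by (rule continuous_closed_preimage[OF contK compact_imp_closed[OF \<rho>0(2)] closed_cball])
    then have "compact (?K \<rho>0 \<inter> (?K \<rho>0 \<inter> f -` cball (f p) \<rho>))"
      by (rule compact_Int_closed[OF \<rho>0(2)])
    also have "?K \<rho>0 \<inter> (?K \<rho>0 \<inter> f -` cball (f p) \<rho>) = ?K \<rho>" using that by auto
    finally show ?thesis .
  qed
  show thesis
  proof (cases "?K \<rho>0 \<subseteq> W")
    case True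
    then show ?thesis using that \<rho>0 by blast
  next
    case False
    have "compact (?K \<rho>0 - W)" by (rule compact_diff[OF \<rho>0(2) W(1)])
    moreover have "?K \<rho>0 - W \<noteq> {}" using False by blast
    moreover have "continuous_on (?K \<rho>0 - W) (\<lambda>x. dist (f p) (f x))"
      by (intro continuous_intros continuous_on_subset[OF contK]) auto
    ultimately have "\<exists>x0\<in>?K \<rho>0 - W. \<forall>x\<in>?K \<rho>0 - W. dist (f p) (f x0) \<le> dist (f p) (f x)"
      by (rule continuous_attains_inf)
    then obtain x0 where x0: "x0 \<in> ?K \<rho>0 - W"
      "\<And>x. x \<in> ?K \<rho>0 - W \<Longrightarrow> dist (f p) (f x0) \<le> dist (f p) (f x)"
      by blast
    have "f x0 \<noteq> f p"
    proof
      assume "f x0 = f p"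
      with x0(1) have "x0 \<in> {x \<in> U. f x = f p}" by simp
      then show False unfolding fib using x0(1) W(2) by simp
    qed
    then have m: "0 < dist (f p) (f x0)" by simp
    let ?\<rho> = "min \<rho>0 (dist (f p) (f x0) / 2)"
    show ?thesis
    proof (rule that)
      show "0 < ?\<rho>" using m \<rho>0 by simp
      show "compact (?K ?\<rho>)" by (rule comp) simp
      show "?K ?\<rho> \<subseteq> W"
      proof
        fix x assume x: "x \<in> ?K ?\<rho>"
        then have "dist (f p) (f x) \<le> dist (f p) (f x0) / 2" and "x \<in> ?K \<rho>0" by auto
        moreover from this(1) have "dist (f p) (f x) < dist (f p) (f x0)" using m by linarith
        ultimately have "dist (f p) (f x) < dist (f p) (f x0)" "x \<in> ?K \<rho>0" by auto
        then show "x \<in> W" using x0(2)[of x] by force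
      qed
    qed
  qed
qed

text \<open>On a dense set of points \<open>q\<close> the tangent spaces agree at some \<open>x\<close> over \<open>f\<^sub>1 q\<close>. These \<open>x\<close> stay in
  a compact set, and the conditions on \<open>(q, x)\<close> are closed, so a limit point of the \<open>x\<close> serves for a limit of
  the \<open>q\<close>.\<close>

lemma normals_match_up_to_sign:
  fixes f\<^sub>1 f\<^sub>2 \<nu>\<^sub>1 \<nu>\<^sub>2 :: "real ^ 'n \<Rightarrow> real ^ 'm"
  assumes dim: "CARD('m) = CARD('n) + 1" and U: "open U\<^sub>1" "open U\<^sub>2"
    and f: "times_cont_diff_on (Suc 0) f\<^sub>1 U\<^sub>1" "times_cont_diff_on (Suc 0) f\<^sub>2 U\<^sub>2"
    and \<nu>: "continuous_on U\<^sub>1 \<nu>\<^sub>1" "continuous_on U\<^sub>2 \<nu>\<^sub>2"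
    and unit: "\<And>x. x \<in> U\<^sub>1 \<Longrightarrow> norm (\<nu>\<^sub>1 x) = 1" "\<And>x. x \<in> U\<^sub>2 \<Longrightarrow> norm (\<nu>\<^sub>2 x) = 1"
    and orth: "\<And>x v. x \<in> U\<^sub>1 \<Longrightarrow> \<nu>\<^sub>1 x \<bullet> frechet_derivative f\<^sub>1 (at x) v = 0"
      "\<And>x v. x \<in> U\<^sub>2 \<Longrightarrow> \<nu>\<^sub>2 x \<bullet> frechet_derivative f\<^sub>2 (at x) v = 0"
    and sub: "f\<^sub>1 ` U\<^sub>1 \<subseteq> f\<^sub>2 ` U\<^sub>2"
    and reg: "open (regular_set f\<^sub>1 U\<^sub>1)" "U\<^sub>1 \<subseteq> closure (regular_set f\<^sub>1 U\<^sub>1)"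
    and K: "compact {x \<in> U\<^sub>2. f\<^sub>2 x \<in> cball P \<rho>}" and q: "q \<in> U\<^sub>1" "f\<^sub>1 q \<in> ball P \<rho>"
  shows "\<exists>x\<in>U\<^sub>2. f\<^sub>2 x = f\<^sub>1 q \<and> (\<nu>\<^sub>1 q = \<nu>\<^sub>2 x \<or> \<nu>\<^sub>1 q = - \<nu>\<^sub>2 x)"
proof -
  let ?K = "{x \<in> U\<^sub>2. f\<^sub>2 x \<in> cball P \<rho>}"
  have cont: "continuous_on U\<^sub>1 f\<^sub>1" "continuous_on U\<^sub>2 f\<^sub>2" using f times_cont_diff_on_continuous by blast+
  define G where "G = {q \<in> U\<^sub>1. \<exists>x\<in>?K. f\<^sub>2 x = f\<^sub>1 q \<and> (\<nu>\<^sub>1 q = \<nu>\<^sub>2 x \<or> \<nu>\<^sub>1 q = - \<nu>\<^sub>2 x)}"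
  have "q \<in> closure G"
  proof (rule ccontr)
    assume "q \<notin> closure G"
    \<comment> \<open>an open set that would contain a regular point, hence a point of \<open>G\<close>\<close>
    define T where "T = (U\<^sub>1 \<inter> f\<^sub>1 -` ball P \<rho>) \<inter> - closure G"
    have T: "open T" unfolding T_def
      by (intro open_Int continuous_open_preimage cont U) auto
    have "q \<in> T" using q \<open>q \<notin> closure G\<close> by (simp add: T_def)
    then have "T \<inter> closure (regular_set f\<^sub>1 U\<^sub>1) \<noteq> {}" using reg(2) q(1) by blast
    then have ne: "T \<inter> regular_set f\<^sub>1 U\<^sub>1 \<noteq> {}" using open_Int_closure_eq_empty[OF T] by blast
    have TU: "T \<inter> regular_set f\<^sub>1 U\<^sub>1 \<subseteq> U\<^sub>1" by (auto simp: T_def)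
    have "\<exists>q\<in>T \<inter> regular_set f\<^sub>1 U\<^sub>1. \<exists>x\<in>U\<^sub>2. f\<^sub>2 x = f\<^sub>1 q \<and>
        range (frechet_derivative f\<^sub>1 (at q)) \<subseteq> range (frechet_derivative f\<^sub>2 (at x))"
    proof (rule common_tangent_space[OF _ ne times_cont_diff_on_subset[OF f(1) TU] _ U(2) f(2)])
      show "open (T \<inter> regular_set f\<^sub>1 U\<^sub>1)" by (intro open_Int T reg(1))
      show "immersion_at f\<^sub>1 q" if "q \<in> T \<inter> regular_set f\<^sub>1 U\<^sub>1" for q
        using that by (simp add: regular_set_def)
      show "f\<^sub>1 ` (T \<inter> regular_set f\<^sub>1 U\<^sub>1) \<subseteq> f\<^sub>2 ` U\<^sub>2" using TU sub by blast
    qed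
    then obtain z x where z: "z \<in> T" "z \<in> regular_set f\<^sub>1 U\<^sub>1" and x: "x \<in> U\<^sub>2" "f\<^sub>2 x = f\<^sub>1 z"
      and ran: "range (frechet_derivative f\<^sub>1 (at z)) \<subseteq> range (frechet_derivative f\<^sub>2 (at x))"
      by blast
    have zU: "z \<in> U\<^sub>1" and zP: "f\<^sub>1 z \<in> ball P \<rho>" using z(1) by (auto simp: T_def)
    have "\<nu>\<^sub>1 z = \<nu>\<^sub>2 x \<or> \<nu>\<^sub>1 z = - \<nu>\<^sub>2 x"
    proof (rule unit_normals_agree_up_to_sign[OF dim])
      show "linear (frechet_derivative f\<^sub>1 (at z))"
        by (rule has_derivative_linear[OF times_cont_diff_on_differentiable[OF f(1) zU]])
      show "inj (frechet_derivative f\<^sub>1 (at z))"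
        using z(2) by (simp add: regular_set_def immersion_at_def)
      fix v
      obtain w where "frechet_derivative f\<^sub>1 (at z) v = frechet_derivative f\<^sub>2 (at x) w"
        using ran by blast
      then show "\<nu>\<^sub>2 x \<bullet> frechet_derivative f\<^sub>1 (at z) v = 0" using orth(2)[OF x(1)] by simp
    qed (use unit orth(1) zU x in auto)
    then have "z \<in> G" using zU x zP by (auto simp: G_def)
    then show False using z(1) closure_subset[of G] by (auto simp: T_def)
  qed
  then obtain s where s: "\<And>k. s k \<in> G" "s \<longlonglongrightarrow> q" unfolding closure_sequential by blast
  have sU: "s k \<in> U\<^sub>1" for k using s(1) by (simp add: G_def)
  have "\<forall>k. \<exists>x. x \<in> ?K \<and> f\<^sub>2 x = f\<^sub>1 (s k) \<and> (\<nu>\<^sub>1 (s k) = \<nu>\<^sub>2 x \<or> \<nu>\<^sub>1 (s k) = - \<nu>\<^sub>2 x)"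
    using s(1) unfolding G_def by blast
  from choice[OF this] obtain x where xK: "\<And>k. x k \<in> ?K" and xf: "\<And>k. f\<^sub>2 (x k) = f\<^sub>1 (s k)"
    and x\<nu>: "\<And>k. \<nu>\<^sub>1 (s k) = \<nu>\<^sub>2 (x k) \<or> \<nu>\<^sub>1 (s k) = - \<nu>\<^sub>2 (x k)"
    by blast
  obtain l r where l: "l \<in> ?K" and r: "strict_mono r" "(x \<circ> r) \<longlonglongrightarrow> l"
    by (rule seq_compactE[OF compact_imp_seq_compact[OF K] allI[OF xK]])
  have lim_x: "(\<lambda>k. x (r k)) \<longlonglongrightarrow> l" using r(2) by (simp add: o_def)
  have lim_s: "(\<lambda>k. s (r k)) \<longlonglongrightarrow> q" using LIMSEQ_subseq_LIMSEQ[OF s(2) r(1)] by (simp add: o_def)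
  have lU: "l \<in> U\<^sub>2" using l by simp
  have lim1: "(\<lambda>k. h (s (r k))) \<longlonglongrightarrow> h q" if "continuous_on U\<^sub>1 h" for h :: "real ^ 'n \<Rightarrow> real ^ 'm"
    by (rule continuous_on_tendsto_compose[OF that lim_s q(1)]) (use sU in simp)
  have lim2: "(\<lambda>k. h (x (r k))) \<longlonglongrightarrow> h l" if "continuous_on U\<^sub>2 h" for h :: "real ^ 'n \<Rightarrow> real ^ 'm"
    by (rule continuous_on_tendsto_compose[OF that lim_x lU]) (use xK in simp)
  have "f\<^sub>2 l = f\<^sub>1 q"
    using LIMSEQ_unique[OF lim2[OF cont(2)]] lim1[OF cont(1)] by (simp add: xf)
  moreover have "(\<nu>\<^sub>1 q, \<nu>\<^sub>2 l) \<in> {p. fst p = snd p} \<union> {p. fst p = - snd p}"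
  proof (rule closed_sequentially)
    show "closed ({p :: (real ^ 'm) \<times> (real ^ 'm). fst p = snd p} \<union> {p. fst p = - snd p})"
      by (intro closed_Un closed_Collect_eq continuous_intros)
    show "(\<lambda>k. (\<nu>\<^sub>1 (s (r k)), \<nu>\<^sub>2 (x (r k)))) \<longlonglongrightarrow> (\<nu>\<^sub>1 q, \<nu>\<^sub>2 l)"
      by (intro tendsto_Pair lim1 lim2 \<nu>)
  qed (use x\<nu> in simp)
  ultimately show ?thesis using lU by auto
qed

text \<open>The map \<open>\<psi>\<close> is the inverse of the signed lift \<open>M\<close> of \<open>f\<^sub>2\<close> on a compact set, composed with the lift \<open>L\<close> of
  \<open>f\<^sub>1\<close>. The sign \<open>\<sigma>\<close> is read off at the base points; on neighbourhoods where the normals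
  form acute angles with their values at the base points no other sign is possible.\<close>

theorem frontal_reparametrization:
  fixes f\<^sub>1 f\<^sub>2 \<nu>\<^sub>1 \<nu>\<^sub>2 :: "real ^ 'n \<Rightarrow> real ^ 'm"
  assumes dim: "CARD('m) = CARD('n) + 1" and U: "open U\<^sub>1" "open U\<^sub>2" and p: "p\<^sub>1 \<in> U\<^sub>1" "p\<^sub>2 \<in> U\<^sub>2"
    and f: "times_cont_diff_on (Suc 0) f\<^sub>1 U\<^sub>1" "times_cont_diff_on (Suc 0) f\<^sub>2 U\<^sub>2"
    and \<nu>: "continuous_on U\<^sub>1 \<nu>\<^sub>1" "continuous_on U\<^sub>2 \<nu>\<^sub>2"
    and unit: "\<And>x. x \<in> U\<^sub>1 \<Longrightarrow> norm (\<nu>\<^sub>1 x) = 1" "\<And>x. x \<in> U\<^sub>2 \<Longrightarrow> norm (\<nu>\<^sub>2 x) = 1"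
    and orth: "\<And>x v. x \<in> U\<^sub>1 \<Longrightarrow> \<nu>\<^sub>1 x \<bullet> frechet_derivative f\<^sub>1 (at x) v = 0"
      "\<And>x v. x \<in> U\<^sub>2 \<Longrightarrow> \<nu>\<^sub>2 x \<bullet> frechet_derivative f\<^sub>2 (at x) v = 0"
    and sub: "f\<^sub>1 ` U\<^sub>1 \<subseteq> f\<^sub>2 ` U\<^sub>2" and P: "f\<^sub>1 p\<^sub>1 = f\<^sub>2 p\<^sub>2"
    and proper: "proper_at f\<^sub>2 U\<^sub>2 p\<^sub>2" and fib: "{x \<in> U\<^sub>2. f\<^sub>2 x = f\<^sub>2 p\<^sub>2} = {p\<^sub>2}"
    and reg: "open (regular_set f\<^sub>1 U\<^sub>1)" "U\<^sub>1 \<subseteq> closure (regular_set f\<^sub>1 U\<^sub>1)"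
    and inj: "locally_injective_at (legendrian_lift f\<^sub>1 \<nu>\<^sub>1) U\<^sub>1 p\<^sub>1"
      "locally_injective_at (legendrian_lift f\<^sub>2 \<nu>\<^sub>2) U\<^sub>2 p\<^sub>2"
  obtains V\<^sub>1 V\<^sub>2 \<psi> \<phi> \<sigma> where
    "open V\<^sub>1" "connected V\<^sub>1" "p\<^sub>1 \<in> V\<^sub>1" "closure V\<^sub>1 \<subseteq> U\<^sub>1"
    "open V\<^sub>2" "connected V\<^sub>2" "p\<^sub>2 \<in> V\<^sub>2" "closure V\<^sub>2 \<subseteq> U\<^sub>2"
    "homeomorphism V\<^sub>1 V\<^sub>2 \<psi> \<phi>" "\<sigma> = 1 \<or> \<sigma> = (- 1 :: real)"
    "\<And>x. x \<in> V\<^sub>1 \<Longrightarrow> f\<^sub>1 x = f\<^sub>2 (\<psi> x) \<and> \<nu>\<^sub>1 x = \<sigma> *\<^sub>R \<nu>\<^sub>2 (\<psi> x)"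
proof -
  have cont: "continuous_on U\<^sub>1 f\<^sub>1" "continuous_on U\<^sub>2 f\<^sub>2" using f times_cont_diff_on_continuous by blast+
  obtain N\<^sub>1 where N1: "open N\<^sub>1" "p\<^sub>1 \<in> N\<^sub>1" "N\<^sub>1 \<subseteq> U\<^sub>1" "inj_on (legendrian_lift f\<^sub>1 \<nu>\<^sub>1) N\<^sub>1"
    using inj(1) unfolding locally_injective_at_def by blast
  obtain N\<^sub>2 where N2: "open N\<^sub>2" "p\<^sub>2 \<in> N\<^sub>2" "N\<^sub>2 \<subseteq> U\<^sub>2" "inj_on (legendrian_lift f\<^sub>2 \<nu>\<^sub>2) N\<^sub>2"
    using inj(2) unfolding locally_injective_at_def by blast
  \<comment> \<open>where the lift is injective and the normal points to the same side as at \<open>p\<^sub>2\<close>\<close>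
  define W\<^sub>2 where "W\<^sub>2 = N\<^sub>2 \<inter> (\<lambda>x. \<nu>\<^sub>2 x \<bullet> \<nu>\<^sub>2 p\<^sub>2) -` {0<..}"
  have W2: "open W\<^sub>2" unfolding W\<^sub>2_def
    by (intro continuous_open_preimage N2 continuous_intros continuous_on_subset[OF \<nu>(2)] open_greaterThan)
  have pW2: "p\<^sub>2 \<in> W\<^sub>2" using N2(2) unit(2)[OF p(2)] by (auto simp: W\<^sub>2_def)
  obtain \<rho> where \<rho>: "0 < \<rho>" and K: "compact {x \<in> U\<^sub>2. f\<^sub>2 x \<in> cball (f\<^sub>2 p\<^sub>2) \<rho>}"
    and KW: "{x \<in> U\<^sub>2. f\<^sub>2 x \<in> cball (f\<^sub>2 p\<^sub>2) \<rho>} \<subseteq> W\<^sub>2"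
    using proper_at_small_preimage[OF proper fib cont(2) W2 pW2] by blast
  let ?K = "{x \<in> U\<^sub>2. f\<^sub>2 x \<in> cball (f\<^sub>2 p\<^sub>2) \<rho>}"
  have match: "\<exists>x\<in>?K. \<exists>\<tau>. (\<tau> = 1 \<or> \<tau> = - 1) \<and> f\<^sub>2 x = f\<^sub>1 q \<and> \<nu>\<^sub>1 q = \<tau> *\<^sub>R \<nu>\<^sub>2 x"
    if q: "q \<in> U\<^sub>1" "f\<^sub>1 q \<in> ball (f\<^sub>2 p\<^sub>2) \<rho>" for q
  proof -
    obtain x where x: "x \<in> U\<^sub>2" "f\<^sub>2 x = f\<^sub>1 q" "\<nu>\<^sub>1 q = \<nu>\<^sub>2 x \<or> \<nu>\<^sub>1 q = - \<nu>\<^sub>2 x"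
      using normals_match_up_to_sign[OF dim U f \<nu> unit orth sub reg K q] by blast
    then have "\<exists>\<tau>. (\<tau> = 1 \<or> \<tau> = - 1) \<and> \<nu>\<^sub>1 q = \<tau> *\<^sub>R \<nu>\<^sub>2 x" by force
    then show ?thesis using x q(2) by (intro bexI[of _ x]) auto
  qed
  obtain \<sigma> where \<sigma>: "\<sigma> = 1 \<or> \<sigma> = (- 1 :: real)" and \<nu>p: "\<nu>\<^sub>1 p\<^sub>1 = \<sigma> *\<^sub>R \<nu>\<^sub>2 p\<^sub>2"
  proof -
    have "f\<^sub>1 p\<^sub>1 \<in> ball (f\<^sub>2 p\<^sub>2) \<rho>" using \<rho> P by simp
    from match[OF p(1) this] obtain x \<tau> where x: "x \<in> ?K" "\<tau> = 1 \<or> \<tau> = (- 1 :: real)"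
      "f\<^sub>2 x = f\<^sub>1 p\<^sub>1" "\<nu>\<^sub>1 p\<^sub>1 = \<tau> *\<^sub>R \<nu>\<^sub>2 x" by blast
    then have "x \<in> {x \<in> U\<^sub>2. f\<^sub>2 x = f\<^sub>2 p\<^sub>2}" using P by simp
    then have "x = p\<^sub>2" unfolding fib by simp
    then show thesis using that x by blast
  qed
  define W\<^sub>1 where "W\<^sub>1 = N\<^sub>1 \<inter> f\<^sub>1 -` ball (f\<^sub>2 p\<^sub>2) \<rho> \<inter> (N\<^sub>1 \<inter> (\<lambda>x. \<nu>\<^sub>1 x \<bullet> \<nu>\<^sub>1 p\<^sub>1) -` {0<..})"
  have W1: "open W\<^sub>1" unfolding W\<^sub>1_def
    by (intro open_Int continuous_open_preimage N1 continuous_intros continuous_on_subset[OF \<nu>(1)]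
        continuous_on_subset[OF cont(1)] open_greaterThan open_ball)
  have pW1: "p\<^sub>1 \<in> W\<^sub>1" using N1(2) unit(1)[OF p(1)] \<rho> P by (auto simp: W\<^sub>1_def)
  have W1U: "W\<^sub>1 \<subseteq> N\<^sub>1" "W\<^sub>1 \<subseteq> U\<^sub>1" using N1(3) by (auto simp: W\<^sub>1_def)
  define M where "M x = (f\<^sub>2 x, \<sigma> *\<^sub>R \<nu>\<^sub>2 x)" for x
  define L where "L = legendrian_lift f\<^sub>1 \<nu>\<^sub>1"
  have L: "L x = (f\<^sub>1 x, \<nu>\<^sub>1 x)" for x by (simp add: L_def legendrian_lift_def)
  have LM: "L ` W\<^sub>1 \<subseteq> M ` ?K"
  proof
    fix y assume "y \<in> L ` W\<^sub>1"
    then obtain q where q: "q \<in> W\<^sub>1" "y = L q" by blast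
    then have "q \<in> U\<^sub>1" "f\<^sub>1 q \<in> ball (f\<^sub>2 p\<^sub>2) \<rho>" using W1U by (auto simp: W\<^sub>1_def)
    from match[OF this] obtain x \<tau> where x: "x \<in> ?K" "\<tau> = 1 \<or> \<tau> = (- 1 :: real)"
      "f\<^sub>2 x = f\<^sub>1 q" "\<nu>\<^sub>1 q = \<tau> *\<^sub>R \<nu>\<^sub>2 x" by blast
    have "0 < \<nu>\<^sub>1 q \<bullet> \<nu>\<^sub>1 p\<^sub>1" using q(1) by (simp add: W\<^sub>1_def)
    then have "0 < (\<tau> * \<sigma>) * (\<nu>\<^sub>2 x \<bullet> \<nu>\<^sub>2 p\<^sub>2)" by (simp add: x(4) \<nu>p mult_ac)
    moreover have "0 < \<nu>\<^sub>2 x \<bullet> \<nu>\<^sub>2 p\<^sub>2" using x(1) KW by (auto simp: W\<^sub>2_def)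
    ultimately have "0 < \<tau> * \<sigma>" by (simp add: zero_less_mult_iff)
    then have "\<tau> = \<sigma>" using x(2) \<sigma> by auto
    then have "y = M x" using x q by (simp add: L M_def)
    then show "y \<in> M ` ?K" using x(1) by blast
  qed
  have injM: "inj_on M ?K"
  proof (rule inj_onI)
    fix x y assume xy: "x \<in> ?K" "y \<in> ?K" and "M x = M y"
    then have "legendrian_lift f\<^sub>2 \<nu>\<^sub>2 x = legendrian_lift f\<^sub>2 \<nu>\<^sub>2 y"
      using \<sigma> by (auto simp: M_def legendrian_lift_def)
    moreover have "x \<in> N\<^sub>2" "y \<in> N\<^sub>2" using xy KW by (auto simp: W\<^sub>2_def)
    ultimately show "x = y" using inj_onD[OF N2(4)] by blast
  qed
  have KU: "?K \<subseteq> U\<^sub>2" by auto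
  have contM: "continuous_on ?K M" unfolding M_def
    by (intro continuous_intros continuous_on_subset[OF cont(2) KU] continuous_on_subset[OF \<nu>(2) KU])
  obtain g where g: "homeomorphism ?K (M ` ?K) M g"
    using homeomorphism_compact[OF K contM refl injM] by blast
  have contL: "continuous_on W\<^sub>1 L" unfolding L
    by (intro continuous_intros continuous_on_subset[OF cont(1) W1U(2)] continuous_on_subset[OF \<nu>(1) W1U(2)])
  define \<psi> where "\<psi> q = g (L q)" for q
  have \<psi>: "\<psi> q \<in> ?K" "M (\<psi> q) = L q" if "q \<in> W\<^sub>1" for q
  proof -
    have "L q \<in> M ` ?K" using LM that by blast
    then show "\<psi> q \<in> ?K" "M (\<psi> q) = L q"
      using g unfolding \<psi>_def homeomorphism_def by blast+
  qed
  have cont\<psi>: "continuous_on W\<^sub>1 \<psi>" unfolding \<psi>_def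
    by (rule continuous_on_compose2[OF homeomorphism_cont2[OF g] contL LM])
  have inj\<psi>: "inj_on \<psi> W\<^sub>1"
  proof (rule inj_onI)
    fix x y assume xy: "x \<in> W\<^sub>1" "y \<in> W\<^sub>1" "\<psi> x = \<psi> y"
    then have "L x = L y" using \<psi>(2) by metis
    then show "x = y" using inj_onD[OF N1(4)] xy W1U(1) unfolding L_def by blast
  qed
  obtain s where s: "0 < s" "cball p\<^sub>1 s \<subseteq> W\<^sub>1" using W1 pW1 open_contains_cball by blast
  define V\<^sub>1 where "V\<^sub>1 = ball p\<^sub>1 s"
  have V1W: "V\<^sub>1 \<subseteq> W\<^sub>1" using s(2) ball_subset_cball unfolding V\<^sub>1_def by blast
  have V1: "open V\<^sub>1" "connected V\<^sub>1" "p\<^sub>1 \<in> V\<^sub>1" using s(1) by (auto simp: V\<^sub>1_def)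
  have c1: "continuous_on V\<^sub>1 \<psi>" and i1: "inj_on \<psi> V\<^sub>1"
    using continuous_on_subset[OF cont\<psi> V1W] inj_on_subset[OF inj\<psi> V1W] by auto
  obtain \<phi> where \<phi>: "homeomorphism V\<^sub>1 (\<psi> ` V\<^sub>1) \<psi> \<phi>"
    using invariance_of_domain_homeomorphism[OF V1(1) c1 order_refl i1] by blast
  show thesis
  proof (rule that[OF V1 _ _ _ _ _ \<phi> \<sigma>])
    show "closure V\<^sub>1 \<subseteq> U\<^sub>1" using s W1U(2) unfolding V\<^sub>1_def by (simp add: closure_ball)
    show "open (\<psi> ` V\<^sub>1)" by (rule invariance_of_domain[OF c1 V1(1) i1])
    show "connected (\<psi> ` V\<^sub>1)" by (rule connected_continuous_image[OF c1 V1(2)])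
    have "f\<^sub>2 (\<psi> p\<^sub>1) = f\<^sub>2 p\<^sub>2" using \<psi>(2)[OF pW1] P by (simp add: M_def L)
    then have "\<psi> p\<^sub>1 \<in> {x \<in> U\<^sub>2. f\<^sub>2 x = f\<^sub>2 p\<^sub>2}" using \<psi>(1)[OF pW1] by simp
    then have "\<psi> p\<^sub>1 = p\<^sub>2" unfolding fib by simp
    then show "p\<^sub>2 \<in> \<psi> ` V\<^sub>1" using V1(3) by blast
    have "closure (\<psi> ` V\<^sub>1) \<subseteq> ?K"
      using \<psi>(1) V1W by (intro closure_minimal compact_imp_closed[OF K]) blast
    then show "closure (\<psi> ` V\<^sub>1) \<subseteq> U\<^sub>2" using KU by blast
    show "f\<^sub>1 x = f\<^sub>2 (\<psi> x) \<and> \<nu>\<^sub>1 x = \<sigma> *\<^sub>R \<nu>\<^sub>2 (\<psi> x)" if "x \<in> V\<^sub>1" for x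
      using \<psi>(2)[of x] that V1W by (auto simp: M_def L)
  qed
qed

lemma wave_front_locally_injective:
  fixes f :: "real ^ 'n \<Rightarrow> real ^ 'm"
  assumes wf: "wave_front r U f \<nu>" and p: "p \<in> U"
  shows "locally_injective_at (legendrian_lift f \<nu>) U p"
proof -
  have U: "open U" and f: "Cr_map_on r f U" "Cr_map_on r \<nu> U"
    and imm: "immersion_at (legendrian_lift f \<nu>) p"
    using wf p by (auto simp: wave_front_def frontal_map_def unit_normal_field_def)
  have "Cr_map_on r (legendrian_lift f \<nu>) U"
    using Cr_map_on_Pair_scaleR[OF f U, of 1] unfolding legendrian_lift_def[abs_def] by simp
  from C1_immersion_locally_injective[OF Cr_map_on_imp_C1[OF this U] U p imm]
  obtain e where "0 < e" "ball p e \<subseteq> U" "inj_on (legendrian_lift f \<nu>) (ball p e)" .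
  then show ?thesis unfolding locally_injective_at_def
    by (intro exI[of _ "ball p e"]) auto
qed

text \<open>Changing the sign of the normal is a linear isomorphism of the ambient space of the lift.\<close>

lemma wave_front_signed_lift:
  fixes f :: "real ^ 'n \<Rightarrow> real ^ 'm" and \<sigma> :: real
  assumes wf: "wave_front r U f \<nu>" and \<sigma>: "\<sigma> = 1 \<or> \<sigma> = - 1"
  shows "Cr_map_on r (\<lambda>x. (f x, \<sigma> *\<^sub>R \<nu> x)) U" (is "Cr_map_on r ?M U")
    and "x \<in> U \<Longrightarrow> immersion_at (\<lambda>x. (f x, \<sigma> *\<^sub>R \<nu> x)) x"
proof -
  have U: "open U" and f: "Cr_map_on r f U" "Cr_map_on r \<nu> U"
    using wf by (auto simp: wave_front_def frontal_map_def unit_normal_field_def)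
  show M: "Cr_map_on r ?M U" by (rule Cr_map_on_Pair_scaleR[OF f U])
  assume x: "x \<in> U"
  have imm: "immersion_at (legendrian_lift f \<nu>) x" using wf x by (auto simp: wave_front_def)
  have bl: "bounded_linear (\<lambda>y :: (real ^ 'm) \<times> (real ^ 'm). (fst y, \<sigma> *\<^sub>R snd y))"
    by (intro bounded_linear_Pair bounded_linear_fst
        bounded_linear_compose[OF bounded_linear_scaleR_right bounded_linear_snd])
  have eq: "(\<lambda>z. (\<lambda>y. (fst y, \<sigma> *\<^sub>R snd y)) (f z, \<sigma> *\<^sub>R \<nu> z)) = legendrian_lift f \<nu>"
    using \<sigma> by (auto simp: legendrian_lift_def)
  show "immersion_at ?M x"
  proof (rule immersion_at_of_linear_image[OF bl])
    show "?M differentiable at x"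
      using times_cont_diff_on_differentiable[OF Cr_map_on_imp_C1[OF M U] x] by (auto simp: differentiable_def)
    show "immersion_at (\<lambda>z. (\<lambda>y. (fst y, \<sigma> *\<^sub>R snd y)) (f z, \<sigma> *\<^sub>R \<nu> z)) x"
      unfolding eq by (rule imm)
  qed
qed

theorem theoremA:
  fixes r :: regularity
    and U\<^sub>1 U\<^sub>2 :: "(real ^ 'n) set"
    and p\<^sub>1 p\<^sub>2 :: "real ^ 'n"
    and f\<^sub>1 f\<^sub>2 \<nu>\<^sub>1 \<nu>\<^sub>2 :: "real ^ 'n \<Rightarrow> real ^ 'm"
    and P :: "real ^ 'm"
  assumes dim: "CARD('m) = CARD('n) + 1"
    and nbhd: "open U\<^sub>1" "p\<^sub>1 \<in> U\<^sub>1" "open U\<^sub>2" "p\<^sub>2 \<in> U\<^sub>2"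
    and frontal: "frontal_map r U\<^sub>1 f\<^sub>1" "frontal_map r U\<^sub>2 f\<^sub>2"
    and normal: "unit_normal_field r U\<^sub>1 f\<^sub>1 \<nu>\<^sub>1" "unit_normal_field r U\<^sub>2 f\<^sub>2 \<nu>\<^sub>2"
    and a1: "f\<^sub>1 ` U\<^sub>1 \<subseteq> f\<^sub>2 ` U\<^sub>2" "P = f\<^sub>1 p\<^sub>1" "f\<^sub>1 p\<^sub>1 = f\<^sub>2 p\<^sub>2"
    and a2: "proper_at f\<^sub>2 U\<^sub>2 p\<^sub>2" "{x \<in> U\<^sub>2. f\<^sub>2 x = P} = {p\<^sub>2}"
    and a3: "open (regular_set f\<^sub>1 U\<^sub>1)" "U\<^sub>1 \<subseteq> closure (regular_set f\<^sub>1 U\<^sub>1)"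
            "open (regular_set f\<^sub>2 U\<^sub>2)" "U\<^sub>2 \<subseteq> closure (regular_set f\<^sub>2 U\<^sub>2)"
  shows
    "(wave_front r U\<^sub>1 f\<^sub>1 \<nu>\<^sub>1 \<longrightarrow> locally_injective_at (legendrian_lift f\<^sub>1 \<nu>\<^sub>1) U\<^sub>1 p\<^sub>1) \<and>
     (wave_front r U\<^sub>2 f\<^sub>2 \<nu>\<^sub>2 \<longrightarrow> locally_injective_at (legendrian_lift f\<^sub>2 \<nu>\<^sub>2) U\<^sub>2 p\<^sub>2) \<and>
     (locally_injective_at (legendrian_lift f\<^sub>1 \<nu>\<^sub>1) U\<^sub>1 p\<^sub>1 \<and>
      locally_injective_at (legendrian_lift f\<^sub>2 \<nu>\<^sub>2) U\<^sub>2 p\<^sub>2 \<longrightarrow>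
        (\<exists>V\<^sub>1 V\<^sub>2 \<psi> \<phi>.
           open V\<^sub>1 \<and> connected V\<^sub>1 \<and> p\<^sub>1 \<in> V\<^sub>1 \<and> open V\<^sub>2 \<and> connected V\<^sub>2 \<and> p\<^sub>2 \<in> V\<^sub>2 \<and>
           homeomorphism V\<^sub>1 V\<^sub>2 \<psi> \<phi> \<and>
           closure V\<^sub>1 \<subseteq> U\<^sub>1 \<and> closure V\<^sub>2 \<subseteq> U\<^sub>2 \<and>
           (\<forall>x\<in>V\<^sub>1. f\<^sub>1 x = f\<^sub>2 (\<psi> x)) \<and>
           ((\<forall>x\<in>V\<^sub>1. \<nu>\<^sub>1 x = \<nu>\<^sub>2 (\<psi> x)) \<or> (\<forall>x\<in>V\<^sub>1. \<nu>\<^sub>1 x = - \<nu>\<^sub>2 (\<psi> x)))) \<and>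
        (wave_front r U\<^sub>1 f\<^sub>1 \<nu>\<^sub>1 \<and> wave_front r U\<^sub>2 f\<^sub>2 \<nu>\<^sub>2 \<longrightarrow>
          (\<exists>V\<^sub>1 V\<^sub>2 \<psi> \<phi>.
             open V\<^sub>1 \<and> connected V\<^sub>1 \<and> p\<^sub>1 \<in> V\<^sub>1 \<and> open V\<^sub>2 \<and> connected V\<^sub>2 \<and> p\<^sub>2 \<in> V\<^sub>2 \<and>
             Cr_diffeomorphism r V\<^sub>1 V\<^sub>2 \<psi> \<phi> \<and>
             closure V\<^sub>1 \<subseteq> U\<^sub>1 \<and> closure V\<^sub>2 \<subseteq> U\<^sub>2 \<and>
             (\<forall>x\<in>V\<^sub>1. f\<^sub>1 x = f\<^sub>2 (\<psi> x)) \<and>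
             ((\<forall>x\<in>V\<^sub>1. \<nu>\<^sub>1 x = \<nu>\<^sub>2 (\<psi> x)) \<or> (\<forall>x\<in>V\<^sub>1. \<nu>\<^sub>1 x = - \<nu>\<^sub>2 (\<psi> x))))))"
proof -
  let ?L\<^sub>1 = "legendrian_lift f\<^sub>1 \<nu>\<^sub>1" and ?L\<^sub>2 = "legendrian_lift f\<^sub>2 \<nu>\<^sub>2"
  have Cr: "Cr_map_on r f\<^sub>1 U\<^sub>1" "Cr_map_on r f\<^sub>2 U\<^sub>2" "Cr_map_on r \<nu>\<^sub>1 U\<^sub>1" "Cr_map_on r \<nu>\<^sub>2 U\<^sub>2"
    using frontal normal by (auto simp: frontal_map_def unit_normal_field_def)
  have unit: "norm (\<nu>\<^sub>1 x) = 1" if "x \<in> U\<^sub>1" for x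
    using normal(1) that by (auto simp: unit_normal_field_def)
  have unit': "norm (\<nu>\<^sub>2 x) = 1" if "x \<in> U\<^sub>2" for x
    using normal(2) that by (auto simp: unit_normal_field_def)
  have orth: "\<nu>\<^sub>1 x \<bullet> frechet_derivative f\<^sub>1 (at x) v = 0" if "x \<in> U\<^sub>1" for x v
    using normal(1) that by (simp add: unit_normal_field_def)
  have orth': "\<nu>\<^sub>2 x \<bullet> frechet_derivative f\<^sub>2 (at x) v = 0" if "x \<in> U\<^sub>2" for x v
    using normal(2) that by (simp add: unit_normal_field_def)
  have fib: "{x \<in> U\<^sub>2. f\<^sub>2 x = f\<^sub>2 p\<^sub>2} = {p\<^sub>2}" using a1 a2(2) by simp
  have main: "\<exists>V\<^sub>1 V\<^sub>2 \<psi> \<phi>.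
      open V\<^sub>1 \<and> connected V\<^sub>1 \<and> p\<^sub>1 \<in> V\<^sub>1 \<and> open V\<^sub>2 \<and> connected V\<^sub>2 \<and> p\<^sub>2 \<in> V\<^sub>2 \<and>
      homeomorphism V\<^sub>1 V\<^sub>2 \<psi> \<phi> \<and> closure V\<^sub>1 \<subseteq> U\<^sub>1 \<and> closure V\<^sub>2 \<subseteq> U\<^sub>2 \<and>
      (\<forall>x\<in>V\<^sub>1. f\<^sub>1 x = f\<^sub>2 (\<psi> x)) \<and>
      ((\<forall>x\<in>V\<^sub>1. \<nu>\<^sub>1 x = \<nu>\<^sub>2 (\<psi> x)) \<or> (\<forall>x\<in>V\<^sub>1. \<nu>\<^sub>1 x = - \<nu>\<^sub>2 (\<psi> x))) \<and>
      (wave_front r U\<^sub>1 f\<^sub>1 \<nu>\<^sub>1 \<and> wave_front r U\<^sub>2 f\<^sub>2 \<nu>\<^sub>2 \<longrightarrow> Cr_diffeomorphism r V\<^sub>1 V\<^sub>2 \<psi> \<phi>)"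
    if inj: "locally_injective_at ?L\<^sub>1 U\<^sub>1 p\<^sub>1" "locally_injective_at ?L\<^sub>2 U\<^sub>2 p\<^sub>2"
  proof -
    obtain V\<^sub>1 V\<^sub>2 \<psi> \<phi> \<sigma> where
      V1: "open V\<^sub>1" "connected V\<^sub>1" "p\<^sub>1 \<in> V\<^sub>1" "closure V\<^sub>1 \<subseteq> U\<^sub>1" and
      V2: "open V\<^sub>2" "connected V\<^sub>2" "p\<^sub>2 \<in> V\<^sub>2" "closure V\<^sub>2 \<subseteq> U\<^sub>2" and
      hom: "homeomorphism V\<^sub>1 V\<^sub>2 \<psi> \<phi>" and \<sigma>: "\<sigma> = 1 \<or> \<sigma> = (- 1 :: real)" and
      eq: "\<And>x. x \<in> V\<^sub>1 \<Longrightarrow> f\<^sub>1 x = f\<^sub>2 (\<psi> x) \<and> \<nu>\<^sub>1 x = \<sigma> *\<^sub>R \<nu>\<^sub>2 (\<psi> x)"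
      using frontal_reparametrization[OF dim nbhd(1,3) nbhd(2,4) Cr_map_on_imp_C1[OF Cr(1) nbhd(1)]
          Cr_map_on_imp_C1[OF Cr(2) nbhd(3)] times_cont_diff_on_continuous[OF Cr_map_on_imp_C1[OF Cr(3) nbhd(1)]]
          times_cont_diff_on_continuous[OF Cr_map_on_imp_C1[OF Cr(4) nbhd(3)]] unit unit' orth orth' a1(1,3) a2(1) fib a3(1,2) inj]
      by blast
    have sub: "V\<^sub>1 \<subseteq> U\<^sub>1" "V\<^sub>2 \<subseteq> U\<^sub>2" using V1(4) V2(4) closure_subset by blast+
    have "Cr_diffeomorphism r V\<^sub>1 V\<^sub>2 \<psi> \<phi>"
      if wf: "wave_front r U\<^sub>1 f\<^sub>1 \<nu>\<^sub>1" "wave_front r U\<^sub>2 f\<^sub>2 \<nu>\<^sub>2"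
    proof -
      let ?L = "\<lambda>x. (f\<^sub>1 x, 1 *\<^sub>R \<nu>\<^sub>1 x)" and ?M = "\<lambda>x. (f\<^sub>2 x, \<sigma> *\<^sub>R \<nu>\<^sub>2 x)"
      note L = wave_front_signed_lift[OF wf(1), of 1] and M = wave_front_signed_lift[OF wf(2) \<sigma>]
      have L': "Cr_map_on r ?L V\<^sub>1" and M': "Cr_map_on r ?M V\<^sub>2"
        using Cr_map_on_subset L(1) M(1) sub V1(1) V2(1) by blast+
      have "Cr_map_on r \<psi> V\<^sub>1"
      proof (rule Cr_lift[OF V1(1) V2(1) L' M'])
        show "immersion_at ?M x" if "x \<in> V\<^sub>2" for x using M(2) sub(2) that by blast
        show "continuous_on V\<^sub>1 \<psi>" by (rule homeomorphism_cont1[OF hom])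
        show "\<psi> ` V\<^sub>1 \<subseteq> V\<^sub>2" using homeomorphism_image1[OF hom] by blast
        show "?M (\<psi> x) = ?L x" if "x \<in> V\<^sub>1" for x using eq[OF that] by simp
      qed
      moreover have "Cr_map_on r \<phi> V\<^sub>2"
      proof (rule Cr_lift[OF V2(1) V1(1) M' L'])
        show "immersion_at ?L x" if "x \<in> V\<^sub>1" for x using L(2) sub(1) that by blast
        show "continuous_on V\<^sub>2 \<phi>" by (rule homeomorphism_cont2[OF hom])
        show im: "\<phi> ` V\<^sub>2 \<subseteq> V\<^sub>1" using homeomorphism_image2[OF hom] by blast
        show "?L (\<phi> x) = ?M x" if "x \<in> V\<^sub>2" for x
          using eq[of "\<phi> x"] im that homeomorphism_apply2[OF hom that] by auto
      qed
      ultimately show ?thesis using V1(1) V2(1) hom by (simp add: Cr_diffeomorphism_def)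
    qed
    moreover have "(\<forall>x\<in>V\<^sub>1. \<nu>\<^sub>1 x = \<nu>\<^sub>2 (\<psi> x)) \<or> (\<forall>x\<in>V\<^sub>1. \<nu>\<^sub>1 x = - \<nu>\<^sub>2 (\<psi> x))"
      using \<sigma> eq by auto
    ultimately show ?thesis using V1 V2 hom eq by blast
  qed
  show ?thesis
  proof (intro conjI impI)
    show "locally_injective_at ?L\<^sub>1 U\<^sub>1 p\<^sub>1" if "wave_front r U\<^sub>1 f\<^sub>1 \<nu>\<^sub>1"
      by (rule wave_front_locally_injective[OF that nbhd(2)])
    show "locally_injective_at ?L\<^sub>2 U\<^sub>2 p\<^sub>2" if "wave_front r U\<^sub>2 f\<^sub>2 \<nu>\<^sub>2"
      by (rule wave_front_locally_injective[OF that nbhd(4)])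
  next
    assume "locally_injective_at ?L\<^sub>1 U\<^sub>1 p\<^sub>1 \<and> locally_injective_at ?L\<^sub>2 U\<^sub>2 p\<^sub>2"
    then obtain V\<^sub>1 V\<^sub>2 \<psi> \<phi> where *: "open V\<^sub>1" "connected V\<^sub>1" "p\<^sub>1 \<in> V\<^sub>1" "open V\<^sub>2" "connected V\<^sub>2"
      "p\<^sub>2 \<in> V\<^sub>2" "homeomorphism V\<^sub>1 V\<^sub>2 \<psi> \<phi>" "closure V\<^sub>1 \<subseteq> U\<^sub>1" "closure V\<^sub>2 \<subseteq> U\<^sub>2"
      "\<forall>x\<in>V\<^sub>1. f\<^sub>1 x = f\<^sub>2 (\<psi> x)"
      "(\<forall>x\<in>V\<^sub>1. \<nu>\<^sub>1 x = \<nu>\<^sub>2 (\<psi> x)) \<or> (\<forall>x\<in>V\<^sub>1. \<nu>\<^sub>1 x = - \<nu>\<^sub>2 (\<psi> x))"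
      "wave_front r U\<^sub>1 f\<^sub>1 \<nu>\<^sub>1 \<and> wave_front r U\<^sub>2 f\<^sub>2 \<nu>\<^sub>2 \<longrightarrow> Cr_diffeomorphism r V\<^sub>1 V\<^sub>2 \<psi> \<phi>"
      using main by blast
    show "\<exists>V\<^sub>1 V\<^sub>2 \<psi> \<phi>.
        open V\<^sub>1 \<and> connected V\<^sub>1 \<and> p\<^sub>1 \<in> V\<^sub>1 \<and> open V\<^sub>2 \<and> connected V\<^sub>2 \<and> p\<^sub>2 \<in> V\<^sub>2 \<and>
        homeomorphism V\<^sub>1 V\<^sub>2 \<psi> \<phi> \<and> closure V\<^sub>1 \<subseteq> U\<^sub>1 \<and> closure V\<^sub>2 \<subseteq> U\<^sub>2 \<and>
        (\<forall>x\<in>V\<^sub>1. f\<^sub>1 x = f\<^sub>2 (\<psi> x)) \<and>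
        ((\<forall>x\<in>V\<^sub>1. \<nu>\<^sub>1 x = \<nu>\<^sub>2 (\<psi> x)) \<or> (\<forall>x\<in>V\<^sub>1. \<nu>\<^sub>1 x = - \<nu>\<^sub>2 (\<psi> x)))"
      by (rule exI[of _ V\<^sub>1], rule exI[of _ V\<^sub>2], rule exI[of _ \<psi>], rule exI[of _ \<phi>]) (intro conjI *(1-11))
    assume "wave_front r U\<^sub>1 f\<^sub>1 \<nu>\<^sub>1 \<and> wave_front r U\<^sub>2 f\<^sub>2 \<nu>\<^sub>2"
    with *(12) have diffeo: "Cr_diffeomorphism r V\<^sub>1 V\<^sub>2 \<psi> \<phi>" by blast
    show "\<exists>V\<^sub>1 V\<^sub>2 \<psi> \<phi>.
        open V\<^sub>1 \<and> connected V\<^sub>1 \<and> p\<^sub>1 \<in> V\<^sub>1 \<and> open V\<^sub>2 \<and> connected V\<^sub>2 \<and> p\<^sub>2 \<in> V\<^sub>2 \<and>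
        Cr_diffeomorphism r V\<^sub>1 V\<^sub>2 \<psi> \<phi> \<and> closure V\<^sub>1 \<subseteq> U\<^sub>1 \<and> closure V\<^sub>2 \<subseteq> U\<^sub>2 \<and>
        (\<forall>x\<in>V\<^sub>1. f\<^sub>1 x = f\<^sub>2 (\<psi> x)) \<and>
        ((\<forall>x\<in>V\<^sub>1. \<nu>\<^sub>1 x = \<nu>\<^sub>2 (\<psi> x)) \<or> (\<forall>x\<in>V\<^sub>1. \<nu>\<^sub>1 x = - \<nu>\<^sub>2 (\<psi> x)))"
      by (rule exI[of _ V\<^sub>1], rule exI[of _ V\<^sub>2], rule exI[of _ \<psi>], rule exI[of _ \<phi>])
        (intro conjI *(1-6,8-11) diffeo)
  qed
qed

end
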